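(* Let $G$ be a group, and let $\rho\colon G\to\exp(L)$ be a Malcev completion of $G$, where $L$ is a Malcev Lie algebra. Then, for all $i\ge1$, the Malcev completion of the derived quotient $G/G^{(i)}$ is given by $$\widehat{G/G^{(i)}}=\exp\big(L/\overline{L^{(i)}}\big);$$ that is, the homomorphism $\rho^{(i)}\colon G/G^{(i)}\to\exp(L/\overline{L^{(i)}})$ induced by $\rho$ is a Malcev completion of $G/G^{(i)}$. Here $\overline{L^{(i)}}$ is the closure of $L^{(i)}$ in the filtration topology of $L$, and $L/\overline{L^{(i)}}$ carries the filtration induced from $L$.
   Context: Derived series: $G^{(0)}=G$, $G^{(i+1)}=(G^{(i)},G^{(i)})$ for groups, $L^{(0)}=L$, $L^{(i+1)}=[L^{(i)},L^{(i)}]$ for Lie algebras. Lower central series: $\Gamma_1G=G$, $\Gamma_{r+1}G=(\Gamma_rG,G)$. A Malcev Lie algebra is a $\mathbb{Q}$-Lie algebra $L$ with a complete descending $\mathbb{Q}$-vector space filtration $\{F_rL\}_{r\ge1}$ (i.e. $L\to\varprojlim_rL/F_rL$ is an isomorphism) such that $F_1L=L$, $[F_rL,F_sL]\subset F_{r+s}L$ for all $r,s$, and the Lie algebra $\operatorname{gr}(L)=\bigoplus_{r\ge1}F_rL/F_{r+1}L$ is generated in degree $1$. Its exponential group $\exp(L)$ is the set $L$ with the Campbell–Hausdorff multiplication $x\cdot y=x+y+\frac12[x,y]+\cdots$, filtered by the normal subgroups $\exp(F_rL)$. A Malcev completion of a group $G$ is a group homomorphism $\rho\colon G\to\exp(L)$,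 $L$ a Malcev Lie algebra, such that for each $r\ge1$ the induced map $\rho_r\colon G/\Gamma_rG\to\exp(L/F_rL)$ has the following universal property: for every homomorphism $f_r\colon G/\Gamma_rG\to\exp(\widetilde L)$ with $\widetilde L$ a nilpotent Malcev Lie algebra, there is a unique homomorphism $\tilde f_r\colon\exp(L/F_rL)\to\exp(\widetilde L)$ with $\tilde f_r\circ\rho_r=f_r$. The Malcev Lie algebra $L$ is determined up to isomorphism by this property, and the corresponding filtered group is denoted $\widehat G$. For any homomorphism $\rho\colon G\to\exp(L)$ one has $\rho(G^{(i)})\subset\exp(\overline{L^{(i)}})$ for $i\ge1$, so $\rho$ induces $\rho^{(i)}\colon G/G^{(i)}\to\exp(L/\overline{L^{(i)}})$; since $\overline{L^{(i)}}$ is a closed ideal, $L/\overline{L^{(i)}}$ with the induced filtration is a Malcev Lie algebra. *)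

theory Defs
  imports
    "HOL-Algebra.Generated_Groups"
    "HOL-Algebra.Module"
    "HOL-Algebra.QuotRing"
    "HOL-Analysis.Abstract_Limits"
begin

section \<open>Lie algebras over the rationals\<close>

definition rat_ring :: "rat ring" where
  "rat_ring = \<lparr>carrier = UNIV, mult = (*), one = 1, zero = 0, add = (+)\<rparr>"

text \<open>
  A Lie algebra is a nonassociative algebra, so it is stored in the \<^typ>\<open>(rat, 'a) module\<close>
  record with the bracket in the \<^const>\<open>mult\<close> field: \<open>x \<otimes> y\<close> is \<open>[x, y]\<close>.
  The \<^const>\<open>one\<close> field has no meaning and is never used.
\<close>

type_synonym 'a lie_record = "(rat, 'a) module"

locale rat_lie_algebra = Module.module rat_ring L for L :: "'a lie_record" (structure) +
  assumes bracket_closed: "\<lbrakk>x \<in> carrier L; y \<in> carrier L\<rbrakk> \<Longrightarrow> x \<otimes> y \<in> carrier L"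
    and bracket_add_left: "\<lbrakk>x \<in> carrier L; y \<in> carrier L; z \<in> carrier L\<rbrakk>
      \<Longrightarrow> (x \<oplus> y) \<otimes> z = (x \<otimes> z) \<oplus> (y \<otimes> z)"
    and bracket_add_right: "\<lbrakk>x \<in> carrier L; y \<in> carrier L; z \<in> carrier L\<rbrakk>
      \<Longrightarrow> z \<otimes> (x \<oplus> y) = (z \<otimes> x) \<oplus> (z \<otimes> y)"
    and bracket_smult_left: "\<lbrakk>x \<in> carrier L; y \<in> carrier L\<rbrakk>
      \<Longrightarrow> (q \<odot> x) \<otimes> y = q \<odot> (x \<otimes> y)"
    and bracket_smult_right: "\<lbrakk>x \<in> carrier L; y \<in> carrier L\<rbrakk>
      \<Longrightarrow> x \<otimes> (q \<odot> y) = q \<odot> (x \<otimes> y)"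
    and bracket_self: "x \<in> carrier L \<Longrightarrow> x \<otimes> x = \<zero>"
    and jacobi: "\<lbrakk>x \<in> carrier L; y \<in> carrier L; z \<in> carrier L\<rbrakk>
      \<Longrightarrow> x \<otimes> (y \<otimes> z) \<oplus> y \<otimes> (z \<otimes> x) \<oplus> z \<otimes> (x \<otimes> y) = \<zero>"

definition rat_span :: "'a lie_record \<Rightarrow> 'a set \<Rightarrow> 'a set" where
  "rat_span L S = \<Inter>{H. submodule H rat_ring L \<and> S \<subseteq> H}"

definition lie_product :: "'a lie_record \<Rightarrow> 'a set \<Rightarrow> 'a set \<Rightarrow> 'a set" where
  "lie_product L A B = rat_span L {a \<otimes>\<^bsub>L\<^esub> b | a b. a \<in> A \<and> b \<in> B}"

definition lie_subalgebra :: "'a lie_record \<Rightarrow> 'a set \<Rightarrow> bool" where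
  "lie_subalgebra L K \<longleftrightarrow>
     submodule K rat_ring L \<and> (\<forall>x\<in>K. \<forall>y\<in>K. x \<otimes>\<^bsub>L\<^esub> y \<in> K)"

definition lie_generated :: "'a lie_record \<Rightarrow> 'a set \<Rightarrow> 'a set" where
  "lie_generated L S = \<Inter>{K. lie_subalgebra L K \<and> S \<subseteq> K}"

primrec lie_derived :: "'a lie_record \<Rightarrow> nat \<Rightarrow> 'a set" where
  "lie_derived L 0 = carrier L"
| "lie_derived L (Suc i) = lie_product L (lie_derived L i) (lie_derived L i)"

text \<open>The index is shifted: \<open>lie_lcs L n\<close> is the (n+1)-st term of the lower central series.\<close>

primrec lie_lcs :: "'a lie_record \<Rightarrow> nat \<Rightarrow> 'a set" where
  "lie_lcs L 0 = carrier L"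
| "lie_lcs L (Suc n) = lie_product L (lie_lcs L n) (carrier L)"

definition lie_nilpotent :: "'a lie_record \<Rightarrow> bool" where
  "lie_nilpotent L \<longleftrightarrow> (\<exists>n. lie_lcs L n = {\<zero>\<^bsub>L\<^esub>})"

definition lie_quotient :: "'a lie_record \<Rightarrow> 'a set \<Rightarrow> 'a set lie_record" where
  "lie_quotient L I =
     \<lparr>carrier = a_rcosets\<^bsub>L\<^esub> I,
      mult = rcoset_mult L I,
      one = undefined,
      zero = I,
      add = set_add L,
      smult = (\<lambda>q A. \<Union>a\<in>A. I +>\<^bsub>L\<^esub> (q \<odot>\<^bsub>L\<^esub> a))\<rparr>"


section \<open>Malcev Lie algebras\<close>

text \<open>
  A filtration is a function on \<^typ>\<open>nat\<close> of which only the values at indices \<open>\<ge> 1\<close> matter.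
\<close>

definition filtration_limit :: "'a lie_record \<Rightarrow> (nat \<Rightarrow> 'a set) \<Rightarrow> (nat \<Rightarrow> 'a set) set" where
  "filtration_limit L F =
     {c \<in> (\<Pi>\<^sub>E r\<in>{1..}. carrier (lie_quotient L (F r))).
        \<forall>r\<ge>1. F r <+>\<^bsub>L\<^esub> c (Suc r) = c r}"

text \<open>
  The canonical map to the projective limit is always linear, so it is an isomorphism
  as soon as it is bijective.
\<close>

definition filtration_complete :: "'a lie_record \<Rightarrow> (nat \<Rightarrow> 'a set) \<Rightarrow> bool" where
  "filtration_complete L F \<longleftrightarrow>
     bij_betw (\<lambda>x. \<lambda>r\<in>{1..}. F r +>\<^bsub>L\<^esub> x) (carrier L) (filtration_limit L F)"

definition gr_piece :: "'a lie_record \<Rightarrow> (nat \<Rightarrow> 'a set) \<Rightarrow> nat \<Rightarrow> 'a set lie_record" where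
  "gr_piece L F r = lie_quotient (L\<lparr>carrier := F r\<rparr>) (F (Suc r))"

text \<open>
  The direct sum of the pieces in degrees \<open>\<ge> 1\<close>, realised as finitely supported families; the
  bracket is the graded one, in which the classes of \<open>x \<in> F r\<close> and \<open>y \<in> F s\<close> have as bracket the
  class of \<open>[x, y]\<close> in degree \<open>r + s\<close>.
\<close>

definition gr :: "'a lie_record \<Rightarrow> (nat \<Rightarrow> 'a set) \<Rightarrow> (nat \<Rightarrow> 'a set) lie_record" where
  "gr L F =
     \<lparr>carrier = {c \<in> (\<Pi>\<^sub>E r\<in>{1..}. carrier (gr_piece L F r)).
                   finite {r. r \<ge> 1 \<and> c r \<noteq> \<zero>\<^bsub>gr_piece L F r\<^esub>}},
      mult = (\<lambda>c d. \<lambda>n\<in>{1..}.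
                \<Oplus>\<^bsub>gr_piece L F n\<^esub>r\<in>{1..<n}. rcoset_mult L (F (Suc n)) (c r) (d (n - r))),
      one = undefined,
      zero = (\<lambda>r\<in>{1..}. \<zero>\<^bsub>gr_piece L F r\<^esub>),
      add = (\<lambda>c d. \<lambda>r\<in>{1..}. c r \<oplus>\<^bsub>gr_piece L F r\<^esub> d r),
      smult = (\<lambda>q c. \<lambda>r\<in>{1..}. q \<odot>\<^bsub>gr_piece L F r\<^esub> c r)\<rparr>"

definition gr_degree_one :: "'a lie_record \<Rightarrow> (nat \<Rightarrow> 'a set) \<Rightarrow> (nat \<Rightarrow> 'a set) set" where
  "gr_degree_one L F = {c \<in> carrier (gr L F). \<forall>r\<ge>2. c r = \<zero>\<^bsub>gr_piece L F r\<^esub>}"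

definition malcev_lie_algebra :: "'a lie_record \<Rightarrow> (nat \<Rightarrow> 'a set) \<Rightarrow> bool" where
  "malcev_lie_algebra L F \<longleftrightarrow>
     rat_lie_algebra L \<and>
     (\<forall>r\<ge>1. submodule (F r) rat_ring L) \<and>
     (\<forall>r\<ge>1. F (Suc r) \<subseteq> F r) \<and>
     F 1 = carrier L \<and>
     filtration_complete L F \<and>
     (\<forall>r\<ge>1. \<forall>s\<ge>1. lie_product L (F r) (F s) \<subseteq> F (r + s)) \<and>
     lie_generated (gr L F) (gr_degree_one L F) = carrier (gr L F)"

definition filtration_topology :: "'a lie_record \<Rightarrow> (nat \<Rightarrow> 'a set) \<Rightarrow> 'a topology" where
  "filtration_topology L F =
     topology_generated_by {F r +>\<^bsub>L\<^esub> x | r x. r \<ge> 1 \<and> x \<in> carrier L}"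

definition derived_closure :: "'a lie_record \<Rightarrow> (nat \<Rightarrow> 'a set) \<Rightarrow> nat \<Rightarrow> 'a set" where
  "derived_closure L F i = filtration_topology L F closure_of lie_derived L i"

definition quotient_filtration ::
  "'a lie_record \<Rightarrow> 'a set \<Rightarrow> (nat \<Rightarrow> 'a set) \<Rightarrow> nat \<Rightarrow> 'a set set" where
  "quotient_filtration L I F r = (\<lambda>x. I +>\<^bsub>L\<^esub> x) ` F r"


section \<open>The exponential group\<close>

fun nested_bracket :: "'a lie_record \<Rightarrow> 'a list \<Rightarrow> 'a" where
  "nested_bracket L [] = \<zero>\<^bsub>L\<^esub>"
| "nested_bracket L [x] = x"
| "nested_bracket L (x # y # zs) = x \<otimes>\<^bsub>L\<^esub> nested_bracket L (y # zs)"

text \<open>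
  Campbell--Hausdorff series in Dynkin's form. Its component of total degree \<open>N\<close> is the sum, over
  all finite sequences \<open>(r\<^sub>1, s\<^sub>1), \<dots>, (r\<^sub>n, s\<^sub>n)\<close> of pairs different from \<open>(0, 0)\<close> with
  \<open>\<Sum> (r\<^sub>i + s\<^sub>i) = N\<close>, of the right-nested bracket of the word
  \<open>x^r\<^sub>1 y^s\<^sub>1 \<dots> x^r\<^sub>n y^s\<^sub>n\<close> with coefficient
  \<open>(-1)^(n-1) / (n N \<Prod> r\<^sub>i! s\<^sub>i!)\<close>.
\<close>

definition bch_index :: "nat \<Rightarrow> (nat \<times> nat) list set" where
  "bch_index N = {ps. (\<forall>(r, s)\<in>set ps. r + s > 0) \<and> (\<Sum>(r, s)\<leftarrow>ps. r + s) = N}"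

lemma finite_bch_index: "finite (bch_index N)"
proof -
  have *: "length ps \<le> N \<and> set ps \<subseteq> {..N} \<times> {..N}"
    if "\<forall>(r, s)\<in>set ps. r + s > 0" "(\<Sum>(r, s)\<leftarrow>ps. r + s) = N" for ps :: "(nat \<times> nat) list" and N
    using that
  proof (induction ps arbitrary: N)
    case (Cons p ps)
    obtain r s where p: "p = (r, s)" by (cases p)
    let ?M = "\<Sum>(r, s)\<leftarrow>ps. r + s"
    have "length ps \<le> ?M \<and> set ps \<subseteq> {..?M} \<times> {..?M}"
      using Cons by auto
    moreover have "N = r + s + ?M" "r + s > 0" using Cons.prems p by auto
    ultimately show ?case using p by fastforce
  qed auto
  have "bch_index N \<subseteq> {ps. set ps \<subseteq> {..N} \<times> {..N} \<and> length ps \<le> N}"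
    using * by (auto simp: bch_index_def)
  moreover have "finite {ps. set ps \<subseteq> {..N} \<times> {..N} \<and> length ps \<le> N}"
    by (rule finite_lists_length_le) auto
  ultimately show ?thesis by (rule finite_subset)
qed

definition bch_coeff :: "nat \<Rightarrow> (nat \<times> nat) list \<Rightarrow> rat" where
  "bch_coeff N ps = (-1) ^ (length ps - 1) /
     (of_nat (length ps) * of_nat N * (\<Prod>(r, s)\<leftarrow>ps. fact r * fact s))"

definition bch_word :: "(nat \<times> nat) list \<Rightarrow> 'a \<Rightarrow> 'a \<Rightarrow> 'a list" where
  "bch_word ps x y = concat (map (\<lambda>(r, s). replicate r x @ replicate s y) ps)"

definition bch_component :: "'a lie_record \<Rightarrow> nat \<Rightarrow> 'a \<Rightarrow> 'a \<Rightarrow> 'a" where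
  "bch_component L N x y =
     (\<Oplus>\<^bsub>L\<^esub>ps\<in>bch_index N. bch_coeff N ps \<odot>\<^bsub>L\<^esub> nested_bracket L (bch_word ps x y))"

definition bch :: "'a lie_record \<Rightarrow> (nat \<Rightarrow> 'a set) \<Rightarrow> 'a \<Rightarrow> 'a \<Rightarrow> 'a" where
  "bch L F x y =
     (THE z. limitin (filtration_topology L F)
               (\<lambda>M. \<Oplus>\<^bsub>L\<^esub>N\<in>{1..M}. bch_component L N x y) z sequentially)"

definition exp_group :: "'a lie_record \<Rightarrow> (nat \<Rightarrow> 'a set) \<Rightarrow> 'a monoid" where
  "exp_group L F = \<lparr>carrier = carrier L, mult = bch L F, one = \<zero>\<^bsub>L\<^esub>\<rparr>"


section \<open>Malcev completions\<close>

definition derived_series :: "('g, 'm) monoid_scheme \<Rightarrow> nat \<Rightarrow> 'g set" where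
  "derived_series G i = (derived G ^^ i) (carrier G)"

text \<open>The lower central series starts at index 1; the value at 0 is a dummy.\<close>

fun lower_central :: "('g, 'm) monoid_scheme \<Rightarrow> nat \<Rightarrow> 'g set" where
  "lower_central G 0 = carrier G"
| "lower_central G (Suc 0) = carrier G"
| "lower_central G (Suc (Suc r)) =
     generate G {x \<otimes>\<^bsub>G\<^esub> y \<otimes>\<^bsub>G\<^esub> inv\<^bsub>G\<^esub> x \<otimes>\<^bsub>G\<^esub> inv\<^bsub>G\<^esub> y | x y.
                   x \<in> lower_central G (Suc r) \<and> y \<in> carrier G}"

text \<open>
  The map of cosets induced by \<open>\<rho>\<close> modulo \<open>I\<close>. On a coset all of whose elements have the same
  image modulo \<open>I\<close> the union is that common image; otherwise it is not a single coset of \<open>I\<close>.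
\<close>

definition induced_map :: "'a lie_record \<Rightarrow> 'a set \<Rightarrow> ('g \<Rightarrow> 'a) \<Rightarrow> 'g set \<Rightarrow> 'a set" where
  "induced_map L I \<rho> A = (\<Union>g\<in>A. I +>\<^bsub>L\<^esub> \<rho> g)"

text \<open>
  HOL cannot quantify over types inside a formula, so the nilpotent Malcev Lie algebras against
  which the universal property is tested have carriers in a type \<open>'c\<close>, an explicit parameter.
  Being a Malcev completion in the unrestricted sense is having the property for all types \<open>'c\<close>.
\<close>

definition nilpotent_universal ::
  "'c itself \<Rightarrow> ('h, 'm) monoid_scheme \<Rightarrow> ('e, 'n) monoid_scheme \<Rightarrow> ('h \<Rightarrow> 'e) \<Rightarrow> bool" where
  "nilpotent_universal (_ :: 'c itself) H P \<sigma> \<longleftrightarrow>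
     (\<forall>(M :: 'c lie_record) E. malcev_lie_algebra M E \<and> lie_nilpotent M \<longrightarrow>
        (\<forall>f \<in> hom H (exp_group M E).
           \<exists>!\<phi>. \<phi> \<in> hom P (exp_group M E) \<and> \<phi> \<in> extensional (carrier P) \<and>
                (\<forall>h\<in>carrier H. \<phi> (\<sigma> h) = f h)))"

definition malcev_completion ::
  "'c itself \<Rightarrow> ('g, 'm) monoid_scheme \<Rightarrow> 'a lie_record \<Rightarrow> (nat \<Rightarrow> 'a set) \<Rightarrow> ('g \<Rightarrow> 'a) \<Rightarrow> bool"
where
  "malcev_completion T G L F \<rho> \<longleftrightarrow>
     malcev_lie_algebra L F \<and>
     \<rho> \<in> hom G (exp_group L F) \<and>
     (\<forall>r\<ge>1. nilpotent_universal T
        (G Mod lower_central G r)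
        (exp_group (lie_quotient L (F r)) (quotient_filtration L (F r) F))
        (induced_map L (F r) \<rho>))"

end

theory Submission
  imports Defs
begin

text \<open>
  No associativity of the Campbell--Hausdorff product is needed. Since \<open>bch (t x) (t y)\<close> has
  components \<open>t^N c\<^sub>N(x, y)\<close> with \<open>c\<^sub>1 = x + y\<close> and \<open>c\<^sub>2 = [x, y]/2\<close>, comparing coefficients of
  polynomials in \<open>t\<close> shows three things: homomorphisms between exponential groups of nilpotent
  algebras are Lie homomorphisms; the span \<open>K\<close> of the image of a homomorphism \<open>h\<close> from \<open>G\<close> to
  \<open>exp(M)\<close> is a Lie subalgebra; and the \<open>j\<close>-th derived algebra of \<open>K\<close> lies in the span of
  \<open>h(G^(j))\<close>. Now let \<open>f\<close> be a homomorphism from a nilpotent quotient of \<open>G/G^(i)\<close> to \<open>exp(M)\<close>. The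
  universal property of \<open>\<rho>\<close> extends it to \<open>\<phi> : L/F_r \<rightarrow> M\<close>, and the same property applied to \<open>K\<close>
  (a nilpotent Malcev Lie algebra for its lower central series) shows that \<open>\<phi>\<close> takes values in \<open>K\<close>.
  As \<open>K\<close> is solvable of length at most \<open>i\<close>, \<open>\<phi>\<close> kills the closure of \<open>L^(i)\<close>, and so it factors
  through \<open>L/(closure of L^(i))\<close>.
\<close>

text \<open>Two constraints shape the argument. The universal property speaks only of targets in the
  one type \<open>'c\<close>, so \<open>K\<close> must live in the same type as \<open>M\<close>: it
  is \<open>M\<close> with a smaller carrier. It gets its own lower central series because the
  filtration induced from \<open>M\<close> need not have an associated graded algebra generated in
  degree 1 (take the centre of a Heisenberg algebra). Moreover, a homomorphism of exponential groups
  is a priori only a map compatible with \<open>bch\<close>, neither linear nor filtered. What makes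
  coefficients comparable is that \<open>x\<close> commutes with itself: natural multiples of
  \<open>x\<close> are its powers, so every homomorphism respects them, and over a nilpotent algebra
  \<open>bch\<close> of such multiples is a polynomial. Uniqueness needs no second analysis of
  \<open>K\<close>. With \<open>I\<close> the closure of the derived algebra, the universal property
  for \<open>L/I\<close> concerns \<open>L/(I + F r)\<close>, onto which \<open>L/F r\<close> maps;
  two extensions pull back to extensions of one map on \<open>L/F r\<close>, where they agree by
  hypothesis.\<close>

definition lie_ideal :: "'a lie_record \<Rightarrow> 'a set \<Rightarrow> bool" where
  "lie_ideal L J \<longleftrightarrow> submodule J rat_ring L \<and> (\<forall>x\<in>carrier L. \<forall>y\<in>J. x \<otimes>\<^bsub>L\<^esub> y \<in> J)"

text \<open>One relation serves three purposes: approximation when \<open>W\<close> is a filtration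
  step, equality in a quotient when \<open>W\<close> is an ideal, and plain equality when
  \<open>W\<close> is \<open>{\<zero>}\<close>. Carrier membership is built in so that calculations
  with congruences also deliver it.\<close>

definition eq_mod :: "'a lie_record \<Rightarrow> 'a set \<Rightarrow> 'a \<Rightarrow> 'a \<Rightarrow> bool" where
  "eq_mod L W x y \<longleftrightarrow> x \<in> carrier L \<and> y \<in> carrier L \<and> x \<ominus>\<^bsub>L\<^esub> y \<in> W"

section \<open>The rationals as coefficient ring\<close>

lemma rat_ring_simps [simp]:
  "carrier rat_ring = UNIV" "\<zero>\<^bsub>rat_ring\<^esub> = 0" "\<one>\<^bsub>rat_ring\<^esub> = 1"
  "x \<oplus>\<^bsub>rat_ring\<^esub> y = x + y" "x \<otimes>\<^bsub>rat_ring\<^esub> y = x * y"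
  by (simp_all add: rat_ring_def)

lemma cring_rat_ring: "cring rat_ring"
proof (rule cringI)
  show "abelian_group rat_ring"
  proof (rule abelian_groupI)
    show "\<exists>y\<in>carrier rat_ring. y \<oplus>\<^bsub>rat_ring\<^esub> x = \<zero>\<^bsub>rat_ring\<^esub>" for x
      by (auto intro: exI[of _ "- x"])
  qed auto
  show "comm_monoid rat_ring" by (rule comm_monoidI) auto
qed (auto simp: algebra_simps)

lemma a_inv_rat_ring [simp]: "\<ominus>\<^bsub>rat_ring\<^esub> x = - x"
proof -
  interpret R: cring rat_ring by (rule cring_rat_ring)
  have "- x \<oplus>\<^bsub>rat_ring\<^esub> x = \<zero>\<^bsub>rat_ring\<^esub>" by simp
  then show ?thesis by (metis R.minus_equality UNIV_I rat_ring_simps(1))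
qed

subsection \<open>Linear algebra and congruences\<close>

context rat_lie_algebra
begin

lemma scale_closed [simp]: "x \<in> carrier L \<Longrightarrow> q \<odot> x \<in> carrier L"
  by (simp add: smult_closed)

lemma scale_add_left: "x \<in> carrier L \<Longrightarrow> (p + q) \<odot> x = p \<odot> x \<oplus> q \<odot> x"
  using smult_l_distr[of p q x] by simp

lemma scale_add_right:
  "x \<in> carrier L \<Longrightarrow> y \<in> carrier L \<Longrightarrow> q \<odot> (x \<oplus> y) = q \<odot> x \<oplus> q \<odot> y"
  using smult_r_distr[of q x y] by simp

lemma scale_scale [simp]: "x \<in> carrier L \<Longrightarrow> p \<odot> (q \<odot> x) = (p * q) \<odot> x"
  using smult_assoc1[of p q x] by simp

lemma scale_1 [simp]: "x \<in> carrier L \<Longrightarrow> 1 \<odot> x = x"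
  using smult_one[of x] by simp

lemma scale_0 [simp]: "x \<in> carrier L \<Longrightarrow> 0 \<odot> x = \<zero>"
  using smult_l_null[of x] by simp

lemma scale_zero [simp]: "q \<odot> \<zero> = \<zero>"
  using smult_r_null[of q] by simp

lemma scale_minus_left: "x \<in> carrier L \<Longrightarrow> (- q) \<odot> x = \<ominus> (q \<odot> x)"
  using smult_l_minus[of q x] by simp

lemma scale_minus_right: "x \<in> carrier L \<Longrightarrow> q \<odot> (\<ominus> x) = \<ominus> (q \<odot> x)"
  using smult_r_minus[of q x] by simp

lemma scale_diff_right:
  "x \<in> carrier L \<Longrightarrow> y \<in> carrier L \<Longrightarrow> q \<odot> (x \<ominus> y) = q \<odot> x \<ominus> q \<odot> y"
  by (simp add: a_minus_def scale_add_right scale_minus_right)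

lemma minus_conv_scale: "x \<in> carrier L \<Longrightarrow> \<ominus> x = (-1) \<odot> x"
  by (simp add: scale_minus_left)

lemma diff_zero [simp]: "x \<in> carrier L \<Longrightarrow> x \<ominus> \<zero> = x"
  by (simp add: a_minus_def)

lemma diff_self [simp]: "x \<in> carrier L \<Longrightarrow> x \<ominus> x = \<zero>"
  by (simp add: a_minus_def r_neg)

lemma diff_eq_zero_iff: "x \<in> carrier L \<Longrightarrow> y \<in> carrier L \<Longrightarrow> x \<ominus> y = \<zero> \<longleftrightarrow> x = y"
  by (metis diff_self a_minus_def add.inv_equality add.inv_closed minus_minus)

lemma add_diff_cancel [simp]: "x \<in> carrier L \<Longrightarrow> y \<in> carrier L \<Longrightarrow> x \<oplus> y \<ominus> y = x"
  by (simp add: a_minus_def a_assoc r_neg)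

lemma diff_add_cancel [simp]: "x \<in> carrier L \<Longrightarrow> y \<in> carrier L \<Longrightarrow> x \<ominus> y \<oplus> y = x"
  by (simp add: a_minus_def a_assoc l_neg)

lemma bracket_in_carrier [simp]: "x \<in> carrier L \<Longrightarrow> y \<in> carrier L \<Longrightarrow> x \<otimes> y \<in> carrier L"
  by (rule bracket_closed)

lemma bracket_zero_left [simp]: "x \<in> carrier L \<Longrightarrow> \<zero> \<otimes> x = \<zero>"
  using bracket_smult_left[of "\<zero>" x 0] by simp

lemma bracket_zero_right [simp]: "x \<in> carrier L \<Longrightarrow> x \<otimes> \<zero> = \<zero>"
  using bracket_smult_right[of x "\<zero>" 0] by simp

lemma bracket_minus_left: "x \<in> carrier L \<Longrightarrow> y \<in> carrier L \<Longrightarrow> (\<ominus> x) \<otimes> y = \<ominus> (x \<otimes> y)"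
  using bracket_smult_left[of x y "-1"] by (simp add: minus_conv_scale)

lemma bracket_minus_right: "x \<in> carrier L \<Longrightarrow> y \<in> carrier L \<Longrightarrow> x \<otimes> (\<ominus> y) = \<ominus> (x \<otimes> y)"
  using bracket_smult_right[of x y "-1"] by (simp add: minus_conv_scale)

lemma bracket_antisym: 
  assumes "x \<in> carrier L" "y \<in> carrier L" shows "x \<otimes> y = \<ominus> (y \<otimes> x)"
proof -
  have "(x \<oplus> y) \<otimes> (x \<oplus> y) = \<zero>" using assms bracket_self by simp
  then have "x \<otimes> y \<oplus> y \<otimes> x = \<zero>"
    using assms bracket_self[OF assms(1)] bracket_self[OF assms(2)]
    by (simp add: bracket_add_left bracket_add_right a_comm)
  then show ?thesis using assms by (metis minus_equality bracket_closed)
qed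

abbreviation rat_subspace :: "'a set \<Rightarrow> bool" where
  "rat_subspace W \<equiv> submodule W rat_ring L"

lemma subspaceI:
  assumes "W \<subseteq> carrier L" "\<zero> \<in> W" "\<And>x y. x \<in> W \<Longrightarrow> y \<in> W \<Longrightarrow> x \<oplus> y \<in> W"
    "\<And>q x. x \<in> W \<Longrightarrow> q \<odot> x \<in> W"
  shows "rat_subspace W"
proof (rule submoduleI)
  show "\<ominus> a \<in> W" if "a \<in> W" for a
    using that assms(1) assms(4)[of a "-1"] by (auto simp: minus_conv_scale)
qed (use assms in auto)

lemma subspace_carrier: "rat_subspace W \<Longrightarrow> x \<in> W \<Longrightarrow> x \<in> carrier L"
  using submoduleE(1) by blast

lemma subspace_subset: "rat_subspace W \<Longrightarrow> W \<subseteq> carrier L"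
  using submoduleE(1) by blast

lemma subspace_add: "rat_subspace W \<Longrightarrow> x \<in> W \<Longrightarrow> y \<in> W \<Longrightarrow> x \<oplus> y \<in> W"
  using submoduleE(5) by blast

lemma subspace_scale: "rat_subspace W \<Longrightarrow> x \<in> W \<Longrightarrow> q \<odot> x \<in> W"
  using submoduleE(4)[of W q x] by simp

lemma subspace_zero: "rat_subspace W \<Longrightarrow> \<zero> \<in> W"
  by (metis submoduleE(2) all_not_in_conv scale_0 subspace_carrier subspace_scale)

lemma subspace_minus: "rat_subspace W \<Longrightarrow> x \<in> W \<Longrightarrow> \<ominus> x \<in> W"
  using submoduleE(3) by blast

lemma subspace_diff: "rat_subspace W \<Longrightarrow> x \<in> W \<Longrightarrow> y \<in> W \<Longrightarrow> x \<ominus> y \<in> W"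
  by (simp add: a_minus_def subspace_minus subspace_add)

lemma subspace_finsum:
  assumes "rat_subspace W" "\<And>i. i \<in> A \<Longrightarrow> f i \<in> W" shows "finsum L f A \<in> W"
  using assms(2)
proof (induction A rule: infinite_finite_induct)
  case (insert x A)
  then have "f \<in> A \<rightarrow> carrier L" "f x \<in> carrier L" using assms(1) subspace_carrier by auto
  then show ?case using insert assms(1) by (simp add: subspace_add)
qed (use assms(1) subspace_zero in \<open>simp_all add: finsum_infinite\<close>)

lemma subspace_UNIV: "rat_subspace (carrier L)"
  by (rule carrier_is_submodule)

lemma subspace_trivial: "rat_subspace {\<zero>}"
  by (rule subspaceI) auto

lemma rat_span_subspace: "S \<subseteq> carrier L \<Longrightarrow> rat_subspace (rat_span L S)"
  unfolding rat_span_def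
  by (rule subspaceI)
    (use subspace_UNIV in \<open>auto intro: subspace_zero subspace_add subspace_scale\<close>)

lemma rat_span_superset: "S \<subseteq> rat_span L S"
  by (auto simp: rat_span_def)

lemma rat_span_least: "rat_subspace W \<Longrightarrow> S \<subseteq> W \<Longrightarrow> rat_span L S \<subseteq> W"
  by (auto simp: rat_span_def)

lemma lie_product_subspace:
  "A \<subseteq> carrier L \<Longrightarrow> B \<subseteq> carrier L \<Longrightarrow> rat_subspace (lie_product L A B)"
  unfolding lie_product_def by (rule rat_span_subspace) (auto intro!: bracket_closed)

lemma lie_product_memI: "a \<in> A \<Longrightarrow> b \<in> B \<Longrightarrow> a \<otimes> b \<in> lie_product L A B"
  using rat_span_superset by (fastforce simp: lie_product_def)

lemma lie_product_least:
  "rat_subspace W \<Longrightarrow> (\<And>a b. a \<in> A \<Longrightarrow> b \<in> B \<Longrightarrow> a \<otimes> b \<in> W) \<Longrightarrow> lie_product L A B \<subseteq> W"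
  unfolding lie_product_def by (rule rat_span_least) auto

section \<open>Congruences, cosets and ideals\<close>

abbreviation eqm :: "'a set \<Rightarrow> 'a \<Rightarrow> 'a \<Rightarrow> bool" where "eqm \<equiv> eq_mod L"

lemma eqm_carrier: "eqm W x y \<Longrightarrow> x \<in> carrier L" "eqm W x y \<Longrightarrow> y \<in> carrier L"
  by (auto simp: eq_mod_def)

lemma eqm_refl: "rat_subspace W \<Longrightarrow> x \<in> carrier L \<Longrightarrow> eqm W x x"
  by (simp add: eq_mod_def subspace_zero)

lemma eqm_sym: assumes "rat_subspace W" "eqm W x y" shows "eqm W y x"
proof -
  have "y \<ominus> x = \<ominus> (x \<ominus> y)"
    using assms by (simp add: eq_mod_def a_minus_def minus_add a_comm)
  then show ?thesis using assms subspace_minus by (auto simp: eq_mod_def)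
qed

lemma eqm_trans [trans]: assumes "eqm W x y" "eqm W y z" "rat_subspace W" shows "eqm W x z"
proof -
  have "x \<ominus> z = (x \<ominus> y) \<oplus> (y \<ominus> z)"
  proof -
    have c: "x \<in> carrier L" "y \<in> carrier L" "z \<in> carrier L" using assms by (auto simp: eq_mod_def)
    have "(x \<ominus> y) \<oplus> (y \<ominus> z) = x \<oplus> (\<ominus> y \<oplus> y) \<oplus> \<ominus> z"
      using c by (simp only: a_minus_def a_assoc a_inv_closed a_closed)
    then show ?thesis using c by (simp add: l_neg a_minus_def)
  qed
  then show ?thesis using assms subspace_add by (auto simp: eq_mod_def)
qed

lemma eqm_add: assumes "rat_subspace W" "eqm W x x'" "eqm W y y'" shows "eqm W (x \<oplus> y) (x' \<oplus> y')"
proof -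
  have "x \<oplus> y \<ominus> (x' \<oplus> y') = (x \<ominus> x') \<oplus> (y \<ominus> y')"
    using assms by (simp add: eq_mod_def a_minus_def minus_add a_ac)
  then show ?thesis using assms subspace_add by (auto simp: eq_mod_def)
qed

lemma eqm_scale: "rat_subspace W \<Longrightarrow> eqm W x x' \<Longrightarrow> eqm W (q \<odot> x) (q \<odot> x')"
  by (auto simp: eq_mod_def subspace_scale simp flip: scale_diff_right)

lemma eqm_minus: "rat_subspace W \<Longrightarrow> eqm W x x' \<Longrightarrow> eqm W (\<ominus> x) (\<ominus> x')"
  using eqm_scale[of W x x' "-1"] by (simp add: minus_conv_scale eqm_carrier)

lemma eqm_diff: "rat_subspace W \<Longrightarrow> eqm W x x' \<Longrightarrow> eqm W y y' \<Longrightarrow> eqm W (x \<ominus> y) (x' \<ominus> y')"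
  by (simp add: a_minus_def eqm_add eqm_minus)

lemma eqm_mono: "eqm W x y \<Longrightarrow> W \<subseteq> W' \<Longrightarrow> eqm W' x y"
  by (auto simp: eq_mod_def)

lemma eqm_zero_iff: "rat_subspace W \<Longrightarrow> eqm W x \<zero> \<longleftrightarrow> x \<in> W"
  using subspace_carrier[of W x] by (auto simp: eq_mod_def)

lemma eqm_add_right: "rat_subspace W \<Longrightarrow> x \<in> carrier L \<Longrightarrow> w \<in> W \<Longrightarrow> eqm W (x \<oplus> w) x"
  by (metis eqm_add eqm_refl eqm_zero_iff r_zero)

lemma eqm_mem: assumes "rat_subspace W" "eqm W x y" shows "x \<in> W \<longleftrightarrow> y \<in> W"
  by (metis assms eqm_sym eqm_trans eqm_zero_iff)

text \<open>Turns congruences into equations wherever a filtration step is \<open>{\<zero>}\<close>,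
  which is how nilpotency enters.\<close>

lemma eqm_trivial_iff: "eqm {\<zero>} x y \<longleftrightarrow> x \<in> carrier L \<and> x = y"
  by (metis diff_eq_zero_iff eq_mod_def eqm_refl singleton_iff subspace_trivial)

lemma coset_mem_iff:
  assumes "rat_subspace W" "x \<in> carrier L" shows "y \<in> W +> x \<longleftrightarrow> eqm W y x"
proof
  show "y \<in> W +> x \<Longrightarrow> eqm W y x"
    using assms subspace_carrier[OF assms(1)] by (auto simp: a_r_coset_def' eq_mod_def)
  show "eqm W y x \<Longrightarrow> y \<in> W +> x"
    using assms by (force simp: a_r_coset_def' eq_mod_def intro: bexI[of _ "y \<ominus> x"])
qed

lemma coset_eq_iff:
  assumes "rat_subspace W" "x \<in> carrier L" "y \<in> carrier L" shows "W +> x = W +> y \<longleftrightarrow> eqm W x y"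
proof
  show "W +> x = W +> y \<Longrightarrow> eqm W x y" using assms coset_mem_iff eqm_refl by blast
  assume e: "eqm W x y"
  have "eqm W z x \<longleftrightarrow> eqm W z y" for z
    using e eqm_sym[OF assms(1) e] eqm_trans[OF _ _ assms(1)] by blast
  then show "W +> x = W +> y" using assms by (auto simp: coset_mem_iff)
qed

lemma coset_eq_self_iff: "rat_subspace W \<Longrightarrow> x \<in> carrier L \<Longrightarrow> W +> x = W \<longleftrightarrow> x \<in> W"
  by (metis coset_eq_iff eqm_zero_iff a_coset_add_zero subspace_subset zero_closed)

lemma ideal_subspace: "lie_ideal L J \<Longrightarrow> rat_subspace J"
  by (simp add: lie_ideal_def)

lemma ideal_right: "lie_ideal L J \<Longrightarrow> x \<in> carrier L \<Longrightarrow> y \<in> J \<Longrightarrow> x \<otimes> y \<in> J"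
  by (simp add: lie_ideal_def)

lemma ideal_left: "lie_ideal L J \<Longrightarrow> x \<in> carrier L \<Longrightarrow> y \<in> J \<Longrightarrow> y \<otimes> x \<in> J"
  by (metis bracket_antisym ideal_right ideal_subspace subspace_carrier subspace_minus)

text \<open>The two arguments are exchanged one after the other; each exchange changes the bracket
  by a bracket with an element of the ideal.\<close>

lemma eqm_bracket:
  assumes J: "lie_ideal L J" and e: "eqm J x x'" "eqm J y y'" shows "eqm J (x \<otimes> y) (x' \<otimes> y')"
proof -
  have c: "x \<in> carrier L" "y \<in> carrier L" "x' \<in> carrier L" "y' \<in> carrier L"
    using e eqm_carrier by auto
  note S = ideal_subspace[OF J]
  have "eqm J (x \<otimes> y) (x' \<otimes> y)"
  proof -
    have "x \<otimes> y \<ominus> x' \<otimes> y = (x \<ominus> x') \<otimes> y"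
      using c by (simp add: a_minus_def bracket_add_left bracket_minus_left)
    then show ?thesis using e(1) c ideal_left[OF J] by (simp add: eq_mod_def)
  qed
  moreover have "eqm J (x' \<otimes> y) (x' \<otimes> y')"
  proof -
    have "x' \<otimes> y \<ominus> x' \<otimes> y' = x' \<otimes> (y \<ominus> y')"
      using c by (simp add: a_minus_def bracket_add_right bracket_minus_right)
    then show ?thesis using e(2) c ideal_right[OF J] by (simp add: eq_mod_def)
  qed
  ultimately show ?thesis using eqm_trans S by blast
qed

text \<open>Replacing \<open>p(a)\<close> by \<open>p(2a) - 2^d p(a)\<close> removes the leading term.\<close>

lemma polynomial_coeff_mem:
  assumes W: "rat_subspace W" and v: "\<And>n. v n \<in> carrier L"
    and p: "\<And>a. a \<ge> 1 \<Longrightarrow> (\<Oplus>n\<in>{..d}. (of_nat a ^ n) \<odot> v n) \<in> W"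
    and n: "n \<le> d"
  shows "v n \<in> W"
  using v p n
proof (induction d arbitrary: v n)
  case 0
  from 0(2)[of 1] show ?case using 0 by simp
next
  case (Suc d)
  let ?u = "\<lambda>n. (2 ^ n - 2 ^ Suc d) \<odot> v n"
  have lower: "v n \<in> W" if "n \<le> d" for n
  proof -
    have "?u n \<in> W"
    proof (rule Suc.IH)
      show "(\<Oplus>n\<in>{..d}. (of_nat a ^ n) \<odot> ?u n) \<in> W" if "a \<ge> 1" for a
      proof -
        let ?p = "\<lambda>a. \<Oplus>n\<in>{..Suc d}. (of_nat a ^ n) \<odot> v n"
        have "(\<Oplus>n\<in>{..Suc d}. (of_nat a ^ n) \<odot> ?u n)
            = (\<Oplus>n\<in>{..Suc d}. (of_nat (2 * a) ^ n) \<odot> v n \<oplus> (- (2 ^ Suc d)) \<odot> ((of_nat a ^ n) \<odot> v n))"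
          using Suc.prems(1)
          by (intro finsum_cong') (auto simp: algebra_simps power_mult_distrib simp flip: scale_add_left)
        also have "\<dots> = ?p (2 * a) \<oplus> (- (2 ^ Suc d)) \<odot> ?p a"
          using Suc.prems(1) by (subst finsum_addf, simp, simp, subst finsum_smult_ldistr) auto
        also have "\<dots> \<in> W"
          using Suc.prems(2)[of "2 * a"] Suc.prems(2)[of a] that W subspace_add subspace_scale by auto
        finally show ?thesis using Suc.prems(1) by (simp add: scale_0)
      qed
    qed (use that Suc.prems in auto)
    \<comment> \<open>For \<open>n \<le> d\<close> the factor \<open>2^n - 2^(d+1)\<close> is
      nonzero and can be divided out.\<close>
    then have "inverse (2 ^ n - 2 ^ Suc d) \<odot> ?u n \<in> W" using W subspace_scale by blast
    moreover have "(2::rat) ^ n - 2 ^ Suc d \<noteq> 0"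
      using that power_strict_increasing[of n "Suc d" "2::rat"] by simp
    ultimately show ?thesis using Suc.prems(1) by simp
  qed
  have "v (Suc d) \<in> W"
  proof -
    \<comment> \<open>At \<open>a = 1\<close> the polynomial is the sum of all its coefficients;
      removing the lower ones, already in \<open>W\<close>, leaves the top one.\<close>
    have s: "(\<Oplus>n\<in>{..d}. v n) \<in> W" using lower W by (intro subspace_finsum) auto
    moreover have "v (Suc d) \<oplus> (\<Oplus>n\<in>{..d}. v n) \<in> W"
      using Suc.prems(2)[of 1] Suc.prems(1) by (simp add: finsum_Suc Pi_def)
    ultimately show ?thesis
      using W Suc.prems(1) subspace_diff[OF W _ s] by (metis add_diff_cancel subspace_carrier)
  qed
  then show ?case using lower Suc.prems(3) le_Suc_eq by blast
qed

end

subsection \<open>The components of the Campbell--Hausdorff series\<close>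

lemma bch_word_Nil [simp]: "bch_word [] x y = []"
  by (simp add: bch_word_def)

lemma bch_word_Cons [simp]:
  "bch_word ((r, s) # ps) x y = replicate r x @ replicate s y @ bch_word ps x y"
  by (simp add: bch_word_def)

lemma bch_word_map:
  fixes f :: "'a \<Rightarrow> 'b"
  shows "bch_word ps (f x) (f y) = map f (bch_word ps x y)"
  by (induction ps) auto

lemma set_bch_word: "set (bch_word ps x y) \<subseteq> {x, y}"
  by (induction ps) auto

lemma length_bch_word: "ps \<in> bch_index N \<Longrightarrow> length (bch_word ps x y) = N"
proof -
  have "length (bch_word ps x y) = (\<Sum>(r, s)\<leftarrow>ps. r + s)"
    by (induction ps) auto
  then show "ps \<in> bch_index N \<Longrightarrow> ?thesis" by (simp add: bch_index_def)
qed

lemma bch_index_0: "bch_index 0 = {[]}"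
proof -
  have "ps = []" if "ps \<in> bch_index 0" for ps
    using that by (cases ps) (auto simp: bch_index_def)
  then show ?thesis by (auto simp: bch_index_def)
qed

lemma Cons_in_bch_index:
  "(r, s) # ps \<in> bch_index N \<longleftrightarrow> r + s > 0 \<and> r + s \<le> N \<and> ps \<in> bch_index (N - (r + s))"
  by (auto simp: bch_index_def)

text \<open>Splitting off the first pair makes the index sets computable in low degree. Degrees 1
  and 2 suffice: all explicit information drawn from the series is in its first two
  components.\<close>

lemma bch_index_rec:
  "bch_index (Suc N) = (\<Union>(r, s)\<in>{(r, s). r + s > 0 \<and> r + s \<le> Suc N}. (#) (r, s) ` bch_index (Suc N - (r + s)))"
proof (rule Set.set_eqI)
  fix ps
  show "ps \<in> bch_index (Suc N) \<longleftrightarrow> ps \<in> (\<Union>(r, s)\<in>{(r, s). r + s > 0 \<and> r + s \<le> Suc N}.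
      (#) (r, s) ` bch_index (Suc N - (r + s)))"
  proof (cases ps)
    case Nil
    then show ?thesis by (auto simp: bch_index_def)
  next
    case (Cons p qs)
    obtain r s where "p = (r, s)" by (cases p)
    then show ?thesis using Cons by (auto simp: Cons_in_bch_index)
  qed
qed

lemma bch_index_1: "bch_index (Suc 0) = {[(1, 0)], [(0, 1)]}"
proof -
  have "{(r, s). r + s > 0 \<and> r + s \<le> Suc 0} = {(1, 0), (0, 1)}" by auto
  then show ?thesis unfolding bch_index_rec[of 0] by (simp add: bch_index_0 insert_commute)
qed

lemma bch_index_2:
  "bch_index (Suc (Suc 0)) = {[(2, 0)], [(1, 1)], [(0, 2)], [(1, 0), (1, 0)], [(1, 0), (0, 1)],
     [(0, 1), (1, 0)], [(0, 1), (0, 1)]}"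
proof -
  have "{(r, s). r + s > 0 \<and> r + s \<le> Suc (Suc 0)} = {(1, 0), (0, 1), (2, 0), (1, 1), (0, 2)}"
    by auto
  then show ?thesis unfolding bch_index_rec[of "Suc 0"] by (auto simp: bch_index_0 bch_index_1)
qed

text \<open>Polynomial functions of a natural variable with coefficients in \<open>L\<close> and no
  terms of degree below \<open>k\<close>. They are kept as functions, with repeated exponents
  allowed, so that sums, brackets and components of the Campbell--Hausdorff series are handled by
  plain induction; only the order of vanishing \<open>k\<close> is tracked.\<close>

inductive_set lie_poly :: "'a lie_record \<Rightarrow> nat \<Rightarrow> (nat \<Rightarrow> 'a) set" for L k where
  lie_poly_zero: "(\<lambda>a. \<zero>\<^bsub>L\<^esub>) \<in> lie_poly L k"
| lie_poly_monom: "n \<ge> k \<Longrightarrow> v \<in> carrier L \<Longrightarrow> p \<in> lie_poly L k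
    \<Longrightarrow> (\<lambda>a. (of_nat a ^ n) \<odot>\<^bsub>L\<^esub> v \<oplus>\<^bsub>L\<^esub> p a) \<in> lie_poly L k"

context rat_lie_algebra
begin

lemma nested_bracket_Cons:
  "w \<noteq> [] \<Longrightarrow> nested_bracket L (x # w) = x \<otimes> nested_bracket L w"
  by (cases w) auto

lemma nested_bracket_closed [simp]:
  "set w \<subseteq> carrier L \<Longrightarrow> nested_bracket L w \<in> carrier L"
proof (induction w)
  case (Cons x w)
  then show ?case by (cases "w = []") (auto simp: nested_bracket_Cons)
qed auto

lemma bch_word_closed:
  "x \<in> carrier L \<Longrightarrow> y \<in> carrier L \<Longrightarrow> nested_bracket L (bch_word ps x y) \<in> carrier L"
  using set_bch_word[of ps x y] by (intro nested_bracket_closed) auto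

lemma bch_component_closed [simp]:
  "x \<in> carrier L \<Longrightarrow> y \<in> carrier L \<Longrightarrow> bch_component L N x y \<in> carrier L"
  unfolding bch_component_def by (intro finsum_closed) (auto simp: bch_word_closed)

lemma bch_component_mem:
  assumes "rat_subspace W" "\<And>ps. ps \<in> bch_index N \<Longrightarrow> nested_bracket L (bch_word ps x y) \<in> W"
  shows "bch_component L N x y \<in> W"
  unfolding bch_component_def using assms by (intro subspace_finsum subspace_scale) auto

lemma bch_component_1:
  assumes "x \<in> carrier L" "y \<in> carrier L" shows "bch_component L (Suc 0) x y = x \<oplus> y"
  using assms by (simp add: bch_component_def bch_index_1 bch_coeff_def bch_word_def)

text \<open>The index \<open>[(1,1)]\<close> contributes \<open>1/2\<close> to
  \<open>x \<otimes> y\<close>, the index \<open>[(1,0),(0,1)]\<close> contributes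
  \<open>-1/4\<close>, and \<open>[(0,1),(1,0)]\<close> contributes \<open>-1/4\<close> to
  \<open>y \<otimes> x\<close>. The other words repeat a letter and vanish; by antisymmetry the
  total is \<open>1/2 - 1/4 + 1/4\<close>.\<close>

lemma bch_component_2:
  assumes "x \<in> carrier L" "y \<in> carrier L"
  shows "bch_component L (Suc (Suc 0)) x y = (1/2) \<odot> (x \<otimes> y)"
proof -
  have "y \<otimes> x = (-1) \<odot> (x \<otimes> y)" using assms by (metis bracket_antisym minus_conv_scale bracket_closed)
  then show ?thesis using assms bracket_self
    by (simp add: bch_component_def bch_index_2 bch_coeff_def bch_word_def numeral_2_eq_2
        flip: scale_add_left)
qed

lemma nested_bracket_scale:
  assumes "set w \<subseteq> carrier L"
  shows "nested_bracket L (map (\<lambda>x. q \<odot> x) w) = (q ^ length w) \<odot> nested_bracket L w"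
  using assms
proof (induction w)
  case (Cons x w)
  then show ?case
    by (cases "w = []") (auto simp: nested_bracket_Cons bracket_smult_left bracket_smult_right mult.commute)
qed auto

text \<open>Each word in the component of degree \<open>N\<close> has exactly \<open>N\<close>
  letters, and nested brackets are multilinear.\<close>

lemma bch_component_scale:
  assumes "x \<in> carrier L" "y \<in> carrier L"
  shows "bch_component L N (q \<odot> x) (q \<odot> y) = (q ^ N) \<odot> bch_component L N x y"
proof -
  have "bch_coeff N ps \<odot> nested_bracket L (bch_word ps (q \<odot> x) (q \<odot> y))
      = (q ^ N) \<odot> (bch_coeff N ps \<odot> nested_bracket L (bch_word ps x y))" if "ps \<in> bch_index N" for ps
    using that assms nested_bracket_scale[of "bch_word ps x y" q] set_bch_word[of ps x y]
      subset_trans[OF set_bch_word[of ps x y], of "carrier L"]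
    by (simp add: bch_word_map[of ps "\<lambda>x. q \<odot> x"] length_bch_word mult.commute bch_word_closed)
  then show ?thesis unfolding bch_component_def using assms
    by (subst finsum_smult_ldistr) (auto simp: finite_bch_index bch_word_closed intro!: finsum_cong')
qed

text \<open>The innermost bracket joins two letters, so it is zero or \<open>x \<otimes> y\<close>
  up to sign; the outer letters then keep it in the ideal.\<close>

lemma nested_bracket_mem_ideal:
  assumes J: "lie_ideal L J" and x: "x \<in> carrier L" "y \<in> carrier L" "x \<otimes> y \<in> J"
    and w: "set w \<subseteq> {x, y}" "length w \<ge> 2"
  shows "nested_bracket L w \<in> J"
  using w
proof (induction w)
  case (Cons u w)
  note S = ideal_subspace[OF J]
  have u: "u \<in> carrier L" using Cons x by auto
  show ?case
  proof (cases "length w \<ge> 2")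
    case True
    then have "w \<noteq> []" "nested_bracket L w \<in> J" using Cons by auto
    then show ?thesis using ideal_right[OF J u] by (simp add: nested_bracket_Cons)
  next
    case False
    then obtain v where v: "w = [v]" using Cons.prems(2) by (cases w) (auto simp: Suc_le_eq)
    have "u \<in> {x, y}" "v \<in> {x, y}" using Cons.prems v by auto
    moreover have "y \<otimes> x \<in> J" using x S by (metis bracket_antisym subspace_minus)
    ultimately have "u \<otimes> v \<in> J" using x bracket_self S subspace_zero by auto
    then show ?thesis using v by simp
  qed
qed auto

lemma bch_component_mem_ideal:
  assumes "lie_ideal L J" "x \<in> carrier L" "y \<in> carrier L" "x \<otimes> y \<in> J" "N \<ge> 2"
  shows "bch_component L N x y \<in> J"
  using assms set_bch_word[of _ x y] ideal_subspace
  by (intro bch_component_mem nested_bracket_mem_ideal[of J x y]) (simp_all add: length_bch_word)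

section \<open>Polynomial families of elements of a Lie algebra\<close>

lemma lie_poly_closed: "p \<in> lie_poly L k \<Longrightarrow> p a \<in> carrier L"
  by (induction rule: lie_poly.induct) auto

lemma lie_poly_add:
  assumes "p \<in> lie_poly L k" "q \<in> lie_poly L k" shows "(\<lambda>a. p a \<oplus> q a) \<in> lie_poly L k"
  using assms
proof (induction rule: lie_poly.induct)
  case lie_poly_zero
  then show ?case using lie_poly_closed by simp
next
  case (lie_poly_monom n v p)
  then show ?case using lie_poly.lie_poly_monom[of k n v L "\<lambda>a. p a \<oplus> q a"] lie_poly_closed
    by (simp add: a_assoc)
qed

lemma lie_poly_mono: "p \<in> lie_poly L k \<Longrightarrow> l \<le> k \<Longrightarrow> p \<in> lie_poly L l"
  by (induction rule: lie_poly.induct) (auto intro: lie_poly.intros)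

lemma lie_poly_single: "n \<ge> k \<Longrightarrow> v \<in> carrier L \<Longrightarrow> (\<lambda>a. (of_nat a ^ n) \<odot> v) \<in> lie_poly L k"
  using lie_poly.lie_poly_monom[OF _ _ lie_poly.lie_poly_zero, of k n v L] by simp

lemma lie_poly_scale: "p \<in> lie_poly L k \<Longrightarrow> (\<lambda>a. q \<odot> p a) \<in> lie_poly L k"
proof (induction rule: lie_poly.induct)
  case (lie_poly_monom n v p)
  then show ?case using lie_poly.lie_poly_monom[of k n "q \<odot> v" L "\<lambda>a. q \<odot> p a"] lie_poly_closed
    by (simp add: scale_add_right mult.commute)
qed (simp add: lie_poly.lie_poly_zero)

lemma lie_poly_finsum:
  assumes "\<And>i. i \<in> A \<Longrightarrow> p i \<in> lie_poly L k"
  shows "(\<lambda>a. \<Oplus>i\<in>A. p i a) \<in> lie_poly L k"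
  using assms
proof (induction A rule: infinite_finite_induct)
  case (insert x A)
  then have "(\<lambda>a. \<Oplus>i\<in>insert x A. p i a) = (\<lambda>a. p x a \<oplus> (\<Oplus>i\<in>A. p i a))"
    using lie_poly_closed by (intro ext finsum_insert) auto
  then show ?case using insert lie_poly_add by simp
qed (auto simp: lie_poly.lie_poly_zero finsum_infinite)

lemma lie_poly_bracket:
  assumes p: "p \<in> lie_poly L k" and q: "q \<in> lie_poly L l"
  shows "(\<lambda>a. p a \<otimes> q a) \<in> lie_poly L (k + l)"
  using p
proof (induction rule: lie_poly.induct)
  case lie_poly_zero
  then show ?case using lie_poly_closed[OF q] by (simp add: lie_poly.lie_poly_zero)
next
  case (lie_poly_monom n v p)
  have "(\<lambda>a. (of_nat a ^ n) \<odot> v \<otimes> q a) \<in> lie_poly L (k + l)"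
    using q
  proof (induction rule: lie_poly.induct)
    case lie_poly_zero
    then show ?case using lie_poly_monom by (simp add: lie_poly.lie_poly_zero)
  next
    case (lie_poly_monom m w q)
    then show ?case
      using lie_poly.lie_poly_monom[of "k + l" "n + m" "v \<otimes> w" L "\<lambda>a. (of_nat a ^ n) \<odot> v \<otimes> q a"]
        \<open>k \<le> n\<close> \<open>v \<in> carrier L\<close> lie_poly_closed
      by (simp add: bracket_add_right bracket_smult_left bracket_smult_right power_add mult.commute)
  qed
  from lie_poly_add[OF this lie_poly_monom.IH]
  show ?case using lie_poly_monom(1-3) lie_poly_closed[OF q] lie_poly_closed
    by (simp add: bracket_add_left)
qed

lemma lie_poly_nested_bracket:
  assumes "set w \<subseteq> lie_poly L 1" "w \<noteq> []"
  shows "(\<lambda>a. nested_bracket L (map (\<lambda>p. p a) w)) \<in> lie_poly L (length w)"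
  using assms
proof (induction w)
  case (Cons p w)
  show ?case
  proof (cases "w = []")
    case False
    then have "(\<lambda>a. p a \<otimes> nested_bracket L (map (\<lambda>p. p a) w)) \<in> lie_poly L (1 + length w)"
      using Cons by (intro lie_poly_bracket) auto
    then show ?thesis using False by (simp add: nested_bracket_Cons)
  qed (use Cons in auto)
qed auto

text \<open>The word is formed with the functions \<open>p\<close> and \<open>q\<close> as letters
  and evaluated at \<open>a\<close> afterwards. It has \<open>N\<close> letters, each of order at
  least 1, so its bracket has order at least \<open>N\<close>.\<close>

lemma lie_poly_bch_component:
  assumes "p \<in> lie_poly L 1" "q \<in> lie_poly L 1" "N \<ge> 1"
  shows "(\<lambda>a. bch_component L N (p a) (q a)) \<in> lie_poly L N"
  unfolding bch_component_def
proof (intro lie_poly_finsum lie_poly_scale)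
  fix ps assume ps: "ps \<in> bch_index N"
  then have "bch_word ps p q \<noteq> []" using length_bch_word[OF ps, of p q] assms(3) by auto
  then show "(\<lambda>a. nested_bracket L (bch_word ps (p a) (q a))) \<in> lie_poly L N"
    using lie_poly_nested_bracket[of "bch_word ps p q"] set_bch_word[of ps p q] assms
      length_bch_word[OF ps, of p q] 
    by (auto simp: bch_word_map[of ps "\<lambda>p. p _" p q])
qed

text \<open>Passes to a coefficient sequence, on which coefficients can be extracted. The summation
  bound is left free above \<open>d\<close> so that a further monomial can be absorbed by raising
  it.\<close>

lemma lie_poly_coeffs:
  assumes "p \<in> lie_poly L k"
  obtains d v where "\<And>n. v n \<in> carrier L" "\<And>n. n < k \<Longrightarrow> v n = \<zero>" "\<And>n. n > d \<Longrightarrow> v n = \<zero>" "k \<le> d"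
    "\<And>a D. D \<ge> d \<Longrightarrow> p a = (\<Oplus>n\<in>{..D}. (of_nat a ^ n) \<odot> v n)"
  using assms
proof (induction arbitrary: thesis rule: lie_poly.induct)
  case lie_poly_zero
  then show ?case by (auto intro!: lie_poly_zero[of "\<lambda>_. \<zero>" k])
next
  case (lie_poly_monom n v p)
  obtain d u where u: "\<And>n. u n \<in> carrier L" "\<And>n. n < k \<Longrightarrow> u n = \<zero>" "\<And>n. n > d \<Longrightarrow> u n = \<zero>" "k \<le> d"
    "\<And>a D. D \<ge> d \<Longrightarrow> p a = (\<Oplus>n\<in>{..D}. (of_nat a ^ n) \<odot> u n)"
    using lie_poly_monom.IH by blast
  let ?u = "\<lambda>m. (if n = m then v else \<zero>) \<oplus> u m"
  show ?case
  proof (rule lie_poly_monom.prems[of ?u "max n d"])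
    fix a D assume D: "max n d \<le> D"
    have "(\<Oplus>m\<in>{..D}. (of_nat a ^ m) \<odot> ?u m)
       = (\<Oplus>m\<in>{..D}. (if n = m then (of_nat a ^ m) \<odot> v else \<zero>) \<oplus> (of_nat a ^ m) \<odot> u m)"
      using lie_poly_monom u(1) by (intro finsum_cong') (auto simp: scale_add_right)
    also have "\<dots> = (of_nat a ^ n) \<odot> v \<oplus> p a"
      using lie_poly_monom(2) D u(1)
      by (subst finsum_addf) (auto simp: u(5)[of D a] finsum_singleton[of n "{..D}" "\<lambda>m. (of_nat a ^ m) \<odot> v"])
    finally show "(of_nat a ^ n) \<odot> v \<oplus> p a = (\<Oplus>m\<in>{..D}. (of_nat a ^ m) \<odot> ?u m)" ..
  qed (use lie_poly_monom u in auto)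
qed

text \<open>As \<open>p\<close> starts in degree \<open>k + 1\<close>, the coefficient of degree
  \<open>k\<close> of the whole family is exactly \<open>v\<close>. This is the form in which
  coefficients are read off from products of group elements.\<close>

lemma lie_poly_leading_coeff_mem:
  assumes W: "rat_subspace W" and v: "v \<in> carrier L" and p: "p \<in> lie_poly L (Suc k)"
    and m: "\<And>a. a \<ge> 1 \<Longrightarrow> (of_nat a ^ k) \<odot> v \<oplus> p a \<in> W"
  shows "v \<in> W"
proof -
  obtain d u where u: "\<And>n. u n \<in> carrier L" "\<And>n. n < Suc k \<Longrightarrow> u n = \<zero>" "\<And>n. n > d \<Longrightarrow> u n = \<zero>" "Suc k \<le> d"
    "\<And>a D. D \<ge> d \<Longrightarrow> p a = (\<Oplus>n\<in>{..D}. (of_nat a ^ n) \<odot> u n)"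
    using lie_poly_coeffs[OF p] by metis
  let ?u = "\<lambda>m. (if k = m then v else \<zero>) \<oplus> u m"
  have "(\<Oplus>m\<in>{..d}. (of_nat a ^ m) \<odot> ?u m) \<in> W" if a: "a \<ge> 1" for a
  proof -
    have "(\<Oplus>m\<in>{..d}. (of_nat a ^ m) \<odot> ?u m)
       = (\<Oplus>m\<in>{..d}. (if k = m then (of_nat a ^ m) \<odot> v else \<zero>) \<oplus> (of_nat a ^ m) \<odot> u m)"
      using v u(1) by (intro finsum_cong') (auto simp: scale_add_right)
    also have "\<dots> = (of_nat a ^ k) \<odot> v \<oplus> p a"
      using v u(4) u(1)
      by (subst finsum_addf) (auto simp: u(5)[of d a] finsum_singleton[of k "{..d}" "\<lambda>m. (of_nat a ^ m) \<odot> v"])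
    finally show ?thesis using m[OF a] by simp
  qed
  then have "?u k \<in> W" using u(1,4) v by (intro polynomial_coeff_mem[OF W, of ?u d]) auto
  then show ?thesis using u(2)[of k] v by simp
qed

end

section \<open>Homomorphisms of Lie algebras\<close>

locale lie_algebra_hom = A: rat_lie_algebra A + B: rat_lie_algebra B
  for A :: "'a lie_record" and B :: "'b lie_record" and \<phi> :: "'a \<Rightarrow> 'b" +
  assumes hom_closed [simp]: "x \<in> carrier A \<Longrightarrow> \<phi> x \<in> carrier B"
    and hom_add: "x \<in> carrier A \<Longrightarrow> y \<in> carrier A \<Longrightarrow> \<phi> (x \<oplus>\<^bsub>A\<^esub> y) = \<phi> x \<oplus>\<^bsub>B\<^esub> \<phi> y"
    and hom_scale: "x \<in> carrier A \<Longrightarrow> \<phi> (q \<odot>\<^bsub>A\<^esub> x) = q \<odot>\<^bsub>B\<^esub> \<phi> x"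
    and hom_bracket: "x \<in> carrier A \<Longrightarrow> y \<in> carrier A \<Longrightarrow> \<phi> (x \<otimes>\<^bsub>A\<^esub> y) = \<phi> x \<otimes>\<^bsub>B\<^esub> \<phi> y"
begin

lemma hom_zero [simp]: "\<phi> \<zero>\<^bsub>A\<^esub> = \<zero>\<^bsub>B\<^esub>"
  using hom_scale[of "\<zero>\<^bsub>A\<^esub>" 0] by simp

lemma hom_minus: "x \<in> carrier A \<Longrightarrow> \<phi> (\<ominus>\<^bsub>A\<^esub> x) = \<ominus>\<^bsub>B\<^esub> \<phi> x"
  using hom_scale[of x "-1"] by (simp add: A.minus_conv_scale B.minus_conv_scale)

lemma hom_diff: "x \<in> carrier A \<Longrightarrow> y \<in> carrier A \<Longrightarrow> \<phi> (x \<ominus>\<^bsub>A\<^esub> y) = \<phi> x \<ominus>\<^bsub>B\<^esub> \<phi> y"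
  by (simp add: a_minus_def hom_add hom_minus)

lemma hom_finsum:
  assumes "\<And>i. i \<in> I \<Longrightarrow> f i \<in> carrier A"
  shows "\<phi> (\<Oplus>\<^bsub>A\<^esub>i\<in>I. f i) = (\<Oplus>\<^bsub>B\<^esub>i\<in>I. \<phi> (f i))"
  using assms
  by (induction I rule: infinite_finite_induct) (auto simp: hom_add A.finsum_infinite B.finsum_infinite)

lemma hom_nested_bracket:
  "set w \<subseteq> carrier A \<Longrightarrow> \<phi> (nested_bracket A w) = nested_bracket B (map \<phi> w)"
proof (induction w)
  case (Cons x w)
  then show ?case
    by (cases "w = []") (auto simp: A.nested_bracket_Cons B.nested_bracket_Cons hom_bracket)
qed auto

lemma hom_bch_component:
  assumes "x \<in> carrier A" "y \<in> carrier A"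
  shows "\<phi> (bch_component A N x y) = bch_component B N (\<phi> x) (\<phi> y)"
proof -
  have "\<phi> (nested_bracket A (bch_word ps x y)) = nested_bracket B (bch_word ps (\<phi> x) (\<phi> y))" for ps
    using assms set_bch_word[of ps x y] by (subst hom_nested_bracket) (auto simp: bch_word_map)
  then show ?thesis
    using assms by (simp add: bch_component_def hom_finsum hom_scale A.bch_word_closed)
qed

end

subsection \<open>Complete filtered Lie algebras\<close>

text \<open>Choosing a representative in each coset turns a point of the projective limit into a
  sequence whose members \<open>r\<close> and \<open>r + 1\<close> agree modulo \<open>F r\<close>.
  Entry 0 of such a sequence is unconstrained.\<close>

lemma (in rat_lie_algebra) filtration_limit_eq:
  assumes F: "\<And>r. r \<ge> 1 \<Longrightarrow> rat_subspace (F r)" "\<And>r. r \<ge> 1 \<Longrightarrow> F (Suc r) \<subseteq> F r"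
  shows "filtration_limit L F = {c. \<exists>s. c = (\<lambda>r\<in>{1..}. F r +> s r) \<and> (\<forall>r\<ge>1. eqm (F r) (s (Suc r)) (s r))}"
proof -
  \<comment> \<open>This is the transition map of the inverse system: thickening a coset of
    \<open>F (Suc r)\<close> by \<open>F r\<close> gives the coset of \<open>F r\<close> with the
    same representative.\<close>
  have absorb: "F r <+>\<^bsub>L\<^esub> (F (Suc r) +> x) = F r +> x" if "r \<ge> 1" "x \<in> carrier L" for r x
  proof (rule Set.set_eqI)
    fix z
    have "z \<in> F r <+>\<^bsub>L\<^esub> (F (Suc r) +> x) \<longleftrightarrow> (\<exists>u\<in>F r. \<exists>v\<in>F (Suc r). z = u \<oplus> (v \<oplus> x))"
      by (auto simp: set_add_def' a_r_coset_def')
    also have "\<dots> \<longleftrightarrow> (\<exists>u\<in>F r. z = u \<oplus> x)"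
    proof
      assume "\<exists>u\<in>F r. \<exists>v\<in>F (Suc r). z = u \<oplus> (v \<oplus> x)"
      then obtain u v where uv: "u \<in> F r" "v \<in> F (Suc r)" "z = u \<oplus> (v \<oplus> x)" by blast
      moreover have "v \<in> F r" using uv F(2) that by blast
      ultimately have "z = (u \<oplus> v) \<oplus> x" "u \<oplus> v \<in> F r"
        using F(1)[of r] that subspace_carrier[of "F r"] by (auto simp: a_assoc subspace_add)
      then show "\<exists>u\<in>F r. z = u \<oplus> x" by blast
    next
      assume "\<exists>u\<in>F r. z = u \<oplus> x"
      moreover have "\<zero> \<in> F (Suc r)" using F(1)[of "Suc r"] subspace_zero by simp
      moreover have "x = \<zero> \<oplus> x" using that by simp
      ultimately show "\<exists>u\<in>F r. \<exists>v\<in>F (Suc r). z = u \<oplus> (v \<oplus> x)" by metis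
    qed
    finally show "z \<in> F r <+>\<^bsub>L\<^esub> (F (Suc r) +> x) \<longleftrightarrow> z \<in> F r +> x"
      by (auto simp: a_r_coset_def')
  qed
  show ?thesis
  proof (intro Set.set_eqI iffI)
    fix c assume "c \<in> filtration_limit L F"
    then have c: "c \<in> (\<Pi>\<^sub>E r\<in>{1..}. a_rcosets (F r))" "\<And>r. r \<ge> 1 \<Longrightarrow> F r <+>\<^bsub>L\<^esub> c (Suc r) = c r"
      by (auto simp: filtration_limit_def lie_quotient_def)
    have "\<forall>r. \<exists>x. r \<ge> 1 \<longrightarrow> x \<in> carrier L \<and> c r = F r +> x"
      using c(1) by (fastforce simp: A_RCOSETS_def' PiE_def Pi_def)
    then obtain s where s: "\<And>r. r \<ge> 1 \<Longrightarrow> s r \<in> carrier L \<and> c r = F r +> s r" by metis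
    have "eqm (F r) (s (Suc r)) (s r)" if "r \<ge> 1" for r
    proof -
      have "F r +> s (Suc r) = F r +> s r"
        using c(2)[OF that] s[of r] s[of "Suc r"] that absorb[of r "s (Suc r)"] by auto
      then show ?thesis using F(1) s that by (subst coset_eq_iff[symmetric]) auto
    qed
    moreover have "c = (\<lambda>r\<in>{1..}. F r +> s r)"
      using s c(1) by (auto simp: PiE_def extensional_def fun_eq_iff restrict_def)
    ultimately show "c \<in> {c. \<exists>s. c = (\<lambda>r\<in>{1..}. F r +> s r) \<and> (\<forall>r\<ge>1. eqm (F r) (s (Suc r)) (s r))}"
      by blast
  next
    fix c assume "c \<in> {c. \<exists>s. c = (\<lambda>r\<in>{1..}. F r +> s r) \<and> (\<forall>r\<ge>1. eqm (F r) (s (Suc r)) (s r))}"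
    then obtain s where s: "c = (\<lambda>r\<in>{1..}. F r +> s r)" "\<And>r. r \<ge> 1 \<Longrightarrow> eqm (F r) (s (Suc r)) (s r)"
      by blast
    have sc: "s r \<in> carrier L" if "r \<ge> 1" for r using s(2)[OF that] eqm_carrier by blast
    have "F r <+>\<^bsub>L\<^esub> c (Suc r) = c r" if "r \<ge> 1" for r
      using absorb[of r "s (Suc r)"] s(2)[OF that] sc[of r] sc[of "Suc r"] F(1) that
      by (simp add: s(1) coset_eq_iff)
    then show "c \<in> filtration_limit L F"
      using sc by (auto simp: filtration_limit_def lie_quotient_def A_RCOSETS_def' s(1))
  qed
qed

text \<open>The first conjunct is injectivity of the canonical map, that is, separatedness; the
  second is surjectivity, that is, convergence of coherent sequences.\<close>

lemma (in rat_lie_algebra) filtration_complete_iff: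
  assumes F: "\<And>r. r \<ge> 1 \<Longrightarrow> rat_subspace (F r)" "\<And>r. r \<ge> 1 \<Longrightarrow> F (Suc r) \<subseteq> F r"
  shows "filtration_complete L F \<longleftrightarrow>
    (\<forall>x\<in>carrier L. (\<forall>r\<ge>1. x \<in> F r) \<longrightarrow> x = \<zero>) \<and>
    (\<forall>s. (\<forall>r\<ge>1. eqm (F r) (s (Suc r)) (s r)) \<longrightarrow> (\<exists>z\<in>carrier L. \<forall>r\<ge>1. eqm (F r) (s r) z))"
    (is "_ \<longleftrightarrow> ?sep \<and> ?conv")
proof -
  let ?m = "\<lambda>x. \<lambda>r\<in>{1..}. F r +> x"
  have lim: "filtration_limit L F =
      {c. \<exists>s. c = (\<lambda>r\<in>{1..}. F r +> s r) \<and> (\<forall>r\<ge>1. eqm (F r) (s (Suc r)) (s r))}"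
    using F by (rule filtration_limit_eq)
  have m_eq: "?m x = ?m y \<longleftrightarrow> (\<forall>r\<ge>1. eqm (F r) x y)" if "x \<in> carrier L" "y \<in> carrier L" for x y
    using that F(1) by (auto simp: coset_eq_iff fun_eq_iff restrict_def)
  have inj: "inj_on ?m (carrier L) \<longleftrightarrow> ?sep"
  proof
    assume inj: "inj_on ?m (carrier L)"
    show ?sep
    proof (intro ballI impI)
      fix x assume x: "x \<in> carrier L" "\<forall>r\<ge>1. x \<in> F r"
      then have "?m x = ?m \<zero>" using F(1) by (subst m_eq) (auto simp: eqm_zero_iff)
      then show "x = \<zero>" using inj x by (auto dest: inj_onD)
    qed
  next
    assume sep: ?sep
    show "inj_on ?m (carrier L)"
    proof (rule inj_onI)
      fix x y assume x: "x \<in> carrier L" and y: "y \<in> carrier L" and e: "?m x = ?m y"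
      have "\<forall>r\<ge>1. x \<ominus> y \<in> F r" using e m_eq[OF x y] by (auto simp: eq_mod_def)
      then have "x \<ominus> y = \<zero>" using sep x y by auto
      then show "x = y" using x y by (simp add: diff_eq_zero_iff)
    qed
  qed
  have image: "?m ` carrier L \<subseteq> filtration_limit L F"
    unfolding lim using F(1) eqm_refl by fastforce
  have surj: "filtration_limit L F \<subseteq> ?m ` carrier L \<longleftrightarrow> ?conv"
  proof
    assume A: "filtration_limit L F \<subseteq> ?m ` carrier L"
    show ?conv
    proof (intro allI impI)
      fix s assume s: "\<forall>r\<ge>1. eqm (F r) (s (Suc r)) (s r)"
      then have "(\<lambda>r\<in>{1..}. F r +> s r) \<in> filtration_limit L F"
        unfolding lim by blast
      then obtain z where z: "z \<in> carrier L" "(\<lambda>r\<in>{1..}. F r +> s r) = ?m z" using A by blast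
      have "eqm (F r) (s r) z" if "r \<ge> 1" for r
        using fun_cong[OF z(2), of r] z(1) s that F(1) eqm_carrier(2)[of "F r"]
        by (auto simp: coset_eq_iff)
      then show "\<exists>z\<in>carrier L. \<forall>r\<ge>1. eqm (F r) (s r) z" using z by blast
    qed
  next
    assume A: ?conv
    show "filtration_limit L F \<subseteq> ?m ` carrier L"
    proof
      fix c assume "c \<in> filtration_limit L F"
      then obtain s where s: "c = (\<lambda>r\<in>{1..}. F r +> s r)" "\<forall>r\<ge>1. eqm (F r) (s (Suc r)) (s r)"
        unfolding lim by blast
      then obtain z where z: "z \<in> carrier L" "\<forall>r\<ge>1. eqm (F r) (s r) z" using A by blast
      have "c = ?m z"
      proof
        fix r
        show "c r = ?m z r"
        proof (cases "r \<ge> 1")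
          case True
          then have "F r +> s r = F r +> z" using z F(1) eqm_carrier by (subst coset_eq_iff) auto
          then show ?thesis using True by (simp add: s(1))
        qed (simp add: s(1))
      qed
      then show "c \<in> ?m ` carrier L" using z by blast
    qed
  qed
  show ?thesis
    unfolding filtration_complete_def bij_betw_def inj surj[symmetric] using image by blast
qed

text \<open>The Malcev axioms without generation in degree 1, with the bracket condition on elements
  instead of spans. This is what convergence of the Campbell--Hausdorff series rests on; generation
  is added later as \<open>lcs_dense\<close>.\<close>

locale complete_lie_algebra = rat_lie_algebra L for L :: "'a lie_record" (structure) +
  fixes F :: "nat \<Rightarrow> 'a set"
  assumes F_subspace: "r \<ge> 1 \<Longrightarrow> submodule (F r) rat_ring L"
    and F_Suc: "r \<ge> 1 \<Longrightarrow> F (Suc r) \<subseteq> F r"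
    and F_1: "F (Suc 0) = carrier L"
    and F_bracket: "r \<ge> 1 \<Longrightarrow> s \<ge> 1 \<Longrightarrow> x \<in> F r \<Longrightarrow> y \<in> F s \<Longrightarrow> x \<otimes> y \<in> F (r + s)"
    and F_complete: "filtration_complete L F"
begin

lemma F_separated: "x \<in> carrier L \<Longrightarrow> (\<And>r. r \<ge> 1 \<Longrightarrow> x \<in> F r) \<Longrightarrow> x = \<zero>"
  using F_complete filtration_complete_iff[of F] F_subspace F_Suc by blast

lemma F_converges:
  assumes "\<And>r. r \<ge> 1 \<Longrightarrow> eqm (F r) (s (Suc r)) (s r)"
  obtains z where "z \<in> carrier L" "\<And>r. r \<ge> 1 \<Longrightarrow> eqm (F r) (s r) z"
  using assms F_complete filtration_complete_iff[of F] F_subspace F_Suc by blast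

lemma F_separated_eq:
  assumes "x \<in> carrier L" "y \<in> carrier L" "\<And>r. r \<ge> 1 \<Longrightarrow> eqm (F r) x y" shows "x = y"
proof -
  have "x \<ominus> y = \<zero>" using assms by (intro F_separated) (auto simp: eq_mod_def)
  then show ?thesis using assms by (simp add: diff_eq_zero_iff)
qed

lemma F_antimono: assumes "1 \<le> r" "r \<le> s" shows "F s \<subseteq> F r"
  using assms(2)
proof (induction s rule: dec_induct)
  case (step n)
  then show ?case using F_Suc[of n] assms(1) by auto
qed auto

lemma F_ideal: "r \<ge> 1 \<Longrightarrow> lie_ideal L (F r)"
  unfolding lie_ideal_def using F_subspace F_bracket[of "Suc 0" r] F_1 F_Suc[of r] by auto

text \<open>Closedness is phrased by approximation modulo each \<open>F r\<close>, so that limits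
  can be taken by congruences alone. The topology of the statement is linked to this in
  \<open>closure_of_filtration\<close>.\<close>

definition closed_ideal :: "'a set \<Rightarrow> bool" where
  "closed_ideal J \<longleftrightarrow> lie_ideal L J \<and> (\<forall>x\<in>carrier L. (\<forall>r\<ge>1. \<exists>j\<in>J. eqm (F r) x j) \<longrightarrow> x \<in> J)"

lemma closed_ideal_ideal: "closed_ideal J \<Longrightarrow> lie_ideal L J"
  by (simp add: closed_ideal_def)

lemma closed_idealD:
  "closed_ideal J \<Longrightarrow> x \<in> carrier L \<Longrightarrow> (\<And>r. r \<ge> 1 \<Longrightarrow> \<exists>j\<in>J. eqm (F r) x j) \<Longrightarrow> x \<in> J"
  by (simp add: closed_ideal_def)

text \<open>Limit principle: if approximations of \<open>x\<close> of every precision agree with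
  \<open>y\<close> modulo \<open>J\<close>, then \<open>x \<ominus> y\<close> is a limit of elements
  of \<open>J\<close>.\<close>

lemma closed_ideal_eqmI:
  assumes J: "closed_ideal J" and x: "x \<in> carrier L" "y \<in> carrier L"
    and e: "\<And>r. r \<ge> 1 \<Longrightarrow> \<exists>z. eqm (F r) x z \<and> eqm J z y"
  shows "eqm J x y"
proof -
  have "\<exists>j\<in>J. eqm (F r) (x \<ominus> y) j" if r: "r \<ge> 1" for r
  proof -
    obtain z where z: "eqm (F r) x z" "eqm J z y" using e r by blast
    then have "eqm (F r) (x \<ominus> y) (z \<ominus> y)"
      using x r F_subspace by (intro eqm_diff eqm_refl) auto
    then show ?thesis using z(2) by (auto simp: eq_mod_def)
  qed
  then show ?thesis using x closed_idealD[OF J, of "x \<ominus> y"] by (simp add: eq_mod_def)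
qed

text \<open>Approximation modulo \<open>F k\<close> itself already forces membership.\<close>

lemma closed_ideal_F: "k \<ge> 1 \<Longrightarrow> closed_ideal (F k)"
  unfolding closed_ideal_def using F_ideal eqm_mem[OF F_subspace] by blast

lemma closed_ideal_zero: "closed_ideal {\<zero>}"
proof -
  have "x \<in> {\<zero>}" if "x \<in> carrier L" "\<forall>r\<ge>1. \<exists>j\<in>{\<zero>}. eqm (F r) x j" for x
    using that F_separated_eq[of x \<zero>] by auto
  then show ?thesis by (auto simp: closed_ideal_def lie_ideal_def subspace_trivial)
qed

text \<open>For \<open>A\<close> inside the carrier this is the intersection of all sets
  \<open>A + F r\<close>.\<close>

definition closure_in :: "'a set \<Rightarrow> 'a set" where
  "closure_in A = {x\<in>carrier L. \<forall>r\<ge>1. \<exists>a\<in>A. eqm (F r) x a}"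

lemma closure_inI:
  "x \<in> carrier L \<Longrightarrow> (\<And>r. r \<ge> 1 \<Longrightarrow> \<exists>a\<in>A. eqm (F r) x a) \<Longrightarrow> x \<in> closure_in A"
  by (simp add: closure_in_def)

lemma closure_in_carrier: "x \<in> closure_in A \<Longrightarrow> x \<in> carrier L"
  by (simp add: closure_in_def)

lemma closure_inE:
  assumes "x \<in> closure_in A" "r \<ge> 1" obtains a where "a \<in> A" "eqm (F r) x a"
  using assms by (auto simp: closure_in_def)

lemma closure_in_superset: assumes "A \<subseteq> carrier L" shows "A \<subseteq> closure_in A"
proof
  fix x assume "x \<in> A"
  then show "x \<in> closure_in A" using assms eqm_refl[OF F_subspace] by (intro closure_inI) auto
qed

lemma subspace_closure_in: assumes A: "rat_subspace A" shows "rat_subspace (closure_in A)"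
proof (rule subspaceI)
  show "\<zero> \<in> closure_in A"
    using subspace_zero[OF A] closure_in_superset[OF subspace_subset[OF A]] by blast
  show "x \<oplus> y \<in> closure_in A" if xy: "x \<in> closure_in A" "y \<in> closure_in A" for x y
  proof (rule closure_inI)
    fix r :: nat assume r: "r \<ge> 1"
    obtain a where a: "a \<in> A" "eqm (F r) x a" using closure_inE[OF xy(1) r] .
    obtain b where b: "b \<in> A" "eqm (F r) y b" using closure_inE[OF xy(2) r] .
    show "\<exists>a\<in>A. eqm (F r) (x \<oplus> y) a"
      using eqm_add[OF F_subspace[OF r] a(2) b(2)] subspace_add[OF A a(1) b(1)] by blast
  qed (use xy closure_in_carrier in auto)
  show "q \<odot> x \<in> closure_in A" if x: "x \<in> closure_in A" for q x
  proof (rule closure_inI)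
    fix r :: nat assume r: "r \<ge> 1"
    obtain a where a: "a \<in> A" "eqm (F r) x a" using closure_inE[OF x r] .
    show "\<exists>a\<in>A. eqm (F r) (q \<odot> x) a"
      using eqm_scale[OF F_subspace[OF r] a(2)] subspace_scale[OF A a(1)] by blast
  qed (use x closure_in_carrier in auto)
qed (auto simp: closure_in_carrier)

text \<open>Continuity of the bracket, which holds because each \<open>F r\<close> is an ideal. The
  sets are arbitrary, so no linear structure is involved.\<close>

lemma closure_in_bracket:
  assumes xy: "x \<in> closure_in A" "y \<in> closure_in B"
    and m: "\<And>a b. a \<in> A \<Longrightarrow> b \<in> B \<Longrightarrow> a \<otimes> b \<in> C"
  shows "x \<otimes> y \<in> closure_in C"
proof (rule closure_inI)
  fix r :: nat assume r: "r \<ge> 1"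
  obtain a where a: "a \<in> A" "eqm (F r) x a" using closure_inE[OF xy(1) r] .
  obtain b where b: "b \<in> B" "eqm (F r) y b" using closure_inE[OF xy(2) r] .
  show "\<exists>c\<in>C. eqm (F r) (x \<otimes> y) c"
    using eqm_bracket[OF F_ideal[OF r] a(2) b(2)] m[OF a(1) b(1)] by blast
qed (use xy closure_in_carrier in auto)

lemma closed_ideal_closure_in: assumes A: "lie_ideal L A" shows "closed_ideal (closure_in A)"
proof -
  have "carrier L \<subseteq> closure_in (carrier L)" by (rule closure_in_superset) simp
  then have "x \<otimes> y \<in> closure_in A" if "x \<in> carrier L" "y \<in> closure_in A" for x y
    using that ideal_right[OF A] by (intro closure_in_bracket[of x "carrier L" y A]) auto
  moreover have "x \<in> closure_in A"
    if x: "x \<in> carrier L" "\<forall>r\<ge>1. \<exists>j\<in>closure_in A. eqm (F r) x j" for x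
  proof (rule closure_inI)
    fix r :: nat assume r: "r \<ge> 1"
    obtain j where j: "j \<in> closure_in A" "eqm (F r) x j" using x r by blast
    obtain a where a: "a \<in> A" "eqm (F r) j a" using closure_inE[OF j(1) r] .
    show "\<exists>a\<in>A. eqm (F r) x a" using eqm_trans[OF j(2) a(2) F_subspace[OF r]] a(1) by blast
  qed (use x in auto)
  ultimately show ?thesis
    using subspace_closure_in[OF ideal_subspace[OF A]] by (auto simp: closed_ideal_def lie_ideal_def)
qed

subsection \<open>The filtration topology\<close>

lemma openin_coset:
  "r \<ge> 1 \<Longrightarrow> x \<in> carrier L \<Longrightarrow> openin (filtration_topology L F) (F r +> x)"
  unfolding filtration_topology_def by (rule topology_generated_by_Basis) blast

text \<open>Although the cosets are given only as a subbasis, they form a basis: a coset containing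
  \<open>x\<close> is the coset of \<open>x\<close>, and for an intersection the larger of the two
  indices works.\<close>

lemma openin_contains_coset:
  assumes "openin (filtration_topology L F) U" "x \<in> U"
  shows "\<exists>r\<ge>1. F r +> x \<subseteq> U"
proof -
  have "generate_topology_on {F r +> x | r x. r \<ge> 1 \<and> x \<in> carrier L} U"
    using assms by (simp add: filtration_topology_def openin_topology_generated_by_iff)
  then show ?thesis using assms(2)
  proof (induction rule: generate_topology_on.induct)
    case (Int a b)
    then obtain r s where rs: "r \<ge> 1" "s \<ge> 1" "F r +> x \<subseteq> a" "F s +> x \<subseteq> b" by blast
    have "F (max r s) +> x \<subseteq> a \<inter> b"
      using rs F_antimono[of r "max r s"] F_antimono[of s "max r s"]
      by (fastforce simp: a_r_coset_def')
    then show ?case using rs by (intro exI[of _ "max r s"]) auto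
  next
    case (UN K)
    then show ?case by blast
  next
    case (Basis s)
    then obtain r y where s: "s = F r +> y" "r \<ge> 1" "y \<in> carrier L" by blast
    then have "eqm (F r) x y" using Basis F_subspace by (simp add: coset_mem_iff)
    then have "F r +> x = F r +> y" using s F_subspace eqm_carrier by (subst coset_eq_iff) auto
    then show ?case using s by blast
  qed auto
qed

lemma topspace_filtration: "topspace (filtration_topology L F) = carrier L"
proof -
  have "F r +> x \<subseteq> carrier L" if "r \<ge> 1" "x \<in> carrier L" for r x
    using that F_subspace by (auto simp: coset_mem_iff eqm_carrier)
  moreover have "x \<in> F (Suc 0) +> x" if "x \<in> carrier L" for x
    using that F_subspace eqm_refl by (simp add: coset_mem_iff)
  ultimately show ?thesis by (fastforce simp: filtration_topology_def)
qed

lemma limitin_filtration_iff: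
  "limitin (filtration_topology L F) s z sequentially \<longleftrightarrow>
     z \<in> carrier L \<and> (\<forall>r\<ge>1. \<forall>\<^sub>F n in sequentially. eqm (F r) (s n) z)"
proof
  assume l: "limitin (filtration_topology L F) s z sequentially"
  then have z: "z \<in> carrier L" by (auto simp: limitin_def topspace_filtration)
  moreover have "\<forall>\<^sub>F n in sequentially. eqm (F r) (s n) z" if r: "r \<ge> 1" for r
  proof -
    have "z \<in> F r +> z" using z r F_subspace eqm_refl by (simp add: coset_mem_iff)
    then have "\<forall>\<^sub>F n in sequentially. s n \<in> F r +> z"
      using l openin_coset[OF r z] by (auto simp: limitin_def)
    then show ?thesis using z r F_subspace by (simp add: coset_mem_iff)
  qed
  ultimately show "z \<in> carrier L \<and> (\<forall>r\<ge>1. \<forall>\<^sub>F n in sequentially. eqm (F r) (s n) z)" by blast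
next
  assume z: "z \<in> carrier L \<and> (\<forall>r\<ge>1. \<forall>\<^sub>F n in sequentially. eqm (F r) (s n) z)"
  have "\<forall>\<^sub>F n in sequentially. s n \<in> U" if U: "openin (filtration_topology L F) U" "z \<in> U" for U
  proof -
    obtain r where r: "r \<ge> 1" "F r +> z \<subseteq> U" using openin_contains_coset[OF U] by blast
    have "\<forall>\<^sub>F n in sequentially. s n \<in> F r +> z"
      using z r F_subspace by (simp add: coset_mem_iff)
    then show ?thesis using r by (auto elim: eventually_mono)
  qed
  then show "limitin (filtration_topology L F) s z sequentially"
    using z by (auto simp: limitin_def topspace_filtration)
qed

lemma closure_of_filtration: 
  assumes "A \<subseteq> carrier L"
  shows "filtration_topology L F closure_of A = closure_in A"
proof (intro Set.set_eqI iffI)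
  fix x assume x: "x \<in> filtration_topology L F closure_of A"
  then have xc: "x \<in> carrier L" by (auto simp: in_closure_of topspace_filtration)
  have "\<exists>a\<in>A. eqm (F r) x a" if r: "r \<ge> 1" for r
  proof -
    have "x \<in> F r +> x" using xc r F_subspace eqm_refl by (simp add: coset_mem_iff)
    then have "\<exists>a. a \<in> A \<and> a \<in> F r +> x"
      using x openin_coset[OF r xc] unfolding in_closure_of by blast
    then show ?thesis using xc r F_subspace[OF r] eqm_sym[OF F_subspace[OF r]] by (auto simp: coset_mem_iff)
  qed
  then show "x \<in> closure_in A" using xc by (simp add: closure_in_def)
next
  fix x assume x: "x \<in> closure_in A"
  then have xc: "x \<in> carrier L" by (simp add: closure_in_def)
  have "\<exists>a. a \<in> A \<and> a \<in> U" if U: "openin (filtration_topology L F) U" "x \<in> U" for U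
  proof -
    obtain r where r: "r \<ge> 1" "F r +> x \<subseteq> U" using openin_contains_coset[OF U] by blast
    obtain a where a: "a \<in> A" "eqm (F r) x a" using closure_inE[OF x r(1)] .
    then have "a \<in> F r +> x"
      using r xc F_subspace[OF r(1)] eqm_sym by (simp add: coset_mem_iff)
    then show ?thesis using a r by blast
  qed
  then show "x \<in> filtration_topology L F closure_of A"
    using xc by (auto simp: in_closure_of topspace_filtration)
qed

subsection \<open>The Campbell--Hausdorff product\<close>

definition bch_partial :: "nat \<Rightarrow> 'a \<Rightarrow> 'a \<Rightarrow> 'a" where
  "bch_partial r x y = (\<Oplus>N\<in>{1..r}. bch_component L N x y)"

lemma bch_partial_closed [simp]:
  "x \<in> carrier L \<Longrightarrow> y \<in> carrier L \<Longrightarrow> bch_partial r x y \<in> carrier L"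
  unfolding bch_partial_def by (intro finsum_closed) auto

lemma nested_bracket_mem_F:
  "set w \<subseteq> carrier L \<Longrightarrow> w \<noteq> [] \<Longrightarrow> nested_bracket L w \<in> F (length w)"
proof (induction w)
  case (Cons x w)
  show ?case
  proof (cases "w = []")
    case False
    then have "length w \<ge> 1" by (cases w) auto
    then show ?thesis using False Cons F_bracket[of "Suc 0" "length w" x] F_1
      by (simp add: nested_bracket_Cons)
  qed (use Cons F_1 in auto)
qed auto

lemma bch_component_mem_F:
  assumes "x \<in> carrier L" "y \<in> carrier L" "N \<ge> 1" shows "bch_component L N x y \<in> F N"
proof (rule bch_component_mem[OF F_subspace[OF assms(3)]])
  fix ps assume ps: "ps \<in> bch_index N"
  have "set (bch_word ps x y) \<subseteq> carrier L" "bch_word ps x y \<noteq> []"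
    using set_bch_word[of ps x y] length_bch_word[OF ps, of x y] assms by auto
  then show "nested_bracket L (bch_word ps x y) \<in> F N"
    using nested_bracket_mem_F[of "bch_word ps x y"] length_bch_word[OF ps, of x y] by simp
qed

lemma bch_partial_Suc:
  assumes "x \<in> carrier L" "y \<in> carrier L"
  shows "bch_partial (Suc r) x y = bch_component L (Suc r) x y \<oplus> bch_partial r x y"
proof -
  have "{1..Suc r} = insert (Suc r) {1..r}" by auto
  then show ?thesis using assms unfolding bch_partial_def by (simp add: Pi_def)
qed

text \<open>The first term missing from the partial sum up to \<open>r\<close> has degree
  \<open>r + 1\<close>, hence the bound \<open>Suc r \<ge> k\<close>: modulo \<open>F k\<close> the
  terms of degree below \<open>k\<close> already determine the product.\<close>

lemma bch_partial_eqm: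
  assumes xy: "x \<in> carrier L" "y \<in> carrier L" and k: "k \<ge> 1" and r: "Suc r \<ge> k" "s \<ge> r"
  shows "eqm (F k) (bch_partial s x y) (bch_partial r x y)"
  using r(2)
proof (induction s rule: dec_induct)
  case base
  then show ?case using xy F_subspace k eqm_refl by simp
next
  case (step n)
  have "bch_component L (Suc n) x y \<in> F k"
    using bch_component_mem_F[of x y "Suc n"] F_antimono[of k "Suc n"] xy k r(1) step by auto
  then have "eqm (F k) (bch_partial (Suc n) x y) (bch_partial n x y)"
    using xy k F_subspace by (simp add: bch_partial_Suc a_comm[of "bch_component _ _ _ _"] eqm_add_right)
  then show ?case using step eqm_trans F_subspace k by blast
qed

text \<open>Since \<open>bch\<close> is a definite description of a limit, uniqueness must be shown
  as well: two limits agree modulo every \<open>F r\<close>, and the filtration is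
  separated.\<close>

lemma bch_eqI:
  assumes "x \<in> carrier L" "y \<in> carrier L" "z \<in> carrier L"
    and z: "\<And>r. r \<ge> 1 \<Longrightarrow> eqm (F r) (bch_partial r x y) z"
  shows "bch L F x y = z"
proof -
  let ?lim = "\<lambda>z. limitin (filtration_topology L F) (\<lambda>M. bch_partial M x y) z sequentially"
  have "?lim z"
    unfolding limitin_filtration_iff eventually_sequentially
  proof (intro conjI allI impI exI)
    fix r n :: nat assume r: "r \<ge> 1" and n: "n \<ge> r"
    show "eqm (F r) (bch_partial n x y) z"
      using bch_partial_eqm[of x y r r n] assms z[OF r] r n eqm_trans F_subspace by (metis le_SucI order_refl)
  qed (use assms in auto)
  moreover have "w = z" if w: "?lim w" for w
  proof (rule F_separated_eq)
    fix r :: nat assume r: "r \<ge> 1"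
    have "\<forall>\<^sub>F n in sequentially. eqm (F r) (bch_partial n x y) z \<and> eqm (F r) (bch_partial n x y) w"
      using \<open>?lim z\<close> w r unfolding limitin_filtration_iff by (auto intro: eventually_conj)
    then obtain n where "eqm (F r) (bch_partial n x y) z" "eqm (F r) (bch_partial n x y) w"
      using eventually_happens trivial_limit_sequentially by blast
    then show "eqm (F r) w z" using eqm_sym eqm_trans F_subspace r by blast
  qed (use w assms in \<open>auto simp: limitin_filtration_iff\<close>)
  ultimately show ?thesis unfolding bch_def bch_partial_def by (rule the_equality)
qed

text \<open>The partial sums are themselves a coherent sequence, so completeness supplies the
  limit.\<close>

lemma bch_limit:
  assumes xy: "x \<in> carrier L" "y \<in> carrier L"
  shows bch_closed [simp]: "bch L F x y \<in> carrier L"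
    and bch_partial_eqm_bch: "r \<ge> 1 \<Longrightarrow> eqm (F r) (bch_partial r x y) (bch L F x y)"
proof -
  obtain z where z: "z \<in> carrier L" "\<And>r. r \<ge> 1 \<Longrightarrow> eqm (F r) (bch_partial r x y) z"
    using F_converges[of "\<lambda>r. bch_partial r x y"] bch_partial_eqm[OF xy] by (metis le_SucI order_refl)
  then have "bch L F x y = z" using xy by (intro bch_eqI)
  then show "bch L F x y \<in> carrier L" "r \<ge> 1 \<Longrightarrow> eqm (F r) (bch_partial r x y) (bch L F x y)"
    using z by auto
qed

text \<open>All components of degree at least 2 lie in \<open>J\<close>; closedness carries this
  from the partial sums to the limit. With \<open>J = {\<zero>}\<close> it says that commuting
  elements multiply by addition.\<close>

lemma bch_eqm_add:
  assumes J: "closed_ideal J" and xy: "x \<in> carrier L" "y \<in> carrier L" and b: "x \<otimes> y \<in> J"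
  shows "eqm J (bch L F x y) (x \<oplus> y)"
proof (rule closed_ideal_eqmI[OF J])
  note S = ideal_subspace[OF closed_ideal_ideal[OF J]]
  fix r :: nat assume r: "r \<ge> 1"
  have "eqm J (bch_partial r x y) (x \<oplus> y)"
    using r
  proof (induction r rule: dec_induct)
    case base
    then show ?case using xy S eqm_refl by (simp add: bch_partial_def bch_component_1)
  next
    case (step n)
    have "bch_component L (Suc n) x y \<in> J"
      using bch_component_mem_ideal[OF closed_ideal_ideal[OF J] xy b] step by auto
    then have "eqm J (bch_partial (Suc n) x y) (bch_partial n x y)"
      using xy S by (simp add: bch_partial_Suc a_comm[of "bch_component _ _ _ _"] eqm_add_right)
    then show ?case using step eqm_trans S by blast
  qed
  then show "\<exists>z. eqm (F r) (bch L F x y) z \<and> eqm J z (x \<oplus> y)"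
    using bch_partial_eqm_bch[OF xy r] eqm_sym F_subspace r by blast
qed (use xy in auto)

lemma bch_commuting:
  "x \<in> carrier L \<Longrightarrow> y \<in> carrier L \<Longrightarrow> x \<otimes> y = \<zero> \<Longrightarrow> bch L F x y = x \<oplus> y"
  using bch_eqm_add[OF closed_ideal_zero, of x y] by (simp add: eqm_trivial_iff)

text \<open>Modulo \<open>J\<close> the two inner products are \<open>x \<oplus> y\<close> and its
  negative, so they commute modulo \<open>J\<close> and multiply to zero. The bracketing of the four
  factors is fixed here; regrouping is done in the group \<open>G\<close> by
  \<open>rho_commutator\<close>.\<close>

lemma bch_commutator_mem:
  assumes J: "closed_ideal J" and xy: "x \<in> carrier L" "y \<in> carrier L" and b: "x \<otimes> y \<in> J"
  shows "bch L F (bch L F x y) (bch L F (\<ominus> x) (\<ominus> y)) \<in> J"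
proof -
  note I = closed_ideal_ideal[OF J]
  note S = ideal_subspace[OF I]
  let ?u = "bch L F x y" and ?v = "bch L F (\<ominus> x) (\<ominus> y)"
  have u: "eqm J ?u (x \<oplus> y)" by (rule bch_eqm_add[OF J xy b])
  have "\<ominus> x \<oplus> \<ominus> y = \<ominus> (x \<oplus> y)" using xy by (simp add: minus_add)
  moreover have "eqm J ?v (\<ominus> x \<oplus> \<ominus> y)"
    using xy b by (intro bch_eqm_add[OF J]) (auto simp: bracket_minus_left bracket_minus_right)
  ultimately have v: "eqm J ?v (\<ominus> (x \<oplus> y))" by simp
  have "eqm J (?u \<otimes> ?v) ((x \<oplus> y) \<otimes> (\<ominus> (x \<oplus> y)))" by (rule eqm_bracket[OF I u v])
  then have "?u \<otimes> ?v \<in> J"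
    using xy bracket_self[of "x \<oplus> y"] S subspace_zero subspace_minus eqm_mem
    by (simp add: bracket_minus_right)
  then have "eqm J (bch L F ?u ?v) (?u \<oplus> ?v)" using xy by (intro bch_eqm_add[OF J]) auto
  moreover have "eqm J (?u \<oplus> ?v) \<zero>"
    using eqm_add[OF S u v] xy by (simp add: r_neg)
  ultimately show ?thesis using S eqm_trans eqm_zero_iff by blast
qed

text \<open>Beyond degree \<open>n\<close> the components vanish. The sum is taken up to
  \<open>n + 2\<close> so that degrees 1 and 2 can be split off whatever \<open>n\<close>
  is.\<close>

lemma bch_lie_poly:
  assumes n: "n \<ge> 1" "F n = {\<zero>}" and p: "p \<in> lie_poly L 1" "q \<in> lie_poly L 1"
  obtains h where "h \<in> lie_poly L 3"
    "\<And>a. bch L F (p a) (q a) = (p a \<oplus> q a) \<oplus> ((1/2) \<odot> (p a \<otimes> q a) \<oplus> h a)"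
proof
  let ?h = "\<lambda>a. \<Oplus>N\<in>{3..n + 2}. bch_component L N (p a) (q a)"
  show "?h \<in> lie_poly L 3"
    using p by (intro lie_poly_finsum lie_poly_mono[OF lie_poly_bch_component]) auto
  fix a
  have c: "p a \<in> carrier L" "q a \<in> carrier L" using p lie_poly_closed by auto
  have "F (n + 2) = {\<zero>}"
    using F_antimono[of n "n + 2"] n F_subspace[of "n + 2"] subspace_zero[of "F (n + 2)"] by auto
  then have "bch L F (p a) (q a) = bch_partial (n + 2) (p a) (q a)"
    using bch_partial_eqm_bch[OF c, of "n + 2"] by (simp add: eqm_trivial_iff)
  also have "\<dots> = bch_component L 1 (p a) (q a) \<oplus> (bch_component L 2 (p a) (q a) \<oplus> ?h a)"
  proof -
    have "{1..n + 2} = insert 1 (insert 2 {3..n + 2})" by auto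
    then show ?thesis using c by (simp add: bch_partial_def Pi_def)
  qed
  finally show "bch L F (p a) (q a) = (p a \<oplus> q a) \<oplus> ((1/2) \<odot> (p a \<otimes> q a) \<oplus> ?h a)"
    using c bch_component_1 bch_component_2 by (simp add: numeral_2_eq_2)
qed

end

text \<open>A filtered Lie homomorphism is continuous and maps partial sums to partial sums, hence
  limits to limits.\<close>

lemma (in lie_algebra_hom) hom_bch:
  assumes A: "complete_lie_algebra A F" and B: "complete_lie_algebra B E"
    and F: "\<And>r. r \<ge> 1 \<Longrightarrow> \<phi> ` F r \<subseteq> E r" and xy: "x \<in> carrier A" "y \<in> carrier A"
  shows "\<phi> (bch A F x y) = bch B E (\<phi> x) (\<phi> y)"
proof (rule complete_lie_algebra.bch_eqI[OF B, symmetric])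
  interpret FA: complete_lie_algebra A F by (rule A)
  interpret FB: complete_lie_algebra B E by (rule B)
  fix r :: nat assume r: "r \<ge> 1"
  have "\<phi> (FA.bch_partial r x y) = FB.bch_partial r (\<phi> x) (\<phi> y)"
    using xy by (simp add: FA.bch_partial_def FB.bch_partial_def hom_finsum hom_bch_component)
  moreover have "eq_mod A (F r) (FA.bch_partial r x y) (bch A F x y)"
    using FA.bch_partial_eqm_bch xy r by blast
  then have "\<phi> (FA.bch_partial r x y \<ominus>\<^bsub>A\<^esub> bch A F x y) \<in> E r" using F[OF r] by (auto simp: eq_mod_def)
  ultimately show "eq_mod B (E r) (FB.bch_partial r (\<phi> x) (\<phi> y)) (\<phi> (bch A F x y))"
    using xy by (simp add: eq_mod_def hom_diff)
qed (use xy complete_lie_algebra.bch_closed[OF A] in auto)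

subsection \<open>Quotients by closed ideals\<close>

text \<open>Every element of \<open>Q\<close> has a preimage, so each axiom of \<open>Q\<close> is
  the image of the same axiom of \<open>L\<close>. Quotients by ideals are obtained from this
  without computing inside cosets.\<close>

lemma (in rat_lie_algebra) surjective_image_lie_algebra:
  fixes Q :: "'b lie_record" and p :: "'a \<Rightarrow> 'b"
  assumes carrier: "carrier Q = p ` carrier L" and zero: "\<zero>\<^bsub>Q\<^esub> = p \<zero>"
    and add: "\<And>x y. x \<in> carrier L \<Longrightarrow> y \<in> carrier L \<Longrightarrow> p x \<oplus>\<^bsub>Q\<^esub> p y = p (x \<oplus> y)"
    and scale: "\<And>q x. x \<in> carrier L \<Longrightarrow> q \<odot>\<^bsub>Q\<^esub> p x = p (q \<odot> x)"
    and bracket: "\<And>x y. x \<in> carrier L \<Longrightarrow> y \<in> carrier L \<Longrightarrow> p x \<otimes>\<^bsub>Q\<^esub> p y = p (x \<otimes> y)"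
  shows "lie_algebra_hom L Q p"
proof -
  have "abelian_group Q"
  proof (rule abelian_groupI)
    fix u assume "u \<in> carrier Q"
    then obtain x where x: "x \<in> carrier L" "u = p x" using carrier by blast
    then have "p (\<ominus> x) \<oplus>\<^bsub>Q\<^esub> u = \<zero>\<^bsub>Q\<^esub>" "p (\<ominus> x) \<in> carrier Q"
      using add zero carrier by (auto simp: l_neg)
    then show "\<exists>y\<in>carrier Q. y \<oplus>\<^bsub>Q\<^esub> u = \<zero>\<^bsub>Q\<^esub>" by blast
  qed (auto simp: carrier zero add a_ac)
  then have "Module.module rat_ring Q"
    by (intro moduleI cring_rat_ring)
      (auto simp: carrier add scale scale_add_left scale_add_right)
  then have "rat_lie_algebra Q"
    by (intro rat_lie_algebra.intro rat_lie_algebra_axioms.intro)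
      (auto simp: carrier zero add scale bracket bracket_add_left bracket_add_right bracket_smult_left
        bracket_smult_right bracket_self jacobi)
  then show ?thesis
    by (intro lie_algebra_hom.intro lie_algebra_hom_axioms.intro rat_lie_algebra_axioms)
      (auto simp: carrier add scale bracket)
qed

lemma (in lie_algebra_hom) subspace_image:
  assumes "A.rat_subspace W" shows "B.rat_subspace (\<phi> ` W)"
proof (rule B.subspaceI)
  note c = A.subspace_carrier[OF assms]
  show "\<phi> ` W \<subseteq> carrier B" using c by auto
  show "\<zero>\<^bsub>B\<^esub> \<in> \<phi> ` W" using A.subspace_zero[OF assms] hom_zero by force
  show "x \<oplus>\<^bsub>B\<^esub> y \<in> \<phi> ` W" if "x \<in> \<phi> ` W" "y \<in> \<phi> ` W" for x y
    using that c A.subspace_add[OF assms] by (auto simp flip: hom_add)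
  show "q \<odot>\<^bsub>B\<^esub> x \<in> \<phi> ` W" if "x \<in> \<phi> ` W" for q x
    using that c A.subspace_scale[OF assms] by (auto simp flip: hom_scale)
qed

lemma (in lie_algebra_hom) subspace_vimage:
  assumes "B.rat_subspace W" shows "A.rat_subspace {x\<in>carrier A. \<phi> x \<in> W}"
  using B.subspace_zero[OF assms] B.subspace_add[OF assms] B.subspace_scale[OF assms]
  by (intro A.subspaceI) (auto simp: hom_add hom_scale)

context rat_lie_algebra
begin

lemma carrier_lie_quotient: "carrier (lie_quotient L J) = (\<lambda>x. J +> x) ` carrier L"
  by (auto simp: lie_quotient_def A_RCOSETS_def')

lemma zero_lie_quotient: "\<zero>\<^bsub>lie_quotient L J\<^esub> = J"
  by (simp add: lie_quotient_def)

lemma coset_in_carrier_quotient: "x \<in> carrier L \<Longrightarrow> J +> x \<in> carrier (lie_quotient L J)"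
  by (simp add: carrier_lie_quotient)

lemma set_add_cosets:
  assumes "rat_subspace J" "x \<in> carrier L" "y \<in> carrier L"
  shows "(J +> x) <+>\<^bsub>L\<^esub> (J +> y) = J +> (x \<oplus> y)"
proof -
  interpret abelian_subgroup J L
    using assms submodule.axioms(1) abelian_group_axioms
    by (intro abelian_subgroupI3 additive_subgroup.intro) auto
  show ?thesis using assms by (intro a_rcos_sum)
qed

lemma scale_coset:
  assumes "rat_subspace J" "x \<in> carrier L"
  shows "(\<Union>a\<in>J +> x. J +> (q \<odot> a)) = J +> (q \<odot> x)"
proof -
  have "J +> (q \<odot> a) = J +> (q \<odot> x)" if "a \<in> J +> x" for a
    using that assms eqm_scale[OF assms(1)] eqm_carrier[of J a x]
    by (simp add: coset_mem_iff coset_eq_iff)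
  moreover have "x \<in> J +> x" using assms eqm_refl by (simp add: coset_mem_iff)
  ultimately show ?thesis by blast
qed

text \<open>The bracket and the scaling of cosets are unions over representatives; the ideal
  property makes all cosets in such a union equal.\<close>

lemma lie_algebra_hom_quotient:
  assumes J: "lie_ideal L J" shows "lie_algebra_hom L (lie_quotient L J) (\<lambda>x. J +> x)"
proof (rule surjective_image_lie_algebra)
  note S = ideal_subspace[OF J]
  show "\<zero>\<^bsub>lie_quotient L J\<^esub> = J +> \<zero>"
    using S subspace_subset by (simp add: zero_lie_quotient)
  fix x y assume xy: "x \<in> carrier L" "y \<in> carrier L"
  show "(J +> x) \<oplus>\<^bsub>lie_quotient L J\<^esub> (J +> y) = J +> (x \<oplus> y)"
    using xy S by (simp add: lie_quotient_def set_add_cosets)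
  show "(J +> x) \<otimes>\<^bsub>lie_quotient L J\<^esub> (J +> y) = J +> (x \<otimes> y)"
  proof -
    have "J +> (a \<otimes> b) = J +> (x \<otimes> y)" if "a \<in> J +> x" "b \<in> J +> y" for a b
      using that xy S eqm_bracket[OF J, of a x b y] eqm_carrier[of J a x] eqm_carrier[of J b y]
      by (simp add: coset_mem_iff coset_eq_iff)
    moreover have "x \<in> J +> x" "y \<in> J +> y" using xy S eqm_refl by (simp_all add: coset_mem_iff)
    ultimately have "(\<Union>a\<in>J +> x. \<Union>b\<in>J +> y. J +> (a \<otimes> b)) = J +> (x \<otimes> y)" by blast
    then show ?thesis by (simp add: lie_quotient_def rcoset_mult_def)
  qed
next
  fix q x assume "x \<in> carrier L"
  then show "q \<odot>\<^bsub>lie_quotient L J\<^esub> (J +> x) = J +> (q \<odot> x)"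
    using ideal_subspace[OF J] by (simp add: lie_quotient_def scale_coset)
qed (rule carrier_lie_quotient)

end

text \<open>Closedness of \<open>J\<close> gives separatedness; convergence comes from lifting
  coherent sequences to coherent sequences in \<open>L\<close>.\<close>

lemma (in complete_lie_algebra) complete_quotient:
  assumes J: "closed_ideal J"
  shows "complete_lie_algebra (lie_quotient L J) (quotient_filtration L J F)"
proof -
  note I = closed_ideal_ideal[OF J]
  note S = ideal_subspace[OF I]
  let ?Q = "lie_quotient L J" and ?E = "quotient_filtration L J F" and ?p = "\<lambda>x. J +> x"
  interpret p: lie_algebra_hom L ?Q ?p by (rule lie_algebra_hom_quotient[OF I])
  have E: "?E r = ?p ` F r" for r by (simp add: quotient_filtration_def)
  have p_eq: "?p x = ?p y \<longleftrightarrow> eqm J x y" if "x \<in> carrier L" "y \<in> carrier L" for x y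
    using that S by (rule coset_eq_iff[rotated])
  have Fc: "x \<in> carrier L" if "x \<in> F r" "r \<ge> 1" for x r
    using that F_subspace subspace_carrier by blast
  have sub: "p.B.rat_subspace (?E r)" if "r \<ge> 1" for r
    unfolding E using that F_subspace by (intro p.subspace_image)
  have dec: "?E (Suc r) \<subseteq> ?E r" if "r \<ge> 1" for r
    unfolding E using F_Suc[OF that] by (rule image_mono)
  \<comment> \<open>An element in all filtration steps of the quotient has a representative that
    lies in \<open>J + F r\<close> for every \<open>r\<close>, hence in the closed set
    \<open>J\<close>.\<close>
  have sep: "X = \<zero>\<^bsub>?Q\<^esub>" if X: "X \<in> carrier ?Q" "\<forall>r\<ge>1. X \<in> ?E r" for X
  proof -
    obtain x where x: "x \<in> carrier L" "X = ?p x" using X by (auto simp: carrier_lie_quotient)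
    have "x \<in> J"
    proof (rule closed_idealD[OF J x(1)])
      fix r :: nat assume r: "r \<ge> 1"
      then obtain y where y: "y \<in> F r" "eqm J x y" using X x p_eq Fc[of _ r] unfolding E by auto
      have "x \<ominus> (x \<ominus> y) = y"
        using x(1) Fc[OF y(1) r] by (simp add: a_minus_def minus_add r_neg2)
      then have "eqm (F r) x (x \<ominus> y)" using x(1) Fc[OF y(1) r] y(1) by (simp add: eq_mod_def)
      moreover have "x \<ominus> y \<in> J" using y by (simp add: eq_mod_def)
      ultimately show "\<exists>j\<in>J. eqm (F r) x j" by blast
    qed
    then show ?thesis using x S by (simp add: zero_lie_quotient coset_eq_self_iff)
  qed
  have conv: "\<exists>Z\<in>carrier ?Q. \<forall>r\<ge>1. eq_mod ?Q (?E r) (s r) Z"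
    if s: "\<forall>r\<ge>1. eq_mod ?Q (?E r) (s (Suc r)) (s r)" for s
  proof -
    have sc: "s r \<in> carrier ?Q" if "r \<ge> 1" for r using s that by (auto simp: eq_mod_def)
    have "\<forall>r. \<exists>x. r \<ge> 1 \<longrightarrow> x \<in> carrier L \<and> s r = ?p x"
      using sc by (auto simp: carrier_lie_quotient)
    then obtain t where t: "\<And>r. r \<ge> 1 \<Longrightarrow> t r \<in> carrier L" "\<And>r. r \<ge> 1 \<Longrightarrow> s r = ?p (t r)"
      by metis
    \<comment> \<open>Arbitrary lifts of a coherent sequence agree only modulo
      \<open>J + F r\<close>. Here the part in \<open>F r\<close> is isolated, to be used as the
      increment of a better lift.\<close>
    have "\<exists>z\<in>F r. ?p (t (Suc r)) = ?p (t r \<oplus> z)" if r: "r \<ge> 1" for r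
    proof -
      have "?p (t (Suc r)) \<ominus>\<^bsub>?Q\<^esub> ?p (t r) \<in> ?E r"
        using s r t(2)[of r] t(2)[of "Suc r"] by (auto simp: eq_mod_def)
      then obtain z where z: "z \<in> F r" "?p (t (Suc r)) \<ominus>\<^bsub>?Q\<^esub> ?p (t r) = ?p z" unfolding E by auto
      have "?p (t (Suc r)) = ?p (t (Suc r)) \<ominus>\<^bsub>?Q\<^esub> ?p (t r) \<oplus>\<^bsub>?Q\<^esub> ?p (t r)"
        using t(1)[of r] t(1)[of "Suc r"] r by (simp add: coset_in_carrier_quotient)
      also have "\<dots> = ?p (t r \<oplus> z)"
        unfolding z(2) using Fc[OF z(1) r] t(1)[OF r] by (simp add: p.hom_add[symmetric] a_comm)
      finally show ?thesis using z by blast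
    qed
    then obtain z where z: "\<And>r. r \<ge> 1 \<Longrightarrow> z r \<in> F r"
      "\<And>r. r \<ge> 1 \<Longrightarrow> ?p (t (Suc r)) = ?p (t r \<oplus> z r)" by metis
    \<comment> \<open>The coherent lift \<open>t 1 + z 1 + ... + z (r - 1)\<close>. The recursion
      starts at 0 while the filtration starts at 1, so the first step only repeats
      \<open>t 1\<close>.\<close>
    define u where "u = rec_nat (t 1) (\<lambda>r x. if r = 0 then t 1 else x \<oplus> z r)"
    have u1: "u 1 = t 1" by (simp add: u_def)
    have uS: "u (Suc r) = u r \<oplus> z r" if "r \<ge> 1" for r using that by (simp add: u_def)
    have u: "u r \<in> carrier L \<and> ?p (u r) = s r" if "r \<ge> 1" for r
      using that
    proof (induction r rule: dec_induct)
      case base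
      then show ?case using t u1 by simp
    next
      case (step n)
      then show ?case
        using z[of n] t(1)[of n] t(2)[of n] t(2)[of "Suc n"] Fc[of "z n" n] by (simp add: uS p.hom_add)
    qed
    have "eqm (F r) (u (Suc r)) (u r)" if "r \<ge> 1" for r
      using that z(1) u F_subspace by (simp add: uS eqm_add_right)
    then obtain w where w: "w \<in> carrier L" "\<And>r. r \<ge> 1 \<Longrightarrow> eqm (F r) (u r) w"
      using F_converges by blast
    have "eq_mod ?Q (?E r) (s r) (?p w)" if r: "r \<ge> 1" for r
    proof -
      have "?p (u r) \<ominus>\<^bsub>?Q\<^esub> ?p w = ?p (u r \<ominus> w)" using u[OF r] w(1) by (simp add: p.hom_diff)
      also have "\<dots> \<in> ?E r" using w(2)[OF r] by (auto simp: E eq_mod_def)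
      finally show ?thesis
        using u[OF r] w(1) sc[OF r] by (simp add: eq_mod_def coset_in_carrier_quotient)
    qed
    then show ?thesis using w(1) coset_in_carrier_quotient by blast
  qed
  show ?thesis
  proof (intro complete_lie_algebra.intro complete_lie_algebra_axioms.intro)
    show "rat_lie_algebra ?Q" by (rule p.B.rat_lie_algebra_axioms)
    show "filtration_complete ?Q ?E"
      using sub dec sep conv by (subst p.B.filtration_complete_iff) auto
    show "?E (Suc 0) = carrier ?Q" using F_1 by (simp add: E carrier_lie_quotient)
    fix r s x y assume rs: "(r::nat) \<ge> 1" "(s::nat) \<ge> 1" "x \<in> ?E r" "y \<in> ?E s"
    then show "x \<otimes>\<^bsub>?Q\<^esub> y \<in> ?E (r + s)"
      using F_bracket[OF rs(1,2)] Fc[OF _ rs(1)] Fc[OF _ rs(2)] unfolding E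
      by (auto simp flip: p.hom_bracket)
  qed (use sub dec in auto)
qed

section \<open>Products of ideals and of spans\<close>

lemma (in rat_lie_algebra) ideal_lie_product:
  assumes A: "lie_ideal L A" and B: "lie_ideal L B" shows "lie_ideal L (lie_product L A B)"
proof -
  let ?P = "lie_product L A B"
  have c: "A \<subseteq> carrier L" "B \<subseteq> carrier L" using A B ideal_subspace subspace_subset by blast+
  then have P: "rat_subspace ?P" by (rule lie_product_subspace)
  have "x \<otimes> y \<in> ?P" if x: "x \<in> carrier L" and y: "y \<in> ?P" for x y
  proof -
    have "rat_subspace {y\<in>carrier L. x \<otimes> y \<in> ?P}"
      using x P by (intro subspaceI)
        (auto simp: subspace_zero bracket_add_right subspace_add bracket_smult_right subspace_scale)
    moreover have "x \<otimes> (a \<otimes> b) \<in> ?P" if ab: "a \<in> A" "b \<in> B" for a b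
    proof -
      have abc: "a \<in> carrier L" "b \<in> carrier L" using ab c by auto
      \<comment> \<open>The Jacobi identity moves \<open>x\<close> onto one factor at a time, and
        both factors come from ideals.\<close>
      have "x \<otimes> (a \<otimes> b) \<oplus> (a \<otimes> (b \<otimes> x) \<oplus> b \<otimes> (x \<otimes> a)) = \<zero>"
        using jacobi[OF x abc] x abc by (simp add: a_assoc)
      then have "x \<otimes> (a \<otimes> b) = \<ominus> (a \<otimes> (b \<otimes> x) \<oplus> b \<otimes> (x \<otimes> a))"
        using x abc by (simp add: minus_equality)
      moreover have "a \<otimes> (b \<otimes> x) \<in> ?P"
        using ab ideal_left[OF B x] by (intro lie_product_memI)
      moreover have "b \<otimes> (x \<otimes> a) \<in> ?P"
        using ab ideal_right[OF A x] P lie_product_memI[of "x \<otimes> a" A b B] bracket_antisym[of b "x \<otimes> a"] x abc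
        by (simp add: subspace_minus)
      ultimately show ?thesis using P by (simp add: subspace_add subspace_minus)
    qed
    ultimately have "?P \<subseteq> {y\<in>carrier L. x \<otimes> y \<in> ?P}"
      using c by (intro lie_product_least) (auto intro!: bracket_closed)
    then show ?thesis using y by blast
  qed
  then show ?thesis using P by (simp add: lie_ideal_def)
qed

lemma (in rat_lie_algebra) ideal_carrier: "lie_ideal L (carrier L)"
  using subspace_UNIV by (simp add: lie_ideal_def)

lemma (in rat_lie_algebra) ideal_lie_derived: "lie_ideal L (lie_derived L i)"
  by (induction i) (simp_all add: ideal_carrier ideal_lie_product)

text \<open>Bilinearity, one argument at a time: with the other argument fixed, the elements whose
  bracket falls into \<open>W\<close> form a subspace.\<close>

lemma (in rat_lie_algebra) lie_product_span_subset:
  assumes W: "rat_subspace W" and S: "S \<subseteq> carrier L" "T \<subseteq> carrier L"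
    and st: "\<And>s t. s \<in> S \<Longrightarrow> t \<in> T \<Longrightarrow> s \<otimes> t \<in> W"
  shows "lie_product L (rat_span L S) (rat_span L T) \<subseteq> W"
proof (rule lie_product_least[OF W])
  fix x y assume x: "x \<in> rat_span L S" and y: "y \<in> rat_span L T"
  have yc: "y \<in> carrier L" using y S rat_span_subspace subspace_carrier by blast
  have right: "s \<otimes> y \<in> W" if s: "s \<in> S" for s
  proof -
    have "rat_subspace {y\<in>carrier L. s \<otimes> y \<in> W}"
      using s S W by (intro subspaceI)
        (auto simp: subset_iff subspace_zero bracket_add_right subspace_add bracket_smult_right subspace_scale)
    then have "rat_span L T \<subseteq> {y\<in>carrier L. s \<otimes> y \<in> W}"
      using S st s by (intro rat_span_least) auto
    then show ?thesis using y by blast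
  qed
  have "rat_subspace {x\<in>carrier L. x \<otimes> y \<in> W}"
    using yc W by (intro subspaceI)
      (auto simp: subspace_zero bracket_add_left subspace_add bracket_smult_left subspace_scale)
  then have "rat_span L S \<subseteq> {x\<in>carrier L. x \<otimes> y \<in> W}"
    using S right by (intro rat_span_least) auto
  then show "x \<otimes> y \<in> W" using x by blast
qed

subsection \<open>Homomorphisms of groups into exponential groups\<close>

abbreviation commutators :: "('g, 'm) monoid_scheme \<Rightarrow> 'g set \<Rightarrow> 'g set \<Rightarrow> 'g set" where
  "commutators G A B \<equiv>
     {g \<otimes>\<^bsub>G\<^esub> h \<otimes>\<^bsub>G\<^esub> inv\<^bsub>G\<^esub> g \<otimes>\<^bsub>G\<^esub> inv\<^bsub>G\<^esub> h | g h. g \<in> A \<and> h \<in> B}"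

lemma derived_eq_generate_commutators:
  "derived G H = generate G (commutators G H H)"
  unfolding derived_def by (rule arg_cong[of _ _ "generate G"]) blast

lemma (in group) nat_pow_mem_subgroup: "subgroup H G \<Longrightarrow> x \<in> H \<Longrightarrow> x [^] (n::nat) \<in> H"
  by (induction n) (auto simp: subgroup.one_closed subgroup.m_closed)

text \<open>A conjugate of a commutator is the commutator of the conjugates.\<close>

lemma (in group) lower_central_normal: "lower_central G r \<lhd> G"
proof (induction r rule: induct_nat_012)
  case (ge2 r)
  interpret N: normal "lower_central G (Suc r)" G by (rule ge2)
  show ?case unfolding lower_central.simps
  proof (rule normal_generateI)
    fix h g
    assume h: "h \<in> commutators G (lower_central G (Suc r)) (carrier G)"
      and g: "g \<in> carrier G"
    then obtain x y where xy: "x \<in> lower_central G (Suc r)" "y \<in> carrier G" "h = x \<otimes> y \<otimes> inv x \<otimes> inv y"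
      by blast
    then have x: "x \<in> carrier G" using N.subset by blast
    let ?x = "g \<otimes> x \<otimes> inv g" and ?y = "g \<otimes> y \<otimes> inv g"
    have "inv ?x = g \<otimes> inv x \<otimes> inv g" "inv ?y = g \<otimes> inv y \<otimes> inv g"
      using x xy g by (simp_all add: inv_mult_group m_assoc)
    moreover have "inv g \<otimes> (g \<otimes> z) = z" if "z \<in> carrier G" for z
      using that g by (simp flip: m_assoc)
    ultimately have "g \<otimes> h \<otimes> inv g = ?x \<otimes> ?y \<otimes> inv ?x \<otimes> inv ?y"
      using x xy g by (simp add: m_assoc)
    moreover have "?x \<in> lower_central G (Suc r)" "?y \<in> carrier G"
      using xy g N.inv_op_closed2 by auto
    ultimately show "g \<otimes> h \<otimes> inv g \<in> commutators G (lower_central G (Suc r)) (carrier G)"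
      by blast
  qed (use N.subset in auto)
qed (simp_all add: normal_self)

lemma (in group) derived_series_normal: "derived_series G i \<lhd> G"
  by (induction i) (simp_all add: derived_series_def normal_self derived_is_normal)

text \<open>Only the source is assumed to be a group. The target is a set with the product
  \<open>bch\<close>, so the behaviour of \<open>\<rho>\<close> on the identity and on inverses has
  to be extracted from the series.\<close>

locale exp_hom = complete_lie_algebra L F + G?: group G
  for L :: "'a lie_record" (structure) and F and G :: "('g, 'm) monoid_scheme" +
  fixes \<rho> :: "'g \<Rightarrow> 'a"
  assumes rho_hom: "\<rho> \<in> hom G (exp_group L F)"
begin

lemma rho_closed [simp]: "g \<in> carrier G \<Longrightarrow> \<rho> g \<in> carrier L"
  using rho_hom by (auto simp: hom_def exp_group_def)

lemma rho_mult: "g \<in> carrier G \<Longrightarrow> h \<in> carrier G \<Longrightarrow> \<rho> (g \<otimes>\<^bsub>G\<^esub> h) = bch L F (\<rho> g) (\<rho> h)"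
  using rho_hom by (auto simp: hom_def exp_group_def)

lemma rho_one: "\<rho> \<one>\<^bsub>G\<^esub> = \<zero>"
proof -
  let ?z = "\<rho> \<one>\<^bsub>G\<^esub>"
  have "?z = bch L F ?z ?z" using rho_mult[of "\<one>\<^bsub>G\<^esub>" "\<one>\<^bsub>G\<^esub>"] by simp
  also have "\<dots> = ?z \<oplus> ?z" by (rule bch_commuting) (auto intro: bracket_self)
  finally show ?thesis by (metis G.one_closed add.r_cancel_one' rho_closed)
qed

lemma rho_pow:
  assumes g: "g \<in> carrier G" shows "\<rho> (g [^]\<^bsub>G\<^esub> (n::nat)) = of_nat n \<odot> \<rho> g"
proof (induction n)
  case (Suc n)
  have "\<rho> (g [^]\<^bsub>G\<^esub> Suc n) = bch L F (of_nat n \<odot> \<rho> g) (\<rho> g)"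
    using g Suc by (simp add: rho_mult)
  also have "\<dots> = of_nat n \<odot> \<rho> g \<oplus> \<rho> g"
    using g bracket_self by (intro bch_commuting) (auto simp: bracket_smult_left)
  also have "\<dots> = of_nat (Suc n) \<odot> \<rho> g"
    using g scale_add_left[of "\<rho> g" "of_nat n" 1] by (simp add: add.commute)
  finally show ?case .
qed (use g rho_one in simp)

text \<open>The product of \<open>g^a\<close> and \<open>g^(-a)\<close> is trivial for all \<open>a\<close>, so the linear coefficient vanishes.\<close>

lemma rho_inv: assumes g: "g \<in> carrier G" shows "\<rho> (inv\<^bsub>G\<^esub> g) = \<ominus> \<rho> g"
proof -
  let ?x = "\<rho> g" and ?y = "\<rho> (inv\<^bsub>G\<^esub> g)"
  have xy: "?x \<in> carrier L" "?y \<in> carrier L" using g by auto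
  \<comment> \<open>Working modulo one \<open>F r\<close> at a time truncates the series to a
    polynomial of degree \<open>r\<close>, so the argument applies to any complete algebra.\<close>
  have "?x \<oplus> ?y = \<zero>"
  proof (rule F_separated)
    fix r :: nat assume r: "r \<ge> 1"
    \<comment> \<open>Degree 0 is padded with zero, since coefficient comparison sums from 0 and the
      series starts at 1.\<close>
    let ?v = "\<lambda>N. if N = 0 then \<zero> else bch_component L N ?x ?y"
    have "?v 1 \<in> F r"
    proof (rule polynomial_coeff_mem[OF F_subspace[OF r]])
      fix a :: nat assume "a \<ge> 1"
      let ?q = "of_nat a :: rat"
      have "bch L F (?q \<odot> ?x) (?q \<odot> ?y) = \<zero>"
      proof -
        have "g [^]\<^bsub>G\<^esub> a \<otimes>\<^bsub>G\<^esub> inv\<^bsub>G\<^esub> g [^]\<^bsub>G\<^esub> a = \<one>\<^bsub>G\<^esub>"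
          using g by (simp add: nat_pow_inv)
        then show ?thesis
          using g rho_one rho_mult[of "g [^]\<^bsub>G\<^esub> a" "inv\<^bsub>G\<^esub> g [^]\<^bsub>G\<^esub> a"] by (simp add: rho_pow)
      qed
      then have "eqm (F r) (bch_partial r (?q \<odot> ?x) (?q \<odot> ?y)) \<zero>"
        using bch_partial_eqm_bch[of "?q \<odot> ?x" "?q \<odot> ?y" r] xy r by simp
      then have "bch_partial r (?q \<odot> ?x) (?q \<odot> ?y) \<in> F r"
        using eqm_zero_iff F_subspace r by blast
      moreover have "bch_partial r (?q \<odot> ?x) (?q \<odot> ?y) = (\<Oplus>N\<in>{1..r}. ?q ^ N \<odot> ?v N)"
        unfolding bch_partial_def using xy
        by (intro finsum_cong') (auto simp: bch_component_scale)
      moreover have "(\<Oplus>N\<in>{..r}. ?q ^ N \<odot> ?v N) = (\<Oplus>N\<in>{1..r}. ?q ^ N \<odot> ?v N)"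
      proof -
        have "{..r} = insert 0 {1..r}" by auto
        then show ?thesis using xy by (simp add: Pi_def)
      qed
      ultimately show "(\<Oplus>N\<in>{..r}. ?q ^ N \<odot> ?v N) \<in> F r" by simp
    qed (use xy r in auto)
    then show "?x \<oplus> ?y \<in> F r" using xy by (simp add: bch_component_1)
  qed (use xy in auto)
  then show ?thesis using xy by (metis minus_equality a_comm)
qed

lemma subgroup_vimage:
  assumes J: "closed_ideal J" shows "subgroup {g\<in>carrier G. \<rho> g \<in> J} G"
proof -
  note I = closed_ideal_ideal[OF J]
  note S = ideal_subspace[OF I]
  have "bch L F x y \<in> J" if "x \<in> J" "y \<in> J" for x y
    using bch_eqm_add[OF J, of x y] that S subspace_carrier[OF S] ideal_right[OF I] subspace_add[OF S]
      eqm_mem[OF S] by blast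
  then show ?thesis
    by (intro G.subgroupI) (auto simp: rho_one rho_inv rho_mult subspace_zero[OF S] subspace_minus[OF S]
        intro!: exI[of _ "\<one>\<^bsub>G\<^esub>"])
qed

lemma rho_commutator:
  assumes "g \<in> carrier G" "h \<in> carrier G"
  shows "\<rho> (g \<otimes>\<^bsub>G\<^esub> h \<otimes>\<^bsub>G\<^esub> inv\<^bsub>G\<^esub> g \<otimes>\<^bsub>G\<^esub> inv\<^bsub>G\<^esub> h)
    = bch L F (bch L F (\<rho> g) (\<rho> h)) (bch L F (\<ominus> \<rho> g) (\<ominus> \<rho> h))"
proof -
  have "g \<otimes>\<^bsub>G\<^esub> h \<otimes>\<^bsub>G\<^esub> inv\<^bsub>G\<^esub> g \<otimes>\<^bsub>G\<^esub> inv\<^bsub>G\<^esub> h = (g \<otimes>\<^bsub>G\<^esub> h) \<otimes>\<^bsub>G\<^esub> (inv\<^bsub>G\<^esub> g \<otimes>\<^bsub>G\<^esub> inv\<^bsub>G\<^esub> h)"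
    using assms by (simp add: G.m_assoc)
  then show ?thesis using assms by (simp add: rho_mult rho_inv)
qed

text \<open>The common step for the lower central and the derived series: the preimage of a closed
  ideal is a subgroup, so a generated subgroup can be tested on its commutators.\<close>

lemma generate_commutators_vimage:
  assumes J: "closed_ideal J" and C: "A \<subseteq> carrier G" "B \<subseteq> carrier G"
    and AB: "\<And>g h. g \<in> A \<Longrightarrow> h \<in> B \<Longrightarrow> \<rho> g \<otimes> \<rho> h \<in> J"
  shows "\<rho> ` generate G (commutators G A B) \<subseteq> J"
proof -
  have "commutators G A B \<subseteq> {g\<in>carrier G. \<rho> g \<in> J}"
  proof (clarify, intro conjI)
    fix g h assume gh: "g \<in> A" "h \<in> B"
    then have c: "g \<in> carrier G" "h \<in> carrier G" using C by auto
    then show "g \<otimes>\<^bsub>G\<^esub> h \<otimes>\<^bsub>G\<^esub> inv\<^bsub>G\<^esub> g \<otimes>\<^bsub>G\<^esub> inv\<^bsub>G\<^esub> h \<in> carrier G" by simp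
    show "\<rho> (g \<otimes>\<^bsub>G\<^esub> h \<otimes>\<^bsub>G\<^esub> inv\<^bsub>G\<^esub> g \<otimes>\<^bsub>G\<^esub> inv\<^bsub>G\<^esub> h) \<in> J"
      unfolding rho_commutator[OF c] using AB[OF gh] c by (intro bch_commutator_mem[OF J]) auto
  qed
  then show ?thesis using G.generate_subgroup_incl[OF _ subgroup_vimage[OF J]] by blast
qed

lemma rho_lower_central: "r \<ge> 1 \<Longrightarrow> \<rho> ` lower_central G r \<subseteq> F r"
proof (induction r rule: dec_induct)
  case base
  have "\<rho> ` carrier G \<subseteq> carrier L" by (rule image_subsetI) (rule rho_closed)
  then show ?case by (simp only: F_1 One_nat_def lower_central.simps)
next
  case (step r)
  then obtain k where k: "r = Suc k" by (cases r) auto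
  have "\<rho> ` lower_central G (Suc (Suc k)) \<subseteq> F (Suc r)"
    unfolding lower_central.simps
  proof (rule generate_commutators_vimage)
    show "closed_ideal (F (Suc r))" by (rule closed_ideal_F) simp
    show "lower_central G (Suc k) \<subseteq> carrier G"
      using G.lower_central_normal[of "Suc k"] normal_imp_subgroup subgroup.subset by blast
    show "\<rho> g \<otimes> \<rho> h \<in> F (Suc r)" if "g \<in> lower_central G (Suc k)" "h \<in> carrier G" for g h
      using F_bracket[of r 1 "\<rho> g" "\<rho> h"] step that F_1 k by auto
  qed simp
  then show ?case by (simp add: k)
qed

text \<open>The closure is forced by the infinite series: its limit need not lie in the algebraic
  span of brackets.\<close>

lemma rho_derived_series: "\<rho> ` derived_series G i \<subseteq> closure_in (lie_derived L i)"
proof (induction i)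
  case 0
  then show ?case using closure_in_superset[of "carrier L"] by (auto simp: derived_series_def)
next
  case (Suc i)
  have "\<rho> ` derived G (derived_series G i) \<subseteq> closure_in (lie_derived L (Suc i))"
    unfolding derived_eq_generate_commutators
  proof (rule generate_commutators_vimage)
    show "derived_series G i \<subseteq> carrier G" "derived_series G i \<subseteq> carrier G"
      by (simp_all add: derived_series_def G.exp_of_derived_in_carrier)
    show "\<rho> g \<otimes> \<rho> h \<in> closure_in (lie_derived L (Suc i))"
      if "g \<in> derived_series G i" "h \<in> derived_series G i" for g h
      using that Suc by (intro closure_in_bracket[of _ "lie_derived L i" _ "lie_derived L i"])
        (auto intro: lie_product_memI)
  qed (intro closed_ideal_closure_in ideal_lie_derived)
  then show ?case by (simp add: derived_series_def)
qed

text \<open>For \<open>n\<close> in \<open>N\<close> the bracket of \<open>\<rho> n\<close> and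
  \<open>\<rho> g\<close> lies in the ideal, so \<open>\<rho> (n g)\<close> is congruent to
  \<open>\<rho> g\<close> and the union defining \<open>induced_map\<close> is a single
  coset.\<close>

lemma induced_map_hom:
  assumes N: "N \<lhd> G" and J: "closed_ideal J" and rho: "\<rho> ` N \<subseteq> J"
  shows induced_map_coset: "g \<in> carrier G \<Longrightarrow> induced_map L J \<rho> (N #>\<^bsub>G\<^esub> g) = J +> \<rho> g"
    and induced_map_in_hom:
      "induced_map L J \<rho> \<in> hom (G Mod N) (exp_group (lie_quotient L J) (quotient_filtration L J F))"
proof -
  interpret N: normal N G by (rule N)
  note I = closed_ideal_ideal[OF J]
  note S = ideal_subspace[OF I]
  interpret p: lie_algebra_hom L "lie_quotient L J" "\<lambda>x. J +> x" by (rule lie_algebra_hom_quotient[OF I])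
  have *: "induced_map L J \<rho> (N #>\<^bsub>G\<^esub> g) = J +> \<rho> g" if g: "g \<in> carrier G" for g
  proof -
    have "J +> \<rho> (n \<otimes>\<^bsub>G\<^esub> g) = J +> \<rho> g" if n: "n \<in> N" for n
    proof -
      have nJ: "\<rho> n \<in> J" "\<rho> n \<in> carrier L" "n \<in> carrier G" using n rho by auto
      then have "eqm J (\<rho> (n \<otimes>\<^bsub>G\<^esub> g)) (\<rho> n \<oplus> \<rho> g)"
        using g ideal_left[OF I] by (simp add: rho_mult bch_eqm_add[OF J])
      also have "eqm J (\<rho> n \<oplus> \<rho> g) (\<rho> g)"
        using nJ g by (simp add: a_comm[of "\<rho> n"] eqm_add_right[OF S])
      finally show ?thesis using S nJ g by (subst coset_eq_iff) auto
    qed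
    moreover have "\<one>\<^bsub>G\<^esub> \<otimes>\<^bsub>G\<^esub> g \<in> N #>\<^bsub>G\<^esub> g" using g N.one_closed by (auto simp: r_coset_def)
    ultimately show ?thesis unfolding induced_map_def r_coset_def by blast
  qed
  then show "g \<in> carrier G \<Longrightarrow> induced_map L J \<rho> (N #>\<^bsub>G\<^esub> g) = J +> \<rho> g" .
  show "induced_map L J \<rho> \<in> hom (G Mod N) (exp_group (lie_quotient L J) (quotient_filtration L J F))"
  proof (rule homI)
    fix X assume "X \<in> carrier (G Mod N)"
    then show "induced_map L J \<rho> X \<in> carrier (exp_group (lie_quotient L J) (quotient_filtration L J F))"
      using * by (auto simp: carrier_FactGroup exp_group_def coset_in_carrier_quotient)
  next
    fix X Y assume "X \<in> carrier (G Mod N)" "Y \<in> carrier (G Mod N)"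
    then obtain g h where gh: "g \<in> carrier G" "h \<in> carrier G" "X = N #>\<^bsub>G\<^esub> g" "Y = N #>\<^bsub>G\<^esub> h"
      by (auto simp: carrier_FactGroup)
    have "J +> bch L F (\<rho> g) (\<rho> h)
        = bch (lie_quotient L J) (quotient_filtration L J F) (J +> \<rho> g) (J +> \<rho> h)"
      using gh by (intro p.hom_bch[OF complete_lie_algebra_axioms complete_quotient[OF J]])
        (auto simp: quotient_filtration_def)
    then show "induced_map L J \<rho> (X \<otimes>\<^bsub>G Mod N\<^esub> Y) = induced_map L J \<rho> X
        \<otimes>\<^bsub>exp_group (lie_quotient L J) (quotient_filtration L J F)\<^esub> induced_map L J \<rho> Y"
      using gh * by (simp add: N.rcos_sum exp_group_def rho_mult)
  qed
qed

end

subsection \<open>The span of the image of a group\<close>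

text \<open>Vanishing of some filtration step is the form of nilpotency used for \<open>bch\<close>:
  it makes the product a finite sum.\<close>

locale nilpotent_exp_hom = exp_hom +
  fixes n
  assumes n_pos: "n \<ge> 1" and F_n: "F n = {\<zero>}"
begin

lemma monom_in_lie_poly: "x \<in> carrier L \<Longrightarrow> (\<lambda>a. of_nat a \<odot> x) \<in> lie_poly L 1"
  using lie_poly_single[of 1 1 x] by simp

text \<open>Half of \<open>[x, y]\<close> is the coefficient of \<open>a^2\<close> in the product of \<open>a x\<close> and \<open>a y\<close>.\<close>

lemma bracket_mem_span:
  assumes A: "subgroup A G" and st: "s \<in> A" "t \<in> A"
  shows "\<rho> s \<otimes> \<rho> t \<in> rat_span L (\<rho> ` A)"
proof -
  interpret A: subgroup A G by (rule A)
  let ?x = "\<rho> s" and ?y = "\<rho> t" and ?W = "rat_span L (\<rho> ` A)"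
  have xy: "?x \<in> carrier L" "?y \<in> carrier L" and stG: "s \<in> carrier G" "t \<in> carrier G" using st by auto
  have "\<rho> ` A \<subseteq> carrier L" by auto
  then have W: "rat_subspace ?W" by (rule rat_span_subspace)
  have mem: "\<rho> g \<in> ?W" if "g \<in> A" for g using that rat_span_superset[of "\<rho> ` A"] by auto
  obtain h where h: "h \<in> lie_poly L 3" "\<And>a. bch L F (of_nat a \<odot> ?x) (of_nat a \<odot> ?y) =
      (of_nat a \<odot> ?x \<oplus> of_nat a \<odot> ?y) \<oplus> ((1/2) \<odot> ((of_nat a \<odot> ?x) \<otimes> (of_nat a \<odot> ?y)) \<oplus> h a)"
    using bch_lie_poly[OF n_pos F_n monom_in_lie_poly monom_in_lie_poly, OF xy] by metis
  have "(1/2) \<odot> (?x \<otimes> ?y) \<in> ?W"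
  proof (rule lie_poly_leading_coeff_mem[OF W _ , where k = 2 and p = h])
    fix a :: nat
    have hc: "h a \<in> carrier L" using h(1) lie_poly_closed by blast
    let ?l = "of_nat a \<odot> ?x \<oplus> of_nat a \<odot> ?y" and ?q = "(of_nat a ^ 2) \<odot> ((1/2) \<odot> (?x \<otimes> ?y)) \<oplus> h a"
    have "s [^]\<^bsub>G\<^esub> a \<otimes>\<^bsub>G\<^esub> t [^]\<^bsub>G\<^esub> a \<in> A"
      using st G.nat_pow_mem_subgroup[OF A] by (intro A.m_closed)
    then have "bch L F (of_nat a \<odot> ?x) (of_nat a \<odot> ?y) \<in> ?W"
      using mem stG by (metis rho_mult rho_pow G.nat_pow_closed)
    moreover have "bch L F (of_nat a \<odot> ?x) (of_nat a \<odot> ?y) = ?q \<oplus> ?l"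
      unfolding h(2) using xy hc
      by (simp add: bracket_smult_left bracket_smult_right power2_eq_square a_comm mult.commute)
    ultimately have "?q \<oplus> ?l \<in> ?W" by simp
    \<comment> \<open>The linear part already lies in the span, so it can be subtracted, leaving a
      polynomial that starts in degree 2.\<close>
    moreover have "?l \<in> ?W" using W mem st by (intro subspace_add subspace_scale) auto
    ultimately have "?q \<oplus> ?l \<ominus> ?l \<in> ?W" using W subspace_diff by blast
    then show "?q \<in> ?W" using xy hc by simp
  qed (use xy h in auto)
  then have "2 \<odot> ((1/2) \<odot> (?x \<otimes> ?y)) \<in> ?W" using W subspace_scale by blast
  then show ?thesis using xy by simp
qed

text \<open>Likewise \<open>[x, y]\<close> is the leading coefficient of the group commutator of \<open>a x\<close> and \<open>a y\<close>.\<close>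

lemma bracket_mem_span_derived:
  assumes A: "subgroup A G" and st: "s \<in> A" "t \<in> A"
  shows "\<rho> s \<otimes> \<rho> t \<in> rat_span L (\<rho> ` derived G A)"
proof -
  interpret A: subgroup A G by (rule A)
  let ?x = "\<rho> s" and ?y = "\<rho> t" and ?W = "rat_span L (\<rho> ` derived G A)"
  have xy: "?x \<in> carrier L" "?y \<in> carrier L" "\<ominus> ?x \<in> carrier L" "\<ominus> ?y \<in> carrier L"
    and stG: "s \<in> carrier G" "t \<in> carrier G" using st by auto
  have "\<rho> ` derived G A \<subseteq> carrier L" using G.derived_in_carrier[of A] A.subset by auto
  then have W: "rat_subspace ?W" by (rule rat_span_subspace)
  let ?X = "\<lambda>a. of_nat a \<odot> ?x" and ?Y = "\<lambda>a. of_nat a \<odot> ?y"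
  let ?X' = "\<lambda>a. of_nat a \<odot> (\<ominus> ?x)" and ?Y' = "\<lambda>a. of_nat a \<odot> (\<ominus> ?y)"
  note X = monom_in_lie_poly[OF xy(1)] and Y = monom_in_lie_poly[OF xy(2)]
  note X' = monom_in_lie_poly[OF xy(3)] and Y' = monom_in_lie_poly[OF xy(4)]
  obtain h where h: "h \<in> lie_poly L 3"
    "\<And>a. bch L F (?X a) (?Y a) = (?X a \<oplus> ?Y a) \<oplus> ((1/2) \<odot> (?X a \<otimes> ?Y a) \<oplus> h a)"
    using bch_lie_poly[OF n_pos F_n X Y] by metis
  obtain h' where h': "h' \<in> lie_poly L 3"
    "\<And>a. bch L F (?X' a) (?Y' a) = (?X' a \<oplus> ?Y' a) \<oplus> ((1/2) \<odot> (?X' a \<otimes> ?Y' a) \<oplus> h' a)"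
    using bch_lie_poly[OF n_pos F_n X' Y'] by metis
  let ?w = "\<lambda>a. ?X a \<oplus> ?Y a"
  let ?p = "\<lambda>a. (1/2) \<odot> (?X a \<otimes> ?Y a) \<oplus> h a" and ?p' = "\<lambda>a. (1/2) \<odot> (?X' a \<otimes> ?Y' a) \<oplus> h' a"
  have w: "?w \<in> lie_poly L 1" by (rule lie_poly_add[OF X Y])
  \<comment> \<open>The linear parts of the two factors of the commutator are opposite, so their sum
    starts in degree 2.\<close>
  have w_neg: "?X' a \<oplus> ?Y' a = \<ominus> ?w a" for a
    using xy by (simp add: scale_minus_right minus_add)
  have p: "?p \<in> lie_poly L 2"
    using lie_poly_bracket[OF X Y] h(1)
    by (intro lie_poly_add lie_poly_scale) (auto intro: lie_poly_mono simp: numeral_2_eq_2)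
  have p': "?p' \<in> lie_poly L 2"
    using lie_poly_bracket[OF X' Y'] h'(1)
    by (intro lie_poly_add lie_poly_scale) (auto intro: lie_poly_mono simp: numeral_2_eq_2)
  let ?u = "\<lambda>a. bch L F (?X a) (?Y a)" and ?v = "\<lambda>a. bch L F (?X' a) (?Y' a)"
  have u_eq: "?u a = ?w a \<oplus> ?p a" and v_eq: "?v a = \<ominus> ?w a \<oplus> ?p' a" for a
    unfolding h(2) h'(2) w_neg by (rule refl)+
  have "(\<lambda>a. (?X a \<oplus> ?Y a) \<oplus> ?p a) \<in> lie_poly L 1"
    by (intro lie_poly_add[OF w] lie_poly_mono[OF p]) simp
  then have u: "?u \<in> lie_poly L 1" unfolding h(2) .
  have "(\<lambda>a. (?X' a \<oplus> ?Y' a) \<oplus> ?p' a) \<in> lie_poly L 1"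
    by (intro lie_poly_add[OF lie_poly_add[OF X' Y']] lie_poly_mono[OF p']) simp
  then have v: "?v \<in> lie_poly L 1" unfolding h'(2) .
  obtain k where k: "k \<in> lie_poly L 3"
    "\<And>a. bch L F (?u a) (?v a) = (?u a \<oplus> ?v a) \<oplus> ((1/2) \<odot> (?u a \<otimes> ?v a) \<oplus> k a)"
    using bch_lie_poly[OF n_pos F_n u v] by metis
  note cl = lie_poly_closed[OF w] lie_poly_closed[OF p] lie_poly_closed[OF p'] lie_poly_closed[OF k(1)]
    lie_poly_closed[OF h(1)] lie_poly_closed[OF h'(1)]
  \<comment> \<open>The bracket of \<open>w + p\<close> with \<open>-w + p'\<close>, expanded. The
    term of degree 2 would come from the bracket of \<open>w\<close> with itself, so what remains
    has order 3.\<close>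
  let ?b = "\<lambda>a. (?w a \<otimes> ?p' a \<oplus> (-1) \<odot> (?p a \<otimes> ?w a)) \<oplus> ?p a \<otimes> ?p' a"
  have uv: "?u a \<otimes> ?v a = ?b a" for a
  proof -
    obtain w p p' where eq: "w = ?w a" "p = ?p a" "p' = ?p' a" by simp
    have c: "w \<in> carrier L" "p \<in> carrier L" "p' \<in> carrier L" using cl[of a] eq by auto
    have "(w \<oplus> p) \<otimes> (\<ominus> w \<oplus> p') = (w \<otimes> p' \<oplus> (-1) \<odot> (p \<otimes> w)) \<oplus> p \<otimes> p'"
      using c bracket_self[OF c(1)]
      by (simp add: bracket_add_left bracket_add_right bracket_minus_right minus_conv_scale bracket_smult_right a_ac)
    then show ?thesis unfolding u_eq v_eq eq .
  qed
  have b: "?b \<in> lie_poly L 3"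
    using lie_poly_bracket[OF w p'] lie_poly_bracket[OF p w] lie_poly_bracket[OF p p']
    by (intro lie_poly_add lie_poly_scale) (auto intro: lie_poly_mono)
  \<comment> \<open>Everything of degree at least 3 in the commutator, gathered from all three
    applications of the series.\<close>
  let ?r = "\<lambda>a. (h a \<oplus> h' a) \<oplus> ((1/2) \<odot> ?b a \<oplus> k a)"
  have r: "?r \<in> lie_poly L 3"
    by (rule lie_poly_add[OF lie_poly_add[OF h(1) h'(1)] lie_poly_add[OF lie_poly_scale[OF b] k(1)]])
  show ?thesis
  proof (rule lie_poly_leading_coeff_mem[OF W, where k = 2 and p = ?r])
    fix a :: nat
    have "bch L F (?u a) (?v a) = \<rho> (s [^]\<^bsub>G\<^esub> a \<otimes>\<^bsub>G\<^esub> t [^]\<^bsub>G\<^esub> a \<otimes>\<^bsub>G\<^esub> inv\<^bsub>G\<^esub> (s [^]\<^bsub>G\<^esub> a) \<otimes>\<^bsub>G\<^esub> inv\<^bsub>G\<^esub> (t [^]\<^bsub>G\<^esub> a))"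
      using stG xy by (simp add: rho_commutator rho_pow scale_minus_right)
    moreover have "s [^]\<^bsub>G\<^esub> a \<otimes>\<^bsub>G\<^esub> t [^]\<^bsub>G\<^esub> a \<otimes>\<^bsub>G\<^esub> inv\<^bsub>G\<^esub> (s [^]\<^bsub>G\<^esub> a) \<otimes>\<^bsub>G\<^esub> inv\<^bsub>G\<^esub> (t [^]\<^bsub>G\<^esub> a) \<in> derived G A"
      unfolding derived_eq_generate_commutators using st G.nat_pow_mem_subgroup[OF A] by (intro generate.incl) blast
    ultimately have "bch L F (?u a) (?v a) \<in> ?W" using rat_span_superset by fastforce
    moreover have "bch L F (?u a) (?v a) = (of_nat a ^ 2) \<odot> (?x \<otimes> ?y) \<oplus> ?r a"
    proof -
      let ?z = "?x \<otimes> ?y"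
      \<comment> \<open>In the bracket of the negatives the signs cancel, so each factor contributes
        half of \<open>a^2 [x, y]\<close>; together they give the leading term with coefficient
        1.\<close>
      have p_eq: "?p a = (of_nat a ^ 2 / 2) \<odot> ?z \<oplus> h a" and p'_eq: "?p' a = (of_nat a ^ 2 / 2) \<odot> ?z \<oplus> h' a"
        using xy by (simp_all add: bracket_smult_left bracket_smult_right minus_conv_scale
            power2_eq_square mult.commute)
      have "?u a \<oplus> ?v a = ?p a \<oplus> ?p' a"
      proof -
        obtain w p p' where eq: "w = ?w a" "p = ?p a" "p' = ?p' a" by simp
        have c: "w \<in> carrier L" "p \<in> carrier L" "p' \<in> carrier L" using cl[of a] eq by auto
        have "(w \<oplus> p) \<oplus> (\<ominus> w \<oplus> p') = (w \<oplus> \<ominus> w) \<oplus> (p \<oplus> p')" using c by (simp only: a_ac a_closed a_inv_closed)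
        then have "(w \<oplus> p) \<oplus> (\<ominus> w \<oplus> p') = p \<oplus> p'" using c by (simp add: r_neg)
        then show ?thesis unfolding u_eq v_eq eq .
      qed
      also have "\<dots> = ((of_nat a ^ 2 / 2) \<odot> ?z \<oplus> (of_nat a ^ 2 / 2) \<odot> ?z) \<oplus> (h a \<oplus> h' a)"
        unfolding p_eq p'_eq using xy cl[of a] by (simp add: a_ac)
      also have "(of_nat a ^ 2 / 2) \<odot> ?z \<oplus> (of_nat a ^ 2 / 2) \<odot> ?z = (of_nat a ^ 2) \<odot> ?z"
        using xy by (simp flip: scale_add_left)
      finally have "?u a \<oplus> ?v a = (of_nat a ^ 2) \<odot> ?z \<oplus> (h a \<oplus> h' a)" .
      then show ?thesis unfolding k(2) uv using xy cl[of a] lie_poly_closed[OF b, of a]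
        by (simp add: a_assoc)
    qed
    ultimately show "(of_nat a ^ 2) \<odot> (?x \<otimes> ?y) \<oplus> ?r a \<in> ?W" by simp
  qed (use xy r in \<open>auto simp: numeral_3_eq_3\<close>)
qed

end

subsection \<open>Group homomorphisms between nilpotent exponential groups\<close>

text \<open>
  By descending induction on \<open>k\<close>, \<open>\<phi>\<close> is additive as soon as one summand lies in \<open>F k\<close>: the
  higher components of the product of \<open>t x\<close> and \<open>t y\<close> lie in \<open>F (k + 1)\<close>, so that both sides of
  \<open>\<phi> (t x \<cdot> t y) = \<phi> (t x) \<cdot> \<phi> (t y)\<close> are polynomials in \<open>t\<close>, whose coefficients are compared.
\<close>

lemma exp_group_hom_is_lie_hom:
  fixes A (structure)
  assumes A: "complete_lie_algebra A F" and B: "complete_lie_algebra B E"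
    and n: "n \<ge> 1" "F n = {\<zero>}" and m: "m \<ge> 1" "E m = {\<zero>\<^bsub>B\<^esub>}"
    and phi: "\<phi> \<in> hom (exp_group A F) (exp_group B E)"
  shows "lie_algebra_hom A B \<phi>"
proof -
  interpret A: complete_lie_algebra A F by (rule A)
  interpret B: complete_lie_algebra B E by (rule B)
  have closed [simp]: "\<phi> x \<in> carrier B" if "x \<in> carrier A" for x
    using phi that by (auto simp: hom_def exp_group_def)
  have mult: "\<phi> (bch A F x y) = bch B E (\<phi> x) (\<phi> y)" if "x \<in> carrier A" "y \<in> carrier A" for x y
    using phi that by (auto simp: hom_def exp_group_def)
  have zero: "\<phi> \<zero> = \<zero>\<^bsub>B\<^esub>"
  proof -
    have "\<phi> \<zero> = bch B E (\<phi> \<zero>) (\<phi> \<zero>)"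
      using mult[of "\<zero>" "\<zero>"] by (simp add: A.bch_commuting)
    also have "\<dots> = \<phi> \<zero> \<oplus>\<^bsub>B\<^esub> \<phi> \<zero>" by (rule B.bch_commuting) (auto intro: B.bracket_self)
    finally show ?thesis by (metis A.zero_closed B.add.r_cancel_one' closed)
  qed
  have nat_scale: "\<phi> (of_nat k \<odot> x) = of_nat k \<odot>\<^bsub>B\<^esub> \<phi> x" if x: "x \<in> carrier A" for k x
  proof (induction k)
    case (Suc k)
    have "of_nat (Suc k) \<odot> x = bch A F (of_nat k \<odot> x) x"
      using x A.scale_add_left[of x "of_nat k" 1] A.bracket_self[OF x]
      by (simp add: A.bch_commuting A.bracket_smult_left add.commute)
    then have "\<phi> (of_nat (Suc k) \<odot> x) = bch B E (of_nat k \<odot>\<^bsub>B\<^esub> \<phi> x) (\<phi> x)"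
      using x Suc by (simp add: mult)
    also have "\<dots> = of_nat (Suc k) \<odot>\<^bsub>B\<^esub> \<phi> x"
      using x B.scale_add_left[of "\<phi> x" "of_nat k" 1] B.bracket_self[of "\<phi> x"]
      by (simp add: B.bch_commuting B.bracket_smult_left add.commute)
    finally show ?case .
  qed (use x zero in simp)
  \<comment> \<open>One truncation degree for both algebras; the summand 2 ensures that the
    quadratic component, which yields the bracket, is included.\<close>
  define D where "D = n + m + 2"
  have FD: "F D = {\<zero>}"
    using A.F_antimono[of n D] n A.F_subspace[of D] A.subspace_zero[of "F D"] by (auto simp: D_def)
  have ED: "E D = {\<zero>\<^bsub>B\<^esub>}"
    using B.F_antimono[of m D] m B.F_subspace[of D] B.subspace_zero[of "E D"] by (auto simp: D_def)
  have bchA: "bch A F x y = A.bch_partial D x y" if "x \<in> carrier A" "y \<in> carrier A" for x y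
  proof -
    have "A.eqm (F D) (A.bch_partial D x y) (bch A F x y)"
      by (rule A.bch_partial_eqm_bch[OF that]) (simp add: D_def)
    then show ?thesis unfolding FD by (simp add: A.eqm_trivial_iff)
  qed
  have bchB: "bch B E x y = B.bch_partial D x y" if "x \<in> carrier B" "y \<in> carrier B" for x y
  proof -
    have "B.eqm (E D) (B.bch_partial D x y) (bch B E x y)"
      by (rule B.bch_partial_eqm_bch[OF that]) (simp add: D_def)
    then show ?thesis unfolding ED by (simp add: B.eqm_trivial_iff)
  qed

  \<comment> \<open>The engine of the induction: additivity on \<open>F (k + 1)\<close> forces
    \<open>\<phi>\<close> to respect every component when \<open>x\<close> lies in
    \<open>F k\<close>. Degree 1 then gives additivity on \<open>F k\<close>, and degree 2 will give
    the bracket.\<close>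
  have components: "\<phi> (bch_component A N x y) = bch_component B N (\<phi> x) (\<phi> y)"
    if k: "k \<ge> 1" and add: "\<And>u v. u \<in> F (Suc k) \<Longrightarrow> v \<in> carrier A \<Longrightarrow> \<phi> (u \<oplus> v) = \<phi> u \<oplus>\<^bsub>B\<^esub> \<phi> v"
      and x: "x \<in> F k" and y: "y \<in> carrier A" and N: "1 \<le> N" "N \<le> D" for k x y N
  proof -
    have xA: "x \<in> carrier A" using x k A.F_subspace A.subspace_carrier by blast
    have FS: "A.rat_subspace (F (Suc k))" by (rule A.F_subspace) simp
    have high: "bch_component A N x y \<in> F (Suc k)" if "N \<ge> 2" for N
      using A.bch_component_mem_ideal[OF A.F_ideal xA y _ that] A.F_bracket[of k 1 x y] k x y A.F_1
      by simp
    have sum: "\<phi> (\<Oplus>i\<in>I. f i) = (\<Oplus>\<^bsub>B\<^esub>i\<in>I. \<phi> (f i))"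
      if "finite I" "\<And>i. i \<in> I \<Longrightarrow> f i \<in> F (Suc k)" for I :: "nat set" and f
      using that
    proof (induction I)
      case (insert i I)
      have c: "f j \<in> carrier A" if "j \<in> insert i I" for j
        using insert.prems[OF that] A.subspace_carrier[OF FS] by blast
      then have "f \<in> I \<rightarrow> carrier A" "(\<lambda>j. \<phi> (f j)) \<in> I \<rightarrow> carrier B" by auto
      then show ?case using insert c add[of "f i" "\<Oplus>i\<in>I. f i"] by simp
    qed (simp add: zero)
    let ?a = "\<lambda>N. bch_component A N x y" and ?b = "\<lambda>N. bch_component B N (\<phi> x) (\<phi> y)"
    have ab: "?a N \<in> carrier A" "?b N \<in> carrier B" for N using xA y by auto
    \<comment> \<open>Coefficients of the difference of the two sides; as a polynomial in
      \<open>t\<close> it vanishes at all positive integers. Degree 0 is padded with zero.\<close>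
    let ?d = "\<lambda>N. if N = 0 then \<zero>\<^bsub>B\<^esub> else \<phi> (?a N) \<ominus>\<^bsub>B\<^esub> ?b N"
    have "?d N \<in> {\<zero>\<^bsub>B\<^esub>}"
    proof (rule B.polynomial_coeff_mem[OF B.subspace_trivial _ _ N(2)])
      fix t :: nat
      let ?t = "of_nat t :: rat"
      \<comment> \<open>Powers of \<open>t\<close> are natural numbers, so they can be moved through
        \<open>\<phi>\<close> before rational linearity is known.\<close>
      have tN: "?t ^ N = of_nat (t ^ N)" for N by simp
      have split: "{1..D} = insert 1 {2..D}" by (auto simp: D_def)
      have "\<phi> (bch A F (?t \<odot> x) (?t \<odot> y)) = \<phi> (\<Oplus>N\<in>{1..D}. (?t ^ N) \<odot> ?a N)"
        using xA y by (simp add: bchA A.bch_partial_def A.bch_component_scale)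
      also have "(\<Oplus>N\<in>{1..D}. (?t ^ N) \<odot> ?a N) =
          (\<Oplus>N\<in>{2..D}. (?t ^ N) \<odot> ?a N) \<oplus> ?t \<odot> ?a 1"
        unfolding split using ab by (simp add: Pi_def A.a_comm)
      also have "\<phi> \<dots> = \<phi> (\<Oplus>N\<in>{2..D}. (?t ^ N) \<odot> ?a N) \<oplus>\<^bsub>B\<^esub> \<phi> (?t \<odot> ?a 1)"
        using ab high FS
        by (intro add A.subspace_finsum[OF FS] A.subspace_scale[OF FS]) auto
      also have "\<phi> (\<Oplus>N\<in>{2..D}. (?t ^ N) \<odot> ?a N) = (\<Oplus>\<^bsub>B\<^esub>N\<in>{2..D}. \<phi> ((?t ^ N) \<odot> ?a N))"
        using high FS by (intro sum A.subspace_scale) auto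
      also have "\<dots> = (\<Oplus>\<^bsub>B\<^esub>N\<in>{2..D}. (?t ^ N) \<odot>\<^bsub>B\<^esub> \<phi> (?a N))"
        unfolding tN using ab by (simp only: nat_scale)
      also have "\<dots> \<oplus>\<^bsub>B\<^esub> \<phi> (?t \<odot> ?a 1) = (\<Oplus>\<^bsub>B\<^esub>N\<in>{1..D}. (?t ^ N) \<odot>\<^bsub>B\<^esub> \<phi> (?a N))"
        unfolding split using ab by (simp add: Pi_def nat_scale B.a_comm)
      finally have l: "\<phi> (bch A F (?t \<odot> x) (?t \<odot> y)) = (\<Oplus>\<^bsub>B\<^esub>N\<in>{1..D}. (?t ^ N) \<odot>\<^bsub>B\<^esub> \<phi> (?a N))" .
      have r: "\<phi> (bch A F (?t \<odot> x) (?t \<odot> y)) = (\<Oplus>\<^bsub>B\<^esub>N\<in>{1..D}. (?t ^ N) \<odot>\<^bsub>B\<^esub> ?b N)"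
        using xA y by (simp add: mult nat_scale bchB B.bch_partial_def B.bch_component_scale)
      have "{..D} = insert 0 {1..D}" by auto
      then have "(\<Oplus>\<^bsub>B\<^esub>N\<in>{..D}. (?t ^ N) \<odot>\<^bsub>B\<^esub> ?d N) = (\<Oplus>\<^bsub>B\<^esub>N\<in>{1..D}. (?t ^ N) \<odot>\<^bsub>B\<^esub> ?d N)"
        using ab by (simp add: Pi_def)
      also have "\<dots> = (\<Oplus>\<^bsub>B\<^esub>N\<in>{1..D}. (?t ^ N) \<odot>\<^bsub>B\<^esub> \<phi> (?a N) \<oplus>\<^bsub>B\<^esub> (-1) \<odot>\<^bsub>B\<^esub> ((?t ^ N) \<odot>\<^bsub>B\<^esub> ?b N))"
        using ab by (intro B.finsum_cong')
          (auto simp: a_minus_def B.minus_conv_scale B.scale_add_right)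
      also have "\<dots> = (\<Oplus>\<^bsub>B\<^esub>N\<in>{1..D}. (?t ^ N) \<odot>\<^bsub>B\<^esub> \<phi> (?a N)) \<oplus>\<^bsub>B\<^esub>
          (-1) \<odot>\<^bsub>B\<^esub> (\<Oplus>\<^bsub>B\<^esub>N\<in>{1..D}. (?t ^ N) \<odot>\<^bsub>B\<^esub> ?b N)"
        using ab by (subst B.finsum_addf, simp, simp, subst B.finsum_smult_ldistr) auto
      also have "\<dots> = \<zero>\<^bsub>B\<^esub>"
        unfolding l[symmetric] r[symmetric] using xA y
        by (subst B.minus_conv_scale[symmetric]) (simp_all add: B.r_neg)
      finally show "(\<Oplus>\<^bsub>B\<^esub>N\<in>{..D}. (?t ^ N) \<odot>\<^bsub>B\<^esub> ?d N) \<in> {\<zero>\<^bsub>B\<^esub>}" by simp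
    qed (use ab in auto)
    then show ?thesis using N ab by (simp add: B.diff_eq_zero_iff split: if_splits)
  qed

  have add_step: "\<phi> (x \<oplus> y) = \<phi> x \<oplus>\<^bsub>B\<^esub> \<phi> y"
    if k: "k \<le> D" "k \<ge> 1" and x: "x \<in> F k" and y: "y \<in> carrier A" for k x y
    using that
  proof (induction k arbitrary: x y rule: inc_induct)
    case base
    then show ?case using FD zero by simp
  next
    case (step k)
    have xA: "x \<in> carrier A" using step A.F_subspace A.subspace_carrier by blast
    have "\<phi> (bch_component A 1 x y) = bch_component B 1 (\<phi> x) (\<phi> y)"
      using step by (intro components[of k]) (auto simp: D_def)
    then show ?case using xA step.prems by (simp add: A.bch_component_1 B.bch_component_1)
  qed
  have add: "\<phi> (x \<oplus> y) = \<phi> x \<oplus>\<^bsub>B\<^esub> \<phi> y" if "x \<in> carrier A" "y \<in> carrier A" for x y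
    using add_step[of 1 x y] that A.F_1 by (simp add: D_def)
  have bracket: "\<phi> (x \<otimes> y) = \<phi> x \<otimes>\<^bsub>B\<^esub> \<phi> y" if xy: "x \<in> carrier A" "y \<in> carrier A" for x y
  proof -
    \<comment> \<open>Additivity is now known everywhere, so the comparison applies with
      \<open>k = 1\<close> to all pairs.\<close>
    have "\<phi> (bch_component A 2 x y) = bch_component B 2 (\<phi> x) (\<phi> y)"
      using xy A.F_1 A.F_subspace[of "Suc (Suc 0)"] A.subspace_carrier[of "F (Suc (Suc 0))"]
      by (intro components[of 1] add) (auto simp: D_def)
    then have "\<phi> ((1/2) \<odot> (x \<otimes> y)) = (1/2) \<odot>\<^bsub>B\<^esub> (\<phi> x \<otimes>\<^bsub>B\<^esub> \<phi> y)"
      using xy A.bch_component_2 B.bch_component_2 by (simp add: numeral_2_eq_2)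
    then have "of_nat 2 \<odot>\<^bsub>B\<^esub> \<phi> ((1/2) \<odot> (x \<otimes> y)) = \<phi> x \<otimes>\<^bsub>B\<^esub> \<phi> y"
      using xy by simp
    then show ?thesis using xy nat_scale[of "(1/2) \<odot> (x \<otimes> y)" 2] by simp
  qed
  have neg: "\<phi> (\<ominus> x) = \<ominus>\<^bsub>B\<^esub> \<phi> x" if "x \<in> carrier A" for x
    using add[of "\<ominus> x" x] that zero by (simp add: A.l_neg B.minus_equality)
  have int_scale: "\<phi> (of_int k \<odot> x) = of_int k \<odot>\<^bsub>B\<^esub> \<phi> x" if x: "x \<in> carrier A" for k x
  proof (cases "k \<ge> 0")
    case True
    then show ?thesis using nat_scale[OF x, of "nat k"] by simp
  next
    case False
    then have "of_int k = - (of_nat (nat (- k)) :: rat)" by simp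
    then show ?thesis using nat_scale[OF x, of "nat (- k)"] x
      by (simp only: A.scale_minus_left B.scale_minus_left neg A.scale_closed closed)
  qed
  \<comment> \<open>Clearing the denominator reduces rational multiples to integral ones.\<close>
  have scale: "\<phi> (q \<odot> x) = q \<odot>\<^bsub>B\<^esub> \<phi> x" if x: "x \<in> carrier A" for q x
  proof -
    obtain a b :: int where ab: "quotient_of q = (a, b)" by (cases "quotient_of q")
    then have b: "b > 0" and q: "q = of_int a / of_int b"
      using quotient_of_denom_pos quotient_of_div by auto
    have "of_int b \<odot>\<^bsub>B\<^esub> \<phi> (q \<odot> x) = \<phi> ((of_int b * q) \<odot> x)"
      using x int_scale[of "q \<odot> x" b] by simp
    also have "of_int b * q = of_int a" using b q by simp
    also have "\<phi> (of_int a \<odot> x) = of_int a \<odot>\<^bsub>B\<^esub> \<phi> x" using x int_scale by simp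
    finally have "inverse (of_int b) \<odot>\<^bsub>B\<^esub> (of_int b \<odot>\<^bsub>B\<^esub> \<phi> (q \<odot> x))
        = inverse (of_int b) \<odot>\<^bsub>B\<^esub> (of_int a \<odot>\<^bsub>B\<^esub> \<phi> x)" by simp
    then show ?thesis using x b by (simp add: q field_simps)
  qed
  show ?thesis
    by (intro lie_algebra_hom.intro lie_algebra_hom_axioms.intro A.rat_lie_algebra_axioms
        B.rat_lie_algebra_axioms closed add scale bracket)
qed

subsection \<open>The lower central series and subalgebras\<close>

context rat_lie_algebra
begin

lemma ideal_lie_lcs: "lie_ideal L (lie_lcs L n)"
  by (induction n) (simp_all add: ideal_carrier ideal_lie_product)

lemma subspace_lie_lcs: "rat_subspace (lie_lcs L n)"
  by (rule ideal_subspace[OF ideal_lie_lcs])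

lemma lie_lcs_Suc_subset: "lie_lcs L (Suc n) \<subseteq> lie_lcs L n"
  unfolding lie_lcs.simps(2) using ideal_left[OF ideal_lie_lcs]
  by (intro lie_product_least subspace_lie_lcs)

lemma lie_lcs_antimono: "m \<le> n \<Longrightarrow> lie_lcs L n \<subseteq> lie_lcs L m"
  using lie_lcs_Suc_subset by (rule lift_Suc_antimono_le)

text \<open>By Jacobi, \<open>[x, [u, v]] = [[x, u], v] - [[x, v], u]\<close>; the second term
  applies the induction hypothesis with \<open>a + 1\<close>, so \<open>a\<close> must vary. The
  extra \<open>Suc\<close> reflects the index shift of \<open>lie_lcs\<close>.\<close>

lemma bracket_mem_lie_lcs:
  "x \<in> lie_lcs L a \<Longrightarrow> y \<in> lie_lcs L b \<Longrightarrow> x \<otimes> y \<in> lie_lcs L (Suc (a + b))"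
proof (induction b arbitrary: a x y)
  case 0
  then show ?case by (auto intro: lie_product_memI)
next
  case (Suc b)
  let ?T = "lie_lcs L (Suc (a + Suc b))"
  have x: "x \<in> carrier L" using Suc.prems subspace_lie_lcs subspace_carrier by blast
  note T = subspace_lie_lcs[of "Suc (a + Suc b)"]
  have "rat_subspace {y\<in>carrier L. x \<otimes> y \<in> ?T}"
    using x T by (intro subspaceI)
      (auto simp: subspace_zero bracket_add_right subspace_add bracket_smult_right subspace_scale simp del: lie_lcs.simps)
  moreover have "x \<otimes> (u \<otimes> v) \<in> ?T" if uv: "u \<in> lie_lcs L b" "v \<in> carrier L" for u v
  proof -
    have u: "u \<in> carrier L" using uv subspace_lie_lcs subspace_carrier by blast
    have xv: "x \<otimes> v \<in> lie_lcs L (Suc a)" using Suc.prems uv by (auto intro: lie_product_memI)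
    have 1: "(x \<otimes> v) \<otimes> u \<in> ?T" using Suc.IH[OF xv uv(1)] by simp
    have "x \<otimes> u \<in> lie_lcs L (Suc (a + b))" using Suc uv by blast
    then have 2: "(x \<otimes> u) \<otimes> v \<in> ?T" using uv by (auto intro: lie_product_memI)
    have "x \<otimes> (u \<otimes> v) \<oplus> (u \<otimes> (v \<otimes> x) \<oplus> v \<otimes> (x \<otimes> u)) = \<zero>"
      using jacobi[OF x u uv(2)] x u uv by (simp add: a_assoc)
    then have "x \<otimes> (u \<otimes> v) = \<ominus> (u \<otimes> (v \<otimes> x) \<oplus> v \<otimes> (x \<otimes> u))"
      using x u uv by (simp add: minus_equality)
    moreover have "u \<otimes> (v \<otimes> x) = (x \<otimes> v) \<otimes> u"
      using x u uv by (metis bracket_antisym bracket_closed bracket_minus_right)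
    moreover have "v \<otimes> (x \<otimes> u) = \<ominus> ((x \<otimes> u) \<otimes> v)" using x u uv by (metis bracket_antisym bracket_closed)
    ultimately show ?thesis using 1 2 T by (simp add: subspace_add subspace_minus del: lie_lcs.simps)
  qed
  ultimately have "lie_lcs L (Suc b) \<subseteq> {y\<in>carrier L. x \<otimes> y \<in> ?T}"
    unfolding lie_lcs.simps(2)[of L b] using subspace_lie_lcs[of b, THEN subspace_carrier]
    by (intro lie_product_least) (auto intro!: bracket_closed)
  then show ?case using Suc.prems by blast
qed

text \<open>A subalgebra becomes a Lie algebra by changing the carrier alone. The type stays the
  same, which is what allows it to be a test object in the universal property.\<close>

lemma lie_subalgebra_hom:
  assumes H: "rat_subspace H" and b: "\<And>x y. x \<in> H \<Longrightarrow> y \<in> H \<Longrightarrow> x \<otimes> y \<in> H"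
  shows "lie_algebra_hom (L\<lparr>carrier := H\<rparr>) L (\<lambda>x. x)"
proof -
  interpret H: submodule H rat_ring L by (rule H)
  note c = subspace_carrier[OF H]
  have "Module.module rat_ring (L\<lparr>carrier := H\<rparr>)" by (rule H.submodule_is_module) (rule module_axioms)
  then have "rat_lie_algebra (L\<lparr>carrier := H\<rparr>)"
    using b c by (intro rat_lie_algebra.intro rat_lie_algebra_axioms.intro)
      (auto simp: bracket_add_left bracket_add_right bracket_smult_left bracket_smult_right
        bracket_self jacobi)
  then show ?thesis using c
    by (intro lie_algebra_hom.intro lie_algebra_hom_axioms.intro rat_lie_algebra_axioms) auto
qed

end

lemma (in lie_algebra_hom) lie_lcs_image: "\<phi> ` lie_lcs A n \<subseteq> lie_lcs B n"
proof (induction n)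
  case (Suc n)
  have "lie_lcs A (Suc n) \<subseteq> {x\<in>carrier A. \<phi> x \<in> lie_lcs B (Suc n)}"
    unfolding lie_lcs.simps(2)[of A]
    using Suc A.subspace_lie_lcs[of n, THEN A.subspace_carrier]
    by (intro A.lie_product_least subspace_vimage B.subspace_lie_lcs)
      (auto simp: hom_bracket intro!: A.bracket_closed B.lie_product_memI)
  then show ?case by blast
qed auto

subsection \<open>Generation of the associated graded Lie algebra\<close>

lemma a_r_coset_carrier_update [simp]: "H +>\<^bsub>L\<lparr>carrier := K\<rparr>\<^esub> x = H +>\<^bsub>L\<^esub> x"
  by (simp add: a_r_coset_def')

context complete_lie_algebra
begin

lemma F_carrier: "x \<in> F r \<Longrightarrow> r \<ge> 1 \<Longrightarrow> x \<in> carrier L"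
  using F_subspace subspace_carrier by blast

lemma F_subalgebra_hom: "r \<ge> 1 \<Longrightarrow> lie_algebra_hom (L\<lparr>carrier := F r\<rparr>) L (\<lambda>x. x)"
  using F_subspace F_carrier ideal_right[OF F_ideal] by (intro lie_subalgebra_hom) auto

lemma gr_piece_hom:
  assumes r: "r \<ge> 1"
  shows "lie_algebra_hom (L\<lparr>carrier := F r\<rparr>) (gr_piece L F r) (\<lambda>x. F (Suc r) +> x)"
proof -
  interpret i: lie_algebra_hom "L\<lparr>carrier := F r\<rparr>" L "\<lambda>x. x" by (rule F_subalgebra_hom[OF r])
  have S: "rat_subspace (F (Suc r))" using F_subspace by simp
  have "submodule (F (Suc r)) rat_ring (L\<lparr>carrier := F r\<rparr>)"
    using F_Suc[OF r] subspace_zero[OF S] subspace_add[OF S] subspace_scale[OF S]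
    by (intro i.A.subspaceI) auto
  moreover have "x \<otimes> y \<in> F (Suc r)" if "x \<in> F r" "y \<in> F (Suc r)" for x y
    using that F_carrier r ideal_right[OF F_ideal] by auto
  ultimately have "lie_ideal (L\<lparr>carrier := F r\<rparr>) (F (Suc r))" by (auto simp: lie_ideal_def)
  from i.A.lie_algebra_hom_quotient[OF this] show ?thesis by (simp add: gr_piece_def)
qed

lemma carrier_gr_piece: "carrier (gr_piece L F r) = (\<lambda>x. F (Suc r) +> x) ` F r"
  by (auto simp: gr_piece_def lie_quotient_def A_RCOSETS_def')

lemma zero_gr_piece: "\<zero>\<^bsub>gr_piece L F r\<^esub> = F (Suc r)"
  by (simp add: gr_piece_def lie_quotient_def)

section \<open>Representatives for the associated graded algebra\<close>

definition gr_class :: "(nat \<Rightarrow> 'a) \<Rightarrow> nat \<Rightarrow> 'a set" where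
  "gr_class x = (\<lambda>r\<in>{1..}. F (Suc r) +> x r)"

text \<open>Finite support is demanded of the representatives, not only of their classes, so that
  sums over degrees can be handled in \<open>L\<close>.\<close>

definition gr_rep :: "(nat \<Rightarrow> 'a) \<Rightarrow> bool" where
  "gr_rep x \<longleftrightarrow> (\<forall>r\<ge>1. x r \<in> F r) \<and> finite {r. r \<ge> 1 \<and> x r \<noteq> \<zero>}"

text \<open>The graded bracket lifted to representatives. Degrees start at 1, so both factors of
  each summand have positive degree.\<close>

definition convolution :: "(nat \<Rightarrow> 'a) \<Rightarrow> (nat \<Rightarrow> 'a) \<Rightarrow> nat \<Rightarrow> 'a" where
  "convolution x y n = (\<Oplus>r\<in>{1..<n}. x r \<otimes> y (n - r))"

lemma gr_rep_mem: "gr_rep x \<Longrightarrow> r \<ge> 1 \<Longrightarrow> x r \<in> F r"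
  by (simp add: gr_rep_def)

lemma gr_rep_carrier: "gr_rep x \<Longrightarrow> r \<ge> 1 \<Longrightarrow> x r \<in> carrier L"
  using gr_rep_mem F_carrier by blast

lemma gr_class_eq_iff:
  assumes "gr_rep x" "gr_rep y"
  shows "gr_class x = gr_class y \<longleftrightarrow> (\<forall>r\<ge>1. eqm (F (Suc r)) (x r) (y r))"
proof -
  have "F (Suc r) +> x r = F (Suc r) +> y r \<longleftrightarrow> eqm (F (Suc r)) (x r) (y r)" if "r \<ge> 1" for r
    using that assms gr_rep_carrier F_subspace by (intro coset_eq_iff) auto
  then show ?thesis by (auto simp: gr_class_def fun_eq_iff restrict_def)
qed

text \<open>Choosing zero in every degree where the class vanishes makes the representative finitely
  supported; the last property records that choice.\<close>

lemma carrier_grE: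
  assumes "c \<in> carrier (gr L F)"
  obtains x where "gr_rep x" "c = gr_class x" "\<And>r. r \<ge> 1 \<Longrightarrow> c r = \<zero>\<^bsub>gr_piece L F r\<^esub> \<Longrightarrow> x r = \<zero>"
proof -
  have c: "c \<in> (\<Pi>\<^sub>E r\<in>{1..}. carrier (gr_piece L F r))"
    "finite {r. r \<ge> 1 \<and> c r \<noteq> \<zero>\<^bsub>gr_piece L F r\<^esub>}"
    using assms by (auto simp: gr_def)
  have "\<exists>v. v \<in> F r \<and> c r = F (Suc r) +> v \<and> (c r = F (Suc r) \<longrightarrow> v = \<zero>)" if r: "r \<ge> 1" for r
  proof (cases "c r = F (Suc r)")
    case True
    have "F (Suc r) +> \<zero> = F (Suc r)"
      using F_subspace[of "Suc r"] subspace_subset a_coset_add_zero by simp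
    then show ?thesis using True subspace_zero[OF F_subspace[OF r]] by auto
  next
    case False
    have "c r \<in> carrier (gr_piece L F r)" using c(1) r by auto
    then show ?thesis using False by (auto simp: carrier_gr_piece)
  qed
  then obtain x where x: "\<And>r. r \<ge> 1 \<Longrightarrow> x r \<in> F r" "\<And>r. r \<ge> 1 \<Longrightarrow> c r = F (Suc r) +> x r"
    "\<And>r. r \<ge> 1 \<Longrightarrow> c r = F (Suc r) \<Longrightarrow> x r = \<zero>" by metis
  have "finite {r. r \<ge> 1 \<and> x r \<noteq> \<zero>}"
    by (rule finite_subset[OF _ c(2)]) (use x(3) in \<open>auto simp: zero_gr_piece\<close>)
  then have "gr_rep x" using x(1) by (simp add: gr_rep_def)
  moreover have "c = gr_class x"
    using x(2) c(1) by (auto simp: gr_class_def PiE_def extensional_def fun_eq_iff restrict_def)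
  ultimately show ?thesis using that x(3) by (simp add: zero_gr_piece)
qed

lemma gr_class_zero_iff:
  assumes "gr_rep x" "r \<ge> 1" shows "gr_class x r = \<zero>\<^bsub>gr_piece L F r\<^esub> \<longleftrightarrow> x r \<in> F (Suc r)"
  using assms gr_rep_carrier F_subspace by (simp add: gr_class_def zero_gr_piece coset_eq_self_iff)

lemma gr_class_in_carrier: assumes x: "gr_rep x" shows "gr_class x \<in> carrier (gr L F)"
proof -
  have "finite {r. r \<ge> 1 \<and> gr_class x r \<noteq> \<zero>\<^bsub>gr_piece L F r\<^esub>}"
  proof (rule finite_subset)
    have "gr_class x r = \<zero>\<^bsub>gr_piece L F r\<^esub>" if "r \<ge> 1" "x r = \<zero>" for r
      using that gr_class_zero_iff[OF x] subspace_zero[OF F_subspace[of "Suc r"]] by simp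
    then show "{r. r \<ge> 1 \<and> gr_class x r \<noteq> \<zero>\<^bsub>gr_piece L F r\<^esub>} \<subseteq> {r. r \<ge> 1 \<and> x r \<noteq> \<zero>}"
      by blast
    show "finite {r. r \<ge> 1 \<and> x r \<noteq> \<zero>}" using x by (simp add: gr_rep_def)
  qed
  moreover have "gr_class x \<in> (\<Pi>\<^sub>E r\<in>{1..}. carrier (gr_piece L F r))"
    using gr_rep_mem[OF x] by (auto simp: gr_class_def carrier_gr_piece)
  ultimately show ?thesis by (simp add: gr_def)
qed

lemma gr_add:
  assumes "gr_rep x" "gr_rep y"
  shows "gr_class x \<oplus>\<^bsub>gr L F\<^esub> gr_class y = gr_class (\<lambda>r. x r \<oplus> y r)"
proof -
  have "(F (Suc r) +> x r) \<oplus>\<^bsub>gr_piece L F r\<^esub> (F (Suc r) +> y r) = F (Suc r) +> (x r \<oplus> y r)"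
    if r: "r \<ge> 1" for r
    using lie_algebra_hom.hom_add[OF gr_piece_hom[OF r], of "x r" "y r"] gr_rep_mem[OF _ r] assms by simp
  then show ?thesis by (auto simp: gr_def gr_class_def fun_eq_iff)
qed

lemma gr_scale:
  assumes "gr_rep x"
  shows "q \<odot>\<^bsub>gr L F\<^esub> gr_class x = gr_class (\<lambda>r. q \<odot> x r)"
proof -
  have "q \<odot>\<^bsub>gr_piece L F r\<^esub> (F (Suc r) +> x r) = F (Suc r) +> (q \<odot> x r)" if r: "r \<ge> 1" for r
    using lie_algebra_hom.hom_scale[OF gr_piece_hom[OF r], of "x r" q] gr_rep_mem[OF _ r] assms by simp
  then show ?thesis by (auto simp: gr_def gr_class_def fun_eq_iff)
qed

lemma gr_zero: "\<zero>\<^bsub>gr L F\<^esub> = gr_class (\<lambda>r. \<zero>)"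
proof -
  have "F (Suc r) +> \<zero> = F (Suc r)" for r
    using F_subspace[of "Suc r"] subspace_subset a_coset_add_zero by simp
  then show ?thesis by (auto simp: gr_def gr_class_def zero_gr_piece)
qed

text \<open>The factors live in different quotients. Changing \<open>x\<close> by
  \<open>F (Suc r)\<close> or \<open>y\<close> by \<open>F (Suc s)\<close> alters the bracket by an
  element of \<open>F (Suc (r + s))\<close>.\<close>

lemma rcoset_mult_gr:
  assumes r: "r \<ge> 1" and s: "s \<ge> 1" and x: "x \<in> F r" and y: "y \<in> F s"
  shows "rcoset_mult L (F (Suc (r + s))) (F (Suc r) +> x) (F (Suc s) +> y) = F (Suc (r + s)) +> (x \<otimes> y)"
proof -
  have c: "x \<in> carrier L" "y \<in> carrier L" using assms F_carrier by auto
  have S: "rat_subspace (F (Suc k))" for k using F_subspace by simp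
  have "F (Suc (r + s)) +> (a \<otimes> b) = F (Suc (r + s)) +> (x \<otimes> y)"
    if a: "a \<in> F (Suc r) +> x" and b: "b \<in> F (Suc s) +> y" for a b
  proof -
    obtain u where u: "u \<in> F (Suc r)" "a = u \<oplus> x" using a by (auto simp: a_r_coset_def')
    obtain v where v: "v \<in> F (Suc s)" "b = v \<oplus> y" using b by (auto simp: a_r_coset_def')
    have uv: "u \<in> carrier L" "v \<in> carrier L" using u v F_carrier by auto
    have bF: "b \<in> F s" using v y F_Suc[OF s] subspace_add[OF F_subspace[OF s]] by auto
    have "a \<otimes> b = x \<otimes> y \<oplus> (x \<otimes> v \<oplus> u \<otimes> b)"
      unfolding u(2) v(2) using c uv by (simp add: bracket_add_left bracket_add_right a_ac)
    moreover have "x \<otimes> v \<in> F (Suc (r + s))" using F_bracket[OF r _ x v(1)] by simp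
    moreover have "u \<otimes> b \<in> F (Suc (r + s))" using F_bracket[OF _ s u(1) bF] by simp
    ultimately have "eqm (F (Suc (r + s))) (a \<otimes> b) (x \<otimes> y)"
      using c S by (simp add: eqm_add_right subspace_add)
    then show ?thesis using S eqm_carrier by (subst coset_eq_iff) auto
  qed
  moreover have "x \<in> F (Suc r) +> x" "y \<in> F (Suc s) +> y"
    using c S eqm_refl by (simp_all add: coset_mem_iff)
  ultimately show ?thesis unfolding rcoset_mult_def by blast
qed

lemma convolution_mem:
  assumes W: "rat_subspace W"
    and "\<And>r. 1 \<le> r \<Longrightarrow> r < n \<Longrightarrow> x r \<otimes> y (n - r) \<in> W"
  shows "convolution x y n \<in> W"
  unfolding convolution_def using assms by (intro subspace_finsum) auto

text \<open>The sum over degrees is formed in a quotient of \<open>F n\<close>; it is pulled back to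
  \<open>F n\<close> along the projection and then compared with the sum in \<open>L\<close> along
  the inclusion.\<close>

lemma gr_mult:
  assumes x: "gr_rep x" and y: "gr_rep y"
  shows "gr_class x \<otimes>\<^bsub>gr L F\<^esub> gr_class y = gr_class (convolution x y)"
proof -
  have "(\<Oplus>\<^bsub>gr_piece L F n\<^esub>r\<in>{1..<n}. rcoset_mult L (F (Suc n)) (gr_class x r) (gr_class y (n - r)))
      = F (Suc n) +> convolution x y n" if n: "n \<ge> 1" for n
  proof -
    interpret p: lie_algebra_hom "L\<lparr>carrier := F n\<rparr>" "gr_piece L F n" "\<lambda>x. F (Suc n) +> x"
      by (rule gr_piece_hom[OF n])
    interpret i: lie_algebra_hom "L\<lparr>carrier := F n\<rparr>" L "\<lambda>x. x"
      by (rule F_subalgebra_hom[OF n])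
    have m: "x r \<otimes> y (n - r) \<in> F n" if "r \<in> {1..<n}" for r
      using F_bracket[of r "n - r" "x r" "y (n - r)"] that gr_rep_mem[OF x] gr_rep_mem[OF y] by auto
    have "rcoset_mult L (F (Suc n)) (gr_class x r) (gr_class y (n - r)) = F (Suc n) +> (x r \<otimes> y (n - r))"
      if "r \<in> {1..<n}" for r
      using rcoset_mult_gr[of r "n - r" "x r" "y (n - r)"] that gr_rep_mem[OF x] gr_rep_mem[OF y]
      by (auto simp: gr_class_def)
    then have "(\<Oplus>\<^bsub>gr_piece L F n\<^esub>r\<in>{1..<n}. rcoset_mult L (F (Suc n)) (gr_class x r) (gr_class y (n - r)))
      = (\<Oplus>\<^bsub>gr_piece L F n\<^esub>r\<in>{1..<n}. F (Suc n) +> (x r \<otimes> y (n - r)))"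
      using m by (intro p.B.finsum_cong') (auto simp: carrier_gr_piece)
    also have "\<dots> = F (Suc n) +> (\<Oplus>\<^bsub>L\<lparr>carrier := F n\<rparr>\<^esub>r\<in>{1..<n}. x r \<otimes> y (n - r))"
      using m by (subst p.hom_finsum) auto
    also have "(\<Oplus>\<^bsub>L\<lparr>carrier := F n\<rparr>\<^esub>r\<in>{1..<n}. x r \<otimes> y (n - r)) = convolution x y n"
      using m unfolding convolution_def by (subst i.hom_finsum) auto
    finally show ?thesis .
  qed
  then show ?thesis by (auto simp: gr_def gr_class_def[of "convolution x y"] fun_eq_iff)
qed

lemma gr_rep_zero: "gr_rep (\<lambda>r. \<zero>)"
  using F_subspace subspace_zero by (auto simp: gr_rep_def)

lemma gr_rep_add: "gr_rep x \<Longrightarrow> gr_rep y \<Longrightarrow> gr_rep (\<lambda>r. x r \<oplus> y r)"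
proof -
  assume xy: "gr_rep x" "gr_rep y"
  have "{r. r \<ge> 1 \<and> x r \<oplus> y r \<noteq> \<zero>} \<subseteq> {r. r \<ge> 1 \<and> x r \<noteq> \<zero>} \<union> {r. r \<ge> 1 \<and> y r \<noteq> \<zero>}" by auto
  then show ?thesis using xy F_subspace subspace_add unfolding gr_rep_def
    by (metis (no_types, lifting) finite_UnI finite_subset)
qed

lemma gr_rep_scale: "gr_rep x \<Longrightarrow> gr_rep (\<lambda>r. q \<odot> x r)"
proof -
  assume x: "gr_rep x"
  have "{r. r \<ge> 1 \<and> q \<odot> x r \<noteq> \<zero>} \<subseteq> {r. r \<ge> 1 \<and> x r \<noteq> \<zero>}" by auto
  then show ?thesis using x F_subspace subspace_scale unfolding gr_rep_def
    by (metis (no_types, lifting) finite_subset)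
qed

text \<open>The support of the convolution lies in the set of sums of the two finite
  supports.\<close>

lemma gr_rep_convolution:
  assumes x: "gr_rep x" and y: "gr_rep y" shows "gr_rep (convolution x y)"
proof -
  let ?X = "{r. r \<ge> 1 \<and> x r \<noteq> \<zero>}" and ?Y = "{r. r \<ge> 1 \<and> y r \<noteq> \<zero>}"
  have "n \<in> (\<lambda>(r, s). r + s) ` (?X \<times> ?Y)" if n: "convolution x y n \<noteq> \<zero>" for n
  proof (rule ccontr)
    assume n': "n \<notin> (\<lambda>(r, s). r + s) ` (?X \<times> ?Y)"
    have "x r \<otimes> y (n - r) \<in> {\<zero>}" if r: "1 \<le> r" "r < n" for r
    proof -
      have "x r = \<zero> \<or> y (n - r) = \<zero>"
      proof (rule ccontr)
        assume "\<not> (x r = \<zero> \<or> y (n - r) = \<zero>)"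
        then have "(r, n - r) \<in> ?X \<times> ?Y" using r by auto
        then have "r + (n - r) \<in> (\<lambda>(r, s). r + s) ` (?X \<times> ?Y)" by (rule rev_image_eqI) simp
        then show False using n' r by simp
      qed
      then show ?thesis using gr_rep_carrier[OF x, of r] gr_rep_carrier[OF y, of "n - r"] r by auto
    qed
    then have "convolution x y n \<in> {\<zero>}" by (rule convolution_mem[OF subspace_trivial])
    then show False using n by simp
  qed
  then have "{n. n \<ge> 1 \<and> convolution x y n \<noteq> \<zero>} \<subseteq> (\<lambda>(r, s). r + s) ` (?X \<times> ?Y)" by blast
  moreover have "finite ((\<lambda>(r, s). r + s) ` (?X \<times> ?Y))" using x y by (simp add: gr_rep_def)
  ultimately have "finite {n. n \<ge> 1 \<and> convolution x y n \<noteq> \<zero>}" by (rule finite_subset)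
  moreover have "convolution x y n \<in> F n" if "n \<ge> 1" for n
  proof (rule convolution_mem[OF F_subspace[OF that]])
    fix r assume "1 \<le> r" "r < n"
    then show "x r \<otimes> y (n - r) \<in> F n"
      using F_bracket[of r "n - r" "x r" "y (n - r)"] gr_rep_mem[OF x] gr_rep_mem[OF y] by simp
  qed
  ultimately show ?thesis by (simp add: gr_rep_def)
qed

lemma carrier_gr: "carrier (gr L F) = gr_class ` {x. gr_rep x}"
proof (rule Set.set_eqI)
  fix c
  have "\<exists>x. gr_rep x \<and> c = gr_class x" if c: "c \<in> carrier (gr L F)"
    using carrier_grE[OF c] by metis
  then show "c \<in> carrier (gr L F) \<longleftrightarrow> c \<in> gr_class ` {x. gr_rep x}"
    using gr_class_in_carrier by blast
qed

lemma gr_class_cong: "(\<And>r. r \<ge> 1 \<Longrightarrow> x r = y r) \<Longrightarrow> gr_class x = gr_class y"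
  unfolding gr_class_def by (rule restrict_ext) simp

lemma gr_abelian_group: "abelian_group (gr L F)"
proof (rule abelian_groupI)
  note c = gr_rep_carrier
  show "u \<oplus>\<^bsub>gr L F\<^esub> v \<oplus>\<^bsub>gr L F\<^esub> w = u \<oplus>\<^bsub>gr L F\<^esub> (v \<oplus>\<^bsub>gr L F\<^esub> w)"
    if uvw: "u \<in> carrier (gr L F)" "v \<in> carrier (gr L F)" "w \<in> carrier (gr L F)" for u v w
  proof -
    obtain x y z where *: "gr_rep x" "gr_rep y" "gr_rep z" "u = gr_class x" "v = gr_class y" "w = gr_class z"
      using uvw unfolding carrier_gr by blast
    then show ?thesis using c
      by (simp add: gr_add gr_rep_add) (rule gr_class_cong, simp add: a_assoc)
  qed
  show "u \<oplus>\<^bsub>gr L F\<^esub> v = v \<oplus>\<^bsub>gr L F\<^esub> u"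
    if uv: "u \<in> carrier (gr L F)" "v \<in> carrier (gr L F)" for u v
  proof -
    obtain x y where *: "gr_rep x" "gr_rep y" "u = gr_class x" "v = gr_class y"
      using uv unfolding carrier_gr by blast
    then show ?thesis using c
      by (simp add: gr_add gr_rep_add) (rule gr_class_cong, simp add: a_comm)
  qed
  show "\<zero>\<^bsub>gr L F\<^esub> \<oplus>\<^bsub>gr L F\<^esub> u = u" if u: "u \<in> carrier (gr L F)" for u
  proof -
    obtain x where *: "gr_rep x" "u = gr_class x" using u unfolding carrier_gr by blast
    then show ?thesis using c
      by (simp add: gr_zero gr_add gr_rep_zero) (rule gr_class_cong, simp)
  qed
  show "\<exists>v\<in>carrier (gr L F). v \<oplus>\<^bsub>gr L F\<^esub> u = \<zero>\<^bsub>gr L F\<^esub>" if u: "u \<in> carrier (gr L F)" for u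
  proof -
    obtain x where *: "gr_rep x" "u = gr_class x" using u unfolding carrier_gr by blast
    have "gr_class (\<lambda>r. (-1) \<odot> x r) \<oplus>\<^bsub>gr L F\<^esub> u = \<zero>\<^bsub>gr L F\<^esub>"
      using * c gr_rep_scale[of x "-1"]
      by (simp add: gr_zero gr_add)
        (rule gr_class_cong, simp add: minus_conv_scale[symmetric] l_neg)
    then show ?thesis using gr_rep_scale[OF *(1), of "-1"] gr_class_in_carrier by blast
  qed
qed (auto simp: carrier_gr gr_zero gr_add gr_rep_add gr_rep_zero)

text \<open>The property \<open>P\<close> concerns representatives and may depend on their choice: a
  class belongs to the subalgebra as soon as one representative satisfies \<open>P\<close>.\<close>

lemma gr_subalgebraI:
  assumes zero: "P (\<lambda>r. \<zero>)" and add: "\<And>x y. gr_rep x \<Longrightarrow> gr_rep y \<Longrightarrow> P x \<Longrightarrow> P y \<Longrightarrow> P (\<lambda>r. x r \<oplus> y r)"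
    and scale: "\<And>q x. gr_rep x \<Longrightarrow> P x \<Longrightarrow> P (\<lambda>r. q \<odot> x r)"
    and mult: "\<And>x y. gr_rep x \<Longrightarrow> gr_rep y \<Longrightarrow> P x \<Longrightarrow> P y \<Longrightarrow> P (convolution x y)"
  shows "lie_subalgebra (gr L F) (gr_class ` {x. gr_rep x \<and> P x})"
proof -
  interpret gr: abelian_group "gr L F" by (rule gr_abelian_group)
  let ?T = "gr_class ` {x. gr_rep x \<and> P x}"
  have "\<ominus>\<^bsub>gr L F\<^esub> gr_class x \<in> ?T" if x: "gr_rep x" "P x" for x
  proof -
    have x': "gr_rep (\<lambda>r. (-1) \<odot> x r)" by (rule gr_rep_scale[OF x(1)])
    then have "gr_class (\<lambda>r. (-1) \<odot> x r) \<oplus>\<^bsub>gr L F\<^esub> gr_class x = \<zero>\<^bsub>gr L F\<^esub>"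
      using x gr_rep_carrier[OF x(1)]
      by (simp add: gr_zero gr_add) (rule gr_class_cong, simp add: minus_conv_scale[symmetric] l_neg)
    then have "\<ominus>\<^bsub>gr L F\<^esub> gr_class x = gr_class (\<lambda>r. (-1) \<odot> x r)"
      using x(1) x' gr_class_in_carrier by (intro gr.minus_equality)
    then show ?thesis using x' scale[OF x] by auto
  qed
  then have "subgroup ?T (add_monoid (gr L F))"
    using add gr_rep_add zero gr_rep_zero gr_class_in_carrier
    by (intro gr.add.subgroupI) (auto simp: gr_add)
  then have "submodule ?T rat_ring (gr L F)"
    using scale gr_rep_scale by (auto simp: submodule_def submodule_axioms_def gr_scale)
  then show ?thesis
    using mult gr_rep_convolution by (auto simp: lie_subalgebra_def gr_mult)
qed

lemma gr_subalgebra_closed: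
  assumes "lie_subalgebra (gr L F) K"
  shows "u \<in> K \<Longrightarrow> v \<in> K \<Longrightarrow> u \<oplus>\<^bsub>gr L F\<^esub> v \<in> K" "u \<in> K \<Longrightarrow> q \<odot>\<^bsub>gr L F\<^esub> u \<in> K"
    "u \<in> K \<Longrightarrow> v \<in> K \<Longrightarrow> u \<otimes>\<^bsub>gr L F\<^esub> v \<in> K" "\<zero>\<^bsub>gr L F\<^esub> \<in> K"
proof -
  have K: "submodule K rat_ring (gr L F)" using assms by (simp add: lie_subalgebra_def)
  note S = submodule.axioms(1)[OF K]
  show "u \<in> K \<Longrightarrow> v \<in> K \<Longrightarrow> u \<oplus>\<^bsub>gr L F\<^esub> v \<in> K" using subgroup.m_closed[OF S] by simp
  show "u \<in> K \<Longrightarrow> q \<odot>\<^bsub>gr L F\<^esub> u \<in> K" using submodule.smult_closed[OF K] by simp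
  show "u \<in> K \<Longrightarrow> v \<in> K \<Longrightarrow> u \<otimes>\<^bsub>gr L F\<^esub> v \<in> K" using assms by (simp add: lie_subalgebra_def)
  show "\<zero>\<^bsub>gr L F\<^esub> \<in> K" using subgroup.one_closed[OF S] by simp
qed

section \<open>Generation in degree 1 and the lower central series\<close>

definition homogeneous :: "nat \<Rightarrow> 'a \<Rightarrow> nat \<Rightarrow> 'a" where
  "homogeneous n v = (\<lambda>r. if r = n then v else \<zero>)"

lemma gr_rep_homogeneous: "n \<ge> 1 \<Longrightarrow> v \<in> F n \<Longrightarrow> gr_rep (homogeneous n v)"
  using F_subspace subspace_zero by (auto simp: gr_rep_def homogeneous_def)

text \<open>Generation of \<open>gr\<close> in degree 1, expressed inside \<open>L\<close>:
  \<open>F r\<close> is the sum of \<open>F (Suc r)\<close> and the \<open>r\<close>-th term of the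
  lower central series. The \<open>r - 1\<close> undoes the index shift of
  \<open>lie_lcs\<close>.\<close>

definition lcs_dense :: bool where
  "lcs_dense \<longleftrightarrow> (\<forall>r\<ge>1. \<forall>v\<in>F r. \<exists>w\<in>lie_lcs L (r - 1). eqm (F (Suc r)) v w)"

lemma lcs_subset_F: "lie_lcs L n \<subseteq> F (Suc n)"
proof (induction n)
  case (Suc n)
  then have "a \<otimes> b \<in> F (Suc (Suc n))" if "a \<in> lie_lcs L n" "b \<in> carrier L" for a b
    using F_bracket[of "Suc n" "Suc 0" a b] that F_1 by auto
  then show ?case unfolding lie_lcs.simps(2) using F_subspace by (intro lie_product_least) auto
qed (simp add: F_1)

text \<open>Classes that can be represented by elements of the lower central series form a
  subalgebra. It contains degree 1, where the series is still all of \<open>L\<close>, hence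
  everything.\<close>

lemma gr_generated_imp_lcs_dense:
  assumes gen: "lie_generated (gr L F) (gr_degree_one L F) = carrier (gr L F)"
  shows lcs_dense
  unfolding lcs_dense_def
proof (intro allI impI ballI)
  fix r v assume r: "(r::nat) \<ge> 1" and v: "v \<in> F r"
  let ?P = "\<lambda>x. \<forall>r\<ge>1. x r \<in> lie_lcs L (r - 1)"
  note S = subspace_lie_lcs
  have T: "lie_subalgebra (gr L F) (gr_class ` {x. gr_rep x \<and> ?P x})"
  proof (rule gr_subalgebraI)
    fix x y assume xy: "gr_rep x" "gr_rep y" "?P x" "?P y"
    show "?P (convolution x y)"
    proof (intro allI impI)
      fix n :: nat assume "n \<ge> 1"
      show "convolution x y n \<in> lie_lcs L (n - 1)"
      proof (rule convolution_mem[OF S])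
        fix r assume r: "1 \<le> r" "r < n"
        then have "Suc ((r - 1) + (n - r - 1)) = n - 1" by simp
        moreover have "x r \<in> lie_lcs L (r - 1)" "y (n - r) \<in> lie_lcs L (n - r - 1)"
          using xy(3)[rule_format, of r] xy(4)[rule_format, of "n - r"] r by auto
        ultimately show "x r \<otimes> y (n - r) \<in> lie_lcs L (n - 1)" using bracket_mem_lie_lcs by metis
      qed
    qed
  qed (use S subspace_zero subspace_add subspace_scale in blast)+
  have "gr_degree_one L F \<subseteq> gr_class ` {x. gr_rep x \<and> ?P x}"
  proof
    fix c assume c: "c \<in> gr_degree_one L F"
    then obtain x where x: "gr_rep x" "c = gr_class x" "\<And>r. r \<ge> 1 \<Longrightarrow> c r = \<zero>\<^bsub>gr_piece L F r\<^esub> \<Longrightarrow> x r = \<zero>"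
      using carrier_grE unfolding gr_degree_one_def by blast
    have "x r \<in> lie_lcs L (r - 1)" if r: "r \<ge> 1" for r
    proof (cases "r = 1")
      case True
      then show ?thesis using gr_rep_carrier[OF x(1), of 1] by simp
    next
      case False
      then have "x r = \<zero>" using x(3)[OF r] c r by (auto simp: gr_degree_one_def)
      then show ?thesis using S subspace_zero by simp
    qed
    then show "c \<in> gr_class ` {x. gr_rep x \<and> ?P x}" using x by blast
  qed
  then have "carrier (gr L F) \<subseteq> gr_class ` {x. gr_rep x \<and> ?P x}"
    using T unfolding gen[symmetric] lie_generated_def by blast
  then have "gr_class (homogeneous r v) \<in> gr_class ` {x. gr_rep x \<and> ?P x}"
    using gr_class_in_carrier[OF gr_rep_homogeneous[OF r v]] by blast
  then obtain x where x: "gr_rep x" "?P x" "gr_class (homogeneous r v) = gr_class x" by blast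
  then have "eqm (F (Suc r)) (homogeneous r v r) (x r)"
    using gr_class_eq_iff[OF gr_rep_homogeneous[OF r v] x(1)] r by blast
  then show "\<exists>w\<in>lie_lcs L (r - 1). eqm (F (Suc r)) v w" using x(2) r by (auto simp: homogeneous_def)
qed

lemma convolution_homogeneous:
  assumes n: "n \<ge> 1" and a: "a \<in> carrier L" and b: "b \<in> carrier L"
  shows "convolution (homogeneous n a) (homogeneous (Suc 0) b) m = homogeneous (Suc n) (a \<otimes> b) m"
proof -
  have "convolution (homogeneous n a) (homogeneous (Suc 0) b) m
     = (\<Oplus>r\<in>{1..<m}. if n = r then (if m = Suc n then a \<otimes> b else \<zero>) else \<zero>)"
    unfolding convolution_def using a b
    by (intro finsum_cong') (auto simp: homogeneous_def)
  also have "\<dots> = homogeneous (Suc n) (a \<otimes> b) m"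
  proof (cases "m = Suc n")
    case True
    then have "(\<Oplus>r\<in>{1..<m}. if n = r then a \<otimes> b else \<zero>) = a \<otimes> b"
      using n a b by (intro finsum_singleton) auto
    then show ?thesis using True by (simp add: homogeneous_def)
  next
    case False
    then have "(\<Oplus>r\<in>{1..<m}. if n = r then (if m = Suc n then a \<otimes> b else \<zero>) else \<zero>) = (\<Oplus>r\<in>{1..<m}. \<zero>)"
      by (intro finsum_cong') auto
    then show ?thesis using False by (simp add: homogeneous_def)
  qed
  finally show ?thesis .
qed

text \<open>A subalgebra containing degree 1 contains every homogeneous class, by induction on the
  degree, and then every finite sum of them.\<close>

lemma lcs_dense_imp_gr_generated:
  assumes dense: lcs_dense
  shows "lie_generated (gr L F) (gr_degree_one L F) = carrier (gr L F)"
proof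
  have "lie_subalgebra (gr L F) (gr_class ` {x. gr_rep x \<and> True})"
    by (rule gr_subalgebraI) auto
  then have "lie_subalgebra (gr L F) (carrier (gr L F))" by (simp add: carrier_gr)
  then show "lie_generated (gr L F) (gr_degree_one L F) \<subseteq> carrier (gr L F)"
    by (auto simp: lie_generated_def gr_degree_one_def)
  have "carrier (gr L F) \<subseteq> K"
    if K: "lie_subalgebra (gr L F) K" and K1: "gr_degree_one L F \<subseteq> K" for K
  proof -
    note K_ops = gr_subalgebra_closed[OF K]
    have hom1: "gr_class (homogeneous 1 v) \<in> K" if v: "v \<in> F 1" for v
    proof -
      have h: "gr_rep (homogeneous 1 v)" using v by (intro gr_rep_homogeneous) auto
      have "gr_class (homogeneous 1 v) r = \<zero>\<^bsub>gr_piece L F r\<^esub>" if "r \<ge> 2" for r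
        using that gr_class_zero_iff[OF h, of r] subspace_zero[OF F_subspace[of "Suc r"]]
        by (simp add: homogeneous_def)
      then show ?thesis using K1 gr_class_in_carrier[OF h] by (auto simp: gr_degree_one_def)
    qed
    have hom: "gr_class (homogeneous n v) \<in> K" if "n \<ge> 1" "v \<in> F n" for n v
      using that
    proof (induction n arbitrary: v rule: dec_induct)
      case base
      then show ?case by (rule hom1)
    next
      case (step n)
      \<comment> \<open>Elements whose class lies in \<open>K\<close> form a subspace, so it
        suffices to treat brackets of a term of the lower central series with an arbitrary
        element.\<close>
      let ?W = "{w\<in>F (Suc n). gr_class (homogeneous (Suc n) w) \<in> K}"
      have S: "rat_subspace (F (Suc n))" using F_subspace by simp
      have rep: "gr_rep (homogeneous (Suc n) w)" if "w \<in> F (Suc n)" for w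
        using that by (intro gr_rep_homogeneous) auto
      have W: "rat_subspace ?W"
      proof (rule subspaceI)
        have "homogeneous (Suc n) \<zero> = (\<lambda>r. \<zero>)" by (auto simp: homogeneous_def)
        then show "\<zero> \<in> ?W" using S subspace_zero K_ops(4) by (simp add: gr_zero)
        show "x \<oplus> y \<in> ?W" if "x \<in> ?W" "y \<in> ?W" for x y
        proof -
          have "homogeneous (Suc n) (x \<oplus> y) = (\<lambda>r. homogeneous (Suc n) x r \<oplus> homogeneous (Suc n) y r)"
            by (auto simp: homogeneous_def)
          then show ?thesis using that K_ops(1) subspace_add[OF S] by (auto simp: gr_add rep simp flip: gr_add)
        qed
        show "q \<odot> x \<in> ?W" if "x \<in> ?W" for q x
        proof -
          have "homogeneous (Suc n) (q \<odot> x) = (\<lambda>r. q \<odot> homogeneous (Suc n) x r)"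
            by (auto simp: homogeneous_def)
          then show ?thesis using that K_ops(2) subspace_scale[OF S] by (auto simp: rep simp flip: gr_scale)
        qed
      qed (use subspace_carrier[OF S] in auto)
      obtain k where k: "n = Suc k" using step by (cases n) auto
      have "a \<otimes> b \<in> ?W" if ab: "a \<in> lie_lcs L k" "b \<in> carrier L" for a b
      proof -
        have a: "a \<in> F n" "a \<in> carrier L" using ab lcs_subset_F[of k] k F_carrier[of a n] by auto
        have b: "b \<in> F 1" using ab F_1 by simp
        have "gr_class (homogeneous n a) \<otimes>\<^bsub>gr L F\<^esub> gr_class (homogeneous 1 b) \<in> K"
          using step.IH[OF a(1)] hom1[OF b] by (rule K_ops(3))
        also have "gr_class (homogeneous n a) \<otimes>\<^bsub>gr L F\<^esub> gr_class (homogeneous 1 b)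
            = gr_class (homogeneous (Suc n) (a \<otimes> b))"
          using a b ab step.hyps
          by (subst gr_mult) (auto intro!: gr_rep_homogeneous gr_class_cong simp: convolution_homogeneous)
        finally show ?thesis using F_bracket[of n 1 a b] a b step.hyps by simp
      qed
      then have "lie_product L (lie_lcs L k) (carrier L) \<subseteq> ?W" using W by (intro lie_product_least)
      then have "lie_lcs L n \<subseteq> ?W" by (simp add: k)
      moreover obtain w where w: "w \<in> lie_lcs L n" "eqm (F (Suc (Suc n))) v w"
        using dense step.prems unfolding lcs_dense_def by (metis diff_Suc_1 le_add1 plus_1_eq_Suc)
      ultimately have w': "w \<in> F (Suc n)" "gr_class (homogeneous (Suc n) w) \<in> K" by auto
      have "gr_class (homogeneous (Suc n) v) = gr_class (homogeneous (Suc n) w)"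
        using w(2) eqm_refl[OF F_subspace]
        by (subst gr_class_eq_iff[OF rep[OF step.prems] rep[OF w'(1)]]) (auto simp: homogeneous_def)
      then show ?case using w' by simp
    qed
    \<comment> \<open>General elements are reached by splitting off the top homogeneous
      part.\<close>
    have bounded: "gr_class x \<in> K" if "gr_rep x" "\<And>r. r \<ge> 1 \<Longrightarrow> x r \<noteq> \<zero> \<Longrightarrow> r \<le> m" for m x
      using that
    proof (induction m arbitrary: x)
      case 0
      then have "gr_class x = \<zero>\<^bsub>gr L F\<^esub>" unfolding gr_zero by (intro gr_class_cong) fastforce
      then show ?case using K_ops(4) by simp
    next
      case (Suc m)
      let ?y = "x(Suc m := \<zero>)"
      have "{r. r \<ge> 1 \<and> ?y r \<noteq> \<zero>} \<subseteq> {r. r \<ge> 1 \<and> x r \<noteq> \<zero>}" by auto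
      then have "finite {r. r \<ge> 1 \<and> ?y r \<noteq> \<zero>}"
        by (rule finite_subset) (use Suc.prems(1) in \<open>simp add: gr_rep_def\<close>)
      moreover have "\<forall>r\<ge>1. ?y r \<in> F r"
        using gr_rep_mem[OF Suc.prems(1)] F_subspace subspace_zero by auto
      ultimately have y: "gr_rep ?y" unfolding gr_rep_def by blast
      have "r \<le> m" if "r \<ge> 1" "?y r \<noteq> \<zero>" for r
        using Suc.prems(2)[of r] that by (auto split: if_splits simp: le_Suc_eq)
      then have yK: "gr_class ?y \<in> K" using Suc.IH[OF y] by blast
      have xm: "x (Suc m) \<in> F (Suc m)" using gr_rep_mem[OF Suc.prems(1)] by simp
      then have hom_rep: "gr_rep (homogeneous (Suc m) (x (Suc m)))" by (intro gr_rep_homogeneous) auto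
      have "gr_class ?y \<oplus>\<^bsub>gr L F\<^esub> gr_class (homogeneous (Suc m) (x (Suc m))) \<in> K"
        using hom[of "Suc m", OF _ xm] yK by (intro K_ops(1)) auto
      also have "gr_class ?y \<oplus>\<^bsub>gr L F\<^esub> gr_class (homogeneous (Suc m) (x (Suc m))) = gr_class x"
        unfolding gr_add[OF y hom_rep]
        using gr_rep_carrier[OF Suc.prems(1)] by (intro gr_class_cong) (auto simp: homogeneous_def)
      finally show ?case .
    qed
    have "gr_class x \<in> K" if x: "gr_rep x" for x
    proof -
      have "finite {r. r \<ge> 1 \<and> x r \<noteq> \<zero>}" using x by (simp add: gr_rep_def)
      then obtain m where "\<forall>r\<in>{r. r \<ge> 1 \<and> x r \<noteq> \<zero>}. r \<le> m" by (metis finite_nat_set_iff_bounded_le)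
      then show ?thesis using bounded[OF x] by blast
    qed
    then show ?thesis by (auto simp: carrier_gr)
  qed
  then show "carrier (gr L F) \<subseteq> lie_generated (gr L F) (gr_degree_one L F)"
    by (auto simp: lie_generated_def)
qed

end

text \<open>From here on the graded algebra is replaced by the density condition, which passes to
  quotients and is easy to verify for examples.\<close>

lemma malcev_lie_algebra_iff:
  "malcev_lie_algebra L F \<longleftrightarrow> complete_lie_algebra L F \<and> complete_lie_algebra.lcs_dense L F"
proof -
  have "complete_lie_algebra L F" if m: "malcev_lie_algebra L F"
  proof -
    have m': "rat_lie_algebra L" "\<And>r. r \<ge> 1 \<Longrightarrow> submodule (F r) rat_ring L" "\<And>r. r \<ge> 1 \<Longrightarrow> F (Suc r) \<subseteq> F r"
      "F 1 = carrier L" "filtration_complete L F"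
      "\<And>r s. r \<ge> 1 \<Longrightarrow> s \<ge> 1 \<Longrightarrow> lie_product L (F r) (F s) \<subseteq> F (r + s)"
      using m unfolding malcev_lie_algebra_def by blast+
    interpret rat_lie_algebra L by (rule m'(1))
    show ?thesis
    proof (intro complete_lie_algebra.intro complete_lie_algebra_axioms.intro rat_lie_algebra_axioms)
      fix r s x y assume "(r::nat) \<ge> 1" "(s::nat) \<ge> 1" "x \<in> F r" "y \<in> F s"
      then show "x \<otimes>\<^bsub>L\<^esub> y \<in> F (r + s)" using m'(6)[of r s] lie_product_memI by blast
    qed (use m' in auto)
  qed
  moreover have "malcev_lie_algebra L F \<longleftrightarrow> complete_lie_algebra.lcs_dense L F" if c: "complete_lie_algebra L F"
  proof -
    interpret complete_lie_algebra L F by (rule c)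
    have "lie_product L (F r) (F s) \<subseteq> F (r + s)" if "r \<ge> 1" "s \<ge> 1" for r s
      using that F_bracket F_subspace by (intro lie_product_least) auto
    then have "malcev_lie_algebra L F \<longleftrightarrow> lie_generated (gr L F) (gr_degree_one L F) = carrier (gr L F)"
      using F_subspace F_Suc F_1 F_complete rat_lie_algebra_axioms by (auto simp: malcev_lie_algebra_def)
    then show ?thesis using gr_generated_imp_lcs_dense lcs_dense_imp_gr_generated by blast
  qed
  ultimately show ?thesis by blast
qed

text \<open>Once the lower central series is zero, density makes successive filtration steps equal,
  and a constant separated filtration is zero. Lie nilpotency thus implies the vanishing that makes
  \<open>bch\<close> a finite sum.\<close>

lemma nilpotent_malcev_filtration:
  assumes M: "malcev_lie_algebra M E" and nil: "lie_nilpotent M"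
  obtains m where "m \<ge> 1" "E m = {\<zero>\<^bsub>M\<^esub>}"
proof -
  interpret complete_lie_algebra M E using M by (simp add: malcev_lie_algebra_iff)
  have dense: lcs_dense using M by (simp add: malcev_lie_algebra_iff)
  obtain n where n: "lie_lcs M n = {\<zero>\<^bsub>M\<^esub>}" using nil by (auto simp: lie_nilpotent_def)
  have step: "E r \<subseteq> E (Suc r)" if r: "r \<ge> Suc n" for r
  proof
    fix v assume v: "v \<in> E r"
    have "lie_lcs M (r - 1) \<subseteq> {\<zero>\<^bsub>M\<^esub>}" using n lie_lcs_antimono[of n "r - 1"] r by auto
    then have "eqm (E (Suc r)) v \<zero>\<^bsub>M\<^esub>" using dense v r unfolding lcs_dense_def by force
    then show "v \<in> E (Suc r)" using eqm_zero_iff F_subspace by simp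
  qed
  have "E (Suc n) \<subseteq> E r" if "r \<ge> 1" for r
  proof (cases "r \<ge> Suc n")
    case True
    then show ?thesis by (induction r rule: dec_induct) (use step in auto)
  qed (use F_antimono[OF that, of "Suc n"] in auto)
  then have "v = \<zero>\<^bsub>M\<^esub>" if v: "v \<in> E (Suc n)" for v
    using v F_carrier[OF v] by (intro F_separated) auto
  then have "E (Suc n) \<subseteq> {\<zero>\<^bsub>M\<^esub>}" by blast
  then show ?thesis using that[of "Suc n"] subspace_zero[OF F_subspace[of "Suc n"]] by auto
qed

subsection \<open>Examples of Malcev Lie algebras\<close>

text \<open>A coherent sequence is constant from index \<open>n\<close> on, so \<open>s n\<close> is
  its limit.\<close>

lemma (in rat_lie_algebra) filtration_complete_discrete:
  assumes F: "\<And>r. r \<ge> 1 \<Longrightarrow> rat_subspace (F r)" "\<And>r. r \<ge> 1 \<Longrightarrow> F (Suc r) \<subseteq> F r"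
    and n: "n \<ge> 1" "F n = {\<zero>}"
  shows "filtration_complete L F"
proof -
  have anti: "F s \<subseteq> F r" if "1 \<le> r" "r \<le> s" for r s
    using that(2) that(1)
  proof (induction s rule: dec_induct)
    case (step k)
    then show ?case using F(2)[of k] by auto
  qed auto
  have "\<exists>z\<in>carrier L. \<forall>r\<ge>1. eqm (F r) (s r) z" if s: "\<forall>r\<ge>1. eqm (F r) (s (Suc r)) (s r)" for s
  proof -
    have sc: "s r \<in> carrier L" if "r \<ge> 1" for r using s that eqm_carrier by blast
    have chain: "eqm (F r) (s k) (s r)" if "1 \<le> r" "r \<le> k" for r k
      using that(2)
    proof (induction k rule: dec_induct)
      case base
      then show ?case using that F sc eqm_refl by blast
    next
      case (step k)
      have "eqm (F k) (s (Suc k)) (s k)" using s step that by simp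
      then have "eqm (F r) (s (Suc k)) (s k)" using anti[of r k] step that eqm_mono by blast
      then show ?case using step.IH F(1)[OF that(1)] eqm_trans by blast
    qed
    have "eqm (F r) (s r) (s n)" if r: "r \<ge> 1" for r
    proof (cases "r \<le> n")
      case True
      then show ?thesis using chain[OF r True] eqm_sym[OF F(1)[OF r]] by blast
    next
      case False
      then have "s r = s n" using chain[OF n(1), of r] by (simp add: n(2) eqm_trivial_iff)
      then show ?thesis using eqm_refl[OF F(1)[OF r] sc[OF r]] by simp
    qed
    then show ?thesis using sc n(1) by blast
  qed
  then show ?thesis using F n by (subst filtration_complete_iff) auto
qed

text \<open>Nilpotency makes this filtration discrete, hence complete, and density holds with each
  element as its own witness.\<close>

lemma (in rat_lie_algebra) malcev_lie_lcs:
  assumes nil: "lie_nilpotent L"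
  shows "malcev_lie_algebra L (\<lambda>r. lie_lcs L (r - 1))"
proof -
  let ?F = "\<lambda>r. lie_lcs L (r - 1)"
  obtain n where n: "lie_lcs L n = {\<zero>}" using nil by (auto simp: lie_nilpotent_def)
  have dec: "?F (Suc r) \<subseteq> ?F r" for r by (rule lie_lcs_antimono) simp
  have c: "complete_lie_algebra L ?F"
  proof (intro complete_lie_algebra.intro complete_lie_algebra_axioms.intro rat_lie_algebra_axioms)
    show "filtration_complete L ?F"
      using n dec subspace_lie_lcs by (intro filtration_complete_discrete[of ?F "Suc n"]) auto
    fix r s x y assume "(r::nat) \<ge> 1" "(s::nat) \<ge> 1" "x \<in> ?F r" "y \<in> ?F s"
    moreover from this have "Suc ((r - 1) + (s - 1)) = r + s - 1" by simp
    ultimately show "x \<otimes> y \<in> ?F (r + s)" using bracket_mem_lie_lcs by metis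
  qed (use dec subspace_lie_lcs in auto)
  interpret complete_lie_algebra L ?F by (rule c)
  have lcs_dense unfolding lcs_dense_def
  proof (intro allI impI ballI)
    fix r v assume r: "(r::nat) \<ge> 1" and v: "v \<in> ?F r"
    then have "eqm (?F (Suc r)) v v" using F_carrier[OF v r] F_subspace[of "Suc r"] eqm_refl by simp
    then show "\<exists>w\<in>?F r. eqm (?F (Suc r)) v w" using v by blast
  qed
  then show ?thesis using c by (simp add: malcev_lie_algebra_iff)
qed

text \<open>Density passes to the quotient because the projection maps the lower central series into
  the lower central series.\<close>

lemma (in complete_lie_algebra) malcev_quotient:
  assumes J: "closed_ideal J" and dense: lcs_dense
  shows "malcev_lie_algebra (lie_quotient L J) (quotient_filtration L J F)"
proof -
  let ?Q = "lie_quotient L J" and ?E = "quotient_filtration L J F" and ?p = "\<lambda>x. J +> x"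
  interpret p: lie_algebra_hom L ?Q ?p
    by (rule lie_algebra_hom_quotient[OF closed_ideal_ideal[OF J]])
  interpret Q: complete_lie_algebra ?Q ?E by (rule complete_quotient[OF J])
  have "Q.lcs_dense" unfolding Q.lcs_dense_def
  proof (intro allI impI ballI)
    fix r V assume r: "(r::nat) \<ge> 1" and "V \<in> ?E r"
    then obtain v where v: "v \<in> F r" "V = ?p v" by (auto simp: quotient_filtration_def)
    obtain w where w: "w \<in> lie_lcs L (r - 1)" "eqm (F (Suc r)) v w"
      using dense v(1) r unfolding lcs_dense_def by blast
    have "?p v \<ominus>\<^bsub>?Q\<^esub> ?p w \<in> ?E (Suc r)"
      using w(2) p.hom_diff[of v w] by (auto simp: quotient_filtration_def eq_mod_def)
    then have "eq_mod ?Q (?E (Suc r)) V (?p w)"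
      using v(2) eqm_carrier[OF w(2)] by (simp add: eq_mod_def)
    then show "\<exists>W\<in>lie_lcs ?Q (r - 1). eq_mod ?Q (?E (Suc r)) V W"
      using p.lie_lcs_image w(1) by blast
  qed
  then show ?thesis using Q.complete_lie_algebra_axioms by (simp add: malcev_lie_algebra_iff)
qed

subsection \<open>The Lie algebra spanned by the image of a group\<close>

text \<open>Zero commutes with every element, so multiplying by an element of \<open>N\<close> does
  not change the value. This makes the map on the quotient group well defined.\<close>

lemma (in exp_hom) rho_eq_of_coset_eq:
  assumes N: "N \<lhd> G" and triv: "\<rho> ` N \<subseteq> {\<zero>}"
    and gh: "g \<in> carrier G" "h \<in> carrier G" "N #>\<^bsub>G\<^esub> g = N #>\<^bsub>G\<^esub> h"
  shows "\<rho> g = \<rho> h"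
proof -
  interpret N: normal N G by (rule N)
  have "g \<in> N #>\<^bsub>G\<^esub> h" using gh G.rcos_self[OF gh(1) N.subgroup_axioms] by blast
  then obtain n where n: "n \<in> N" "g = n \<otimes>\<^bsub>G\<^esub> h" by (auto simp: r_coset_def)
  then have "\<rho> n = \<zero>" "n \<in> carrier G" using triv by auto
  then show ?thesis using gh n(2) by (simp add: rho_mult bch_commuting)
qed

context nilpotent_exp_hom
begin

abbreviation rho_span :: "'a set" where "rho_span \<equiv> rat_span L (\<rho> ` carrier G)"

lemma rho_span_hom: "lie_algebra_hom (L\<lparr>carrier := rho_span\<rparr>) L (\<lambda>x. x)"
proof (rule lie_subalgebra_hom)
  have c: "\<rho> ` carrier G \<subseteq> carrier L" by auto
  then show "rat_subspace rho_span" by (rule rat_span_subspace)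
  then have "lie_product L rho_span rho_span \<subseteq> rho_span"
    using bracket_mem_span[OF G.subgroup_self] c by (intro lie_product_span_subset) auto
  then show "x \<otimes> y \<in> rho_span" if "x \<in> rho_span" "y \<in> rho_span" for x y
    using that lie_product_memI by blast
qed

text \<open>Changing the filtration does not change the product: the lower central series of
  \<open>K\<close> lies stepwise in \<open>F\<close>, so the inclusion is filtered and commutes with
  \<open>bch\<close>.\<close>

lemma rho_span_malcev:
  defines "K \<equiv> L\<lparr>carrier := rho_span\<rparr>"
  assumes nil: "lie_nilpotent L"
  shows "malcev_lie_algebra K (\<lambda>r. lie_lcs K (r - 1))" "lie_nilpotent K"
    "x \<in> rho_span \<Longrightarrow> y \<in> rho_span \<Longrightarrow> bch K (\<lambda>r. lie_lcs K (r - 1)) x y = bch L F x y"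
    "\<rho> \<in> hom G (exp_group K (\<lambda>r. lie_lcs K (r - 1)))"
proof -
  interpret i: lie_algebra_hom K L "\<lambda>x. x" unfolding K_def by (rule rho_span_hom)
  show nilK: "lie_nilpotent K"
  proof -
    obtain n where n: "lie_lcs L n = {\<zero>}" using nil by (auto simp: lie_nilpotent_def)
    then have "lie_lcs K n \<subseteq> {\<zero>}" using i.lie_lcs_image[of n] by simp
    moreover have "\<zero>\<^bsub>K\<^esub> = \<zero>" by (simp add: K_def)
    moreover have "\<zero>\<^bsub>K\<^esub> \<in> lie_lcs K n" using i.A.subspace_lie_lcs i.A.subspace_zero by blast
    ultimately have "lie_lcs K n = {\<zero>\<^bsub>K\<^esub>}" by auto
    then show ?thesis by (auto simp: lie_nilpotent_def)
  qed
  then show m: "malcev_lie_algebra K (\<lambda>r. lie_lcs K (r - 1))" by (rule i.A.malcev_lie_lcs)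
  then have cK: "complete_lie_algebra K (\<lambda>r. lie_lcs K (r - 1))" by (simp add: malcev_lie_algebra_iff)
  have bch_eq: "bch K (\<lambda>r. lie_lcs K (r - 1)) x y = bch L F x y" if "x \<in> rho_span" "y \<in> rho_span" for x y
  proof (rule i.hom_bch[OF cK complete_lie_algebra_axioms])
    show "(\<lambda>x. x) ` lie_lcs K (r - 1) \<subseteq> F r" if "r \<ge> 1" for r
      using i.lie_lcs_image[of "r - 1"] lcs_subset_F[of "r - 1"] that by auto
  qed (use that in \<open>simp_all add: K_def\<close>)
  then show "x \<in> rho_span \<Longrightarrow> y \<in> rho_span \<Longrightarrow> bch K (\<lambda>r. lie_lcs K (r - 1)) x y = bch L F x y" .
  have mem: "\<rho> g \<in> rho_span" if "g \<in> carrier G" for g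
    using that rat_span_superset[of "\<rho> ` carrier G"] by auto
  then show "\<rho> \<in> hom G (exp_group K (\<lambda>r. lie_lcs K (r - 1)))"
    using bch_eq[OF mem mem] by (intro homI) (auto simp: exp_group_def K_def rho_mult simp del: One_nat_def)
qed

end

text \<open>Each induction step applies \<open>bracket_mem_span_derived\<close> to the subgroup
  \<open>G^(j)\<close>. When \<open>\<rho>\<close> is trivial on \<open>G^(i)\<close>, it follows
  that \<open>\<Phi>\<close> kills the \<open>i\<close>-th derived algebra of
  \<open>A\<close>.\<close>

lemma (in nilpotent_exp_hom) hom_lie_derived_subset:
  assumes A: "lie_algebra_hom A L \<Phi>" and im: "\<Phi> ` carrier A \<subseteq> rho_span"
  shows "\<Phi> ` lie_derived A j \<subseteq> rat_span L (\<rho> ` derived_series G j)"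
proof (induction j)
  case 0
  then show ?case using im by (simp add: derived_series_def)
next
  case (Suc j)
  interpret \<Phi>: lie_algebra_hom A L \<Phi> by (rule A)
  let ?D = "derived_series G j" and ?W = "rat_span L (\<rho> ` derived_series G (Suc j))"
  have D: "subgroup ?D G" using G.derived_series_normal normal_imp_subgroup by blast
  have c: "\<rho> ` derived_series G k \<subseteq> carrier L" for k
    using G.derived_series_normal[of k] normal_imp_subgroup subgroup.subset by fastforce
  then have W: "rat_subspace ?W" by (intro rat_span_subspace)
  have "lie_product L (rat_span L (\<rho> ` ?D)) (rat_span L (\<rho> ` ?D)) \<subseteq> ?W"
    using c bracket_mem_span_derived[OF D] by (intro lie_product_span_subset[OF W]) (auto simp: derived_series_def)
  then have br: "x \<otimes> y \<in> ?W" if "x \<in> rat_span L (\<rho> ` ?D)" "y \<in> rat_span L (\<rho> ` ?D)" for x y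
    using that lie_product_memI by blast
  have "lie_derived A (Suc j) \<subseteq> {x\<in>carrier A. \<Phi> x \<in> ?W}"
    unfolding lie_derived.simps(2)
  proof (rule \<Phi>.A.lie_product_least[OF \<Phi>.subspace_vimage[OF W]])
    fix a b assume ab: "a \<in> lie_derived A j" "b \<in> lie_derived A j"
    then have "a \<in> carrier A" "b \<in> carrier A"
      using \<Phi>.A.ideal_subspace[OF \<Phi>.A.ideal_lie_derived] \<Phi>.A.subspace_carrier by blast+
    then show "a \<otimes>\<^bsub>A\<^esub> b \<in> {x\<in>carrier A. \<Phi> x \<in> ?W}"
      using br Suc ab by (auto simp: \<Phi>.hom_bracket)
  qed
  then show ?case by blast
qed

lemma (in complete_lie_algebra) bch_coset:
  assumes "closed_ideal J" "x \<in> carrier L" "y \<in> carrier L"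
  shows "J +> bch L F x y = bch (lie_quotient L J) (quotient_filtration L J F) (J +> x) (J +> y)"
proof -
  interpret p: lie_algebra_hom L "lie_quotient L J" "\<lambda>x. J +> x"
    by (rule lie_algebra_hom_quotient[OF closed_ideal_ideal[OF assms(1)]])
  show ?thesis
    using assms by (intro p.hom_bch complete_lie_algebra_axioms complete_quotient)
      (auto simp: quotient_filtration_def)
qed

lemma lower_central_hom_image:
  assumes G: "group G" and H: "group H" and \<pi>: "\<pi> \<in> hom G H"
  shows "\<pi> ` lower_central G r \<subseteq> lower_central H r"
proof (induction r rule: induct_nat_012)
  case (ge2 r)
  interpret group_hom G H \<pi> using G H \<pi> by (simp add: group_hom_def group_hom_axioms_def)
  let ?C = "\<lambda>G. commutators G (lower_central G (Suc r)) (carrier G)"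
  have sub: "lower_central G (Suc r) \<subseteq> carrier G"
    using G.lower_central_normal normal_imp_subgroup subgroup.subset by blast
  then have C: "?C G \<subseteq> carrier G" by auto
  have "\<pi> (x \<otimes>\<^bsub>G\<^esub> y \<otimes>\<^bsub>G\<^esub> inv\<^bsub>G\<^esub> x \<otimes>\<^bsub>G\<^esub> inv\<^bsub>G\<^esub> y) \<in> ?C H"
    if x: "x \<in> lower_central G (Suc r)" and y: "y \<in> carrier G" for x y
  proof -
    have "x \<in> carrier G" using x sub by blast
    then have "\<pi> (x \<otimes>\<^bsub>G\<^esub> y \<otimes>\<^bsub>G\<^esub> inv\<^bsub>G\<^esub> x \<otimes>\<^bsub>G\<^esub> inv\<^bsub>G\<^esub> y) = \<pi> x \<otimes>\<^bsub>H\<^esub> \<pi> y \<otimes>\<^bsub>H\<^esub> inv\<^bsub>H\<^esub> \<pi> x \<otimes>\<^bsub>H\<^esub> inv\<^bsub>H\<^esub> \<pi> y"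
      using y by simp
    moreover have "\<pi> x \<in> lower_central H (Suc r)" using ge2 x by blast
    ultimately show ?thesis using hom_closed[OF y] by blast
  qed
  then have "\<pi> ` ?C G \<subseteq> ?C H" by blast
  then show ?case
    unfolding lower_central.simps generate_img[OF C, symmetric] by (rule H.mono_generate)
qed (use \<pi> in \<open>auto simp: hom_def\<close>)

subsection \<open>The universal property\<close>

text \<open>Describes the iterated quotient as \<open>L/(I + F r)\<close> through the projection
  \<open>p\<close>, so that later arguments can use elements of \<open>L\<close> instead of cosets
  of cosets.\<close>

lemma (in complete_lie_algebra) quotient_quotient:
  assumes I: "closed_ideal I" and r: "r \<ge> 1"
  defines "Q \<equiv> lie_quotient L I" and "E \<equiv> quotient_filtration L I F"
  defines "p \<equiv> \<lambda>x. E r +>\<^bsub>Q\<^esub> (I +> x)"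
  shows "carrier (lie_quotient Q (E r)) = p ` carrier L"
    and "x \<in> carrier L \<Longrightarrow> y \<in> carrier L \<Longrightarrow>
      bch (lie_quotient Q (E r)) (quotient_filtration Q (E r) E) (p x) (p y) = p (bch L F x y)"
    and "x \<in> carrier L \<Longrightarrow> y \<in> carrier L \<Longrightarrow> p x = p y \<longleftrightarrow> (\<exists>z\<in>F r. eqm I (x \<ominus> y) z)"
proof -
  interpret q: lie_algebra_hom L Q "\<lambda>x. I +> x"
    unfolding Q_def by (rule lie_algebra_hom_quotient[OF closed_ideal_ideal[OF I]])
  interpret Q: complete_lie_algebra Q E unfolding Q_def E_def by (rule complete_quotient[OF I])
  have cQ: "carrier Q = (\<lambda>x. I +> x) ` carrier L" by (simp add: Q_def carrier_lie_quotient)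
  then show "carrier (lie_quotient Q (E r)) = p ` carrier L"
    by (auto simp: q.B.carrier_lie_quotient p_def)
  assume xy: "x \<in> carrier L" "y \<in> carrier L"
  show "bch (lie_quotient Q (E r)) (quotient_filtration Q (E r) E) (p x) (p y) = p (bch L F x y)"
    unfolding p_def using xy Q.bch_coset[OF Q.closed_ideal_F[OF r]] bch_coset[OF I]
    by (simp flip: Q_def E_def)
  have "p x = p y \<longleftrightarrow> eq_mod Q (E r) (I +> x) (I +> y)"
    unfolding p_def using xy r by (intro q.B.coset_eq_iff Q.F_subspace) auto
  also have "\<dots> \<longleftrightarrow> I +> (x \<ominus> y) \<in> E r" using xy by (simp add: eq_mod_def q.hom_diff)
  also have "\<dots> \<longleftrightarrow> (\<exists>z\<in>F r. I +> (x \<ominus> y) = I +> z)" by (auto simp: E_def quotient_filtration_def)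
  also have "\<dots> \<longleftrightarrow> (\<exists>z\<in>F r. eqm I (x \<ominus> y) z)"
    using xy coset_eq_iff[OF ideal_subspace[OF closed_ideal_ideal[OF I]]] F_carrier[OF _ r] by simp
  finally show "p x = p y \<longleftrightarrow> (\<exists>z\<in>F r. eqm I (x \<ominus> y) z)" .
qed

lemma (in complete_lie_algebra) quotient_filtration_trivial:
  "r \<ge> 1 \<Longrightarrow> quotient_filtration L (F r) F r = {\<zero>\<^bsub>lie_quotient L (F r)\<^esub>}"
  using coset_eq_self_iff[OF F_subspace F_carrier] subspace_zero[OF F_subspace]
  by (auto simp: quotient_filtration_def zero_lie_quotient intro!: image_eqI[of _ _ \<zero>])

text \<open>
  The universal property of \<open>\<rho>\<close>, applied to the nilpotent Malcev Lie algebra spanned by the image of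
  \<open>h\<close> instead of the target \<open>M\<close>, shows that the extension of \<open>h\<close> has its values in that span.
\<close>

lemma (in exp_hom) lie_extension:
  fixes M :: "'c lie_record"
  assumes univ: "nilpotent_universal TYPE('c) (G Mod lower_central G r)
      (exp_group (lie_quotient L (F r)) (quotient_filtration L (F r) F)) (induced_map L (F r) \<rho>)"
    and r: "r \<ge> 1" and M: "malcev_lie_algebra M E" "lie_nilpotent M"
    and h: "h \<in> hom G (exp_group M E)" "h ` lower_central G r \<subseteq> {\<zero>\<^bsub>M\<^esub>}"
  obtains \<Phi> where "lie_algebra_hom L M \<Phi>"
    "\<And>x y. x \<in> carrier L \<Longrightarrow> y \<in> carrier L \<Longrightarrow> \<Phi> (bch L F x y) = bch M E (\<Phi> x) (\<Phi> y)"
    "\<Phi> ` F r \<subseteq> {\<zero>\<^bsub>M\<^esub>}" "\<And>g. g \<in> carrier G \<Longrightarrow> \<Phi> (\<rho> g) = h g"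
    "\<Phi> ` carrier L \<subseteq> rat_span M (h ` carrier G)"
proof -
  obtain m where m: "m \<ge> 1" "E m = {\<zero>\<^bsub>M\<^esub>}" using nilpotent_malcev_filtration[OF M] .
  have cM: "complete_lie_algebra M E" using M by (simp add: malcev_lie_algebra_iff)
  interpret M: nilpotent_exp_hom M E G h m
    using cM m h(1) G.group_axioms
    by (simp add: nilpotent_exp_hom_def nilpotent_exp_hom_axioms_def exp_hom_def exp_hom_axioms_def)
  let ?K = "M\<lparr>carrier := M.rho_span\<rparr>" and ?EK = "\<lambda>k. lie_lcs (M\<lparr>carrier := M.rho_span\<rparr>) (k - 1)"
  note K = M.rho_span_malcev[OF M(2)]
  let ?Q = "lie_quotient L (F r)" and ?F = "quotient_filtration L (F r) F"
  let ?N = "lower_central G r" and ?\<sigma> = "induced_map L (F r) \<rho>"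
  have N: "?N \<lhd> G" by (rule G.lower_central_normal)
  have Fr: "closed_ideal (F r)" by (rule closed_ideal_F[OF r])
  have \<sigma>: "?\<sigma> (?N #>\<^bsub>G\<^esub> g) = F r +> \<rho> g" if "g \<in> carrier G" for g
    using induced_map_coset[OF N Fr rho_lower_central[OF r] that] .
  obtain f where f: "f \<in> hom (G Mod ?N) (exp_group ?K ?EK)" "\<And>g. g \<in> carrier G \<Longrightarrow> f (?N #>\<^bsub>G\<^esub> g) = h g"
    \<comment> \<open>The universal property is invoked with \<open>K\<close> as the target, so the
      extension takes its values in the span by construction.\<close>
    using FactGroup_universal[OF K(4) N] M.rho_eq_of_coset_eq[OF N h(2)] by metis
  obtain \<phi> where \<phi>: "\<phi> \<in> hom (exp_group ?Q ?F) (exp_group ?K ?EK)"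
    "\<And>X. X \<in> carrier (G Mod ?N) \<Longrightarrow> \<phi> (?\<sigma> X) = f X"
    using univ f(1) K(1,2) unfolding nilpotent_universal_def by metis
  have \<phi>_span: "\<phi> X \<in> M.rho_span" if "X \<in> carrier ?Q" for X
    using \<phi>(1) that by (auto simp: hom_def exp_group_def)
  interpret i: lie_algebra_hom ?K M "\<lambda>x. x" by (rule M.rho_span_hom)
  have \<phi>M: "\<phi> \<in> hom (exp_group ?Q ?F) (exp_group M E)"
  proof (rule homI)
    fix X Y assume "X \<in> carrier (exp_group ?Q ?F)" "Y \<in> carrier (exp_group ?Q ?F)"
    then have XY: "X \<in> carrier ?Q" "Y \<in> carrier ?Q" by (simp_all add: exp_group_def)
    then have "\<phi> (bch ?Q ?F X Y) = bch ?K ?EK (\<phi> X) (\<phi> Y)"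
      using \<phi>(1) by (simp add: hom_def exp_group_def)
    then show "\<phi> (X \<otimes>\<^bsub>exp_group ?Q ?F\<^esub> Y) = \<phi> X \<otimes>\<^bsub>exp_group M E\<^esub> \<phi> Y"
      using K(3)[OF \<phi>_span \<phi>_span, OF XY] by (simp add: exp_group_def)
    show "\<phi> X \<in> carrier (exp_group M E)"
      using \<phi>_span[OF XY(1)] i.hom_closed by (simp add: exp_group_def)
  qed
  interpret \<phi>: lie_algebra_hom ?Q M \<phi>
    by (rule exp_group_hom_is_lie_hom[OF complete_quotient[OF Fr] cM r quotient_filtration_trivial[OF r] m \<phi>M])
  interpret p: lie_algebra_hom L ?Q "\<lambda>x. F r +> x"
    by (rule lie_algebra_hom_quotient[OF F_ideal[OF r]])
  show ?thesis
  proof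
    show "lie_algebra_hom L M (\<lambda>x. \<phi> (F r +> x))"
      by (intro lie_algebra_hom.intro lie_algebra_hom_axioms.intro rat_lie_algebra_axioms
          M.rat_lie_algebra_axioms)
        (auto simp: p.hom_add p.hom_scale p.hom_bracket \<phi>.hom_add \<phi>.hom_scale \<phi>.hom_bracket)
    show "\<phi> (F r +> bch L F x y) = bch M E (\<phi> (F r +> x)) (\<phi> (F r +> y))"
      if "x \<in> carrier L" "y \<in> carrier L" for x y
      using \<phi>M that bch_coset[OF Fr that] by (simp add: hom_def exp_group_def)
    have "F r +> x = \<zero>\<^bsub>?Q\<^esub>" if "x \<in> F r" for x
      using that F_carrier[OF that r] F_subspace[OF r] by (simp add: zero_lie_quotient coset_eq_self_iff)
    then show "(\<lambda>x. \<phi> (F r +> x)) ` F r \<subseteq> {\<zero>\<^bsub>M\<^esub>}" by auto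
    show "\<phi> (F r +> \<rho> g) = h g" if g: "g \<in> carrier G" for g
      using \<phi>(2)[of "?N #>\<^bsub>G\<^esub> g"] \<sigma>[OF g] f(2)[OF g] g by (simp add: carrier_FactGroup)
    show "(\<lambda>x. \<phi> (F r +> x)) ` carrier L \<subseteq> M.rho_span" using \<phi>_span by auto
  qed
qed

text \<open>The factor map is undefined off the image; this matches the extensionality by which
  uniqueness is expressed.\<close>

lemma factor_through_image:
  assumes "\<And>x y. x \<in> A \<Longrightarrow> y \<in> A \<Longrightarrow> p x = p y \<Longrightarrow> f x = f y"
  obtains g where "g \<in> extensional (p ` A)" "\<And>x. x \<in> A \<Longrightarrow> g (p x) = f x"
proof (rule that[of "\<lambda>y\<in>p ` A. f (inv_into A p y)"])
  fix x assume x: "x \<in> A"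
  then have "inv_into A p (p x) \<in> A" "p (inv_into A p (p x)) = p x"
    by (auto intro: inv_into_into f_inv_into_f)
  then have "f (inv_into A p (p x)) = f x" using assms x by blast
  then show "(\<lambda>y\<in>p ` A. f (inv_into A p y)) (p x) = f x" using x by simp
qed simp

text \<open>Existence: the extension to \<open>L\<close> kills both \<open>I\<close> and
  \<open>F r\<close>, hence descends to \<open>L/(I + F r)\<close>. Uniqueness: pullback to
  \<open>L/F r\<close> loses no information, because \<open>p\<close> is onto.\<close>

lemma (in exp_hom) derived_quotient_universal:
  fixes i :: nat
  defines "I \<equiv> closure_in (lie_derived L i)"
  defines "Q \<equiv> lie_quotient L I" and "E \<equiv> quotient_filtration L I F"
    and "H \<equiv> G Mod derived_series G i" and "\<tau> \<equiv> induced_map L I \<rho>"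
  assumes univ: "nilpotent_universal TYPE('c) (G Mod lower_central G r)
      (exp_group (lie_quotient L (F r)) (quotient_filtration L (F r) F)) (induced_map L (F r) \<rho>)"
    and r: "r \<ge> 1"
  shows "nilpotent_universal TYPE('c) (H Mod lower_central H r)
      (exp_group (lie_quotient Q (E r)) (quotient_filtration Q (E r) E)) (induced_map Q (E r) \<tau>)"
proof -
  let ?N = "derived_series G i"
  interpret N: normal ?N G by (rule G.derived_series_normal)
  have I: "closed_ideal I" unfolding I_def by (intro closed_ideal_closure_in ideal_lie_derived)
  have NI: "\<rho> ` ?N \<subseteq> I" unfolding I_def by (rule rho_derived_series)
  have cQ: "complete_lie_algebra Q E" unfolding Q_def E_def by (rule complete_quotient[OF I])
  interpret H: group H unfolding H_def by (rule N.factorgroup_is_group)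
  have \<tau>: "\<tau> \<in> hom H (exp_group Q E)" "\<And>g. g \<in> carrier G \<Longrightarrow> \<tau> (?N #>\<^bsub>G\<^esub> g) = I +> \<rho> g"
    unfolding \<tau>_def H_def Q_def E_def
    using induced_map_hom[OF N.normal_axioms I NI] by blast+
  interpret Q: exp_hom Q E H \<tau>
    using cQ \<tau>(1) H.group_axioms by (simp add: exp_hom_def exp_hom_axioms_def)
  let ?C = "lower_central H r" and ?\<sigma> = "induced_map Q (E r) \<tau>"
  interpret C: normal ?C H by (rule H.lower_central_normal)
  define p where "p = (\<lambda>x. E r +>\<^bsub>Q\<^esub> (I +> x))"
  define \<pi> where "\<pi> = (\<lambda>g. ?C #>\<^bsub>H\<^esub> (?N #>\<^bsub>G\<^esub> g))"
  let ?P = "exp_group (lie_quotient Q (E r)) (quotient_filtration Q (E r) E)"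
  note qq = quotient_quotient[OF I r, folded Q_def E_def, folded p_def]
  have carrier_P: "carrier ?P = p ` carrier L" using qq(1) by (simp add: exp_group_def)
  have mult_P: "p x \<otimes>\<^bsub>?P\<^esub> p y = p (bch L F x y)" if "x \<in> carrier L" "y \<in> carrier L" for x y
    using qq(2)[OF that] by (simp add: exp_group_def p_def)
  have p_eq_iff: "p x = p y \<longleftrightarrow> (\<exists>z\<in>F r. eqm I (x \<ominus> y) z)" if "x \<in> carrier L" "y \<in> carrier L" for x y
    using qq(3)[OF that] by (simp add: p_def)
  have \<pi>_hom: "\<pi> \<in> hom G (H Mod ?C)"
  proof -
    have "(\<lambda>h. ?C #>\<^bsub>H\<^esub> h) \<circ> (\<lambda>g. ?N #>\<^bsub>G\<^esub> g) \<in> hom G (H Mod ?C)"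
      using N.r_coset_hom_Mod C.r_coset_hom_Mod unfolding H_def by (rule Group.hom_compose)
    then show ?thesis by (simp add: \<pi>_def comp_def)
  qed
  have carrier_HC: "carrier (H Mod ?C) = \<pi> ` carrier G"
    by (auto simp: carrier_FactGroup \<pi>_def H_def)
  have \<sigma>_\<pi>: "?\<sigma> (\<pi> g) = p (\<rho> g)" if g: "g \<in> carrier G" for g
  proof -
    have "?N #>\<^bsub>G\<^esub> g \<in> carrier H" using g by (auto simp: H_def carrier_FactGroup)
    then show ?thesis
      using Q.induced_map_coset[OF C.normal_axioms Q.closed_ideal_F[OF r] Q.rho_lower_central[OF r]] \<tau>(2)[OF g]
      by (simp add: \<pi>_def p_def)
  qed
  show ?thesis
    unfolding nilpotent_universal_def
  proof (intro allI impI ballI)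
    fix M :: "'c lie_record" and EM f
    assume M: "malcev_lie_algebra M EM \<and> lie_nilpotent M" and f: "f \<in> hom (H Mod ?C) (exp_group M EM)"
    have cM: "complete_lie_algebra M EM" using M by (simp add: malcev_lie_algebra_iff)
    define h where "h = (\<lambda>g. f (\<pi> g))"
    have h: "h \<in> hom G (exp_group M EM)"
      using Group.hom_compose[OF \<pi>_hom f] by (simp add: h_def comp_def)
    interpret HC: exp_hom M EM "H Mod ?C" f
      using cM f C.factorgroup_is_group by (simp add: exp_hom_def exp_hom_axioms_def)
    obtain m where m: "m \<ge> 1" "EM m = {\<zero>\<^bsub>M\<^esub>}" using nilpotent_malcev_filtration M by blast
    interpret M: nilpotent_exp_hom M EM G h m
      using cM m h G.group_axioms
      by (simp add: nilpotent_exp_hom_def nilpotent_exp_hom_axioms_def exp_hom_def exp_hom_axioms_def)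
    have h_one: "h g = \<zero>\<^bsub>M\<^esub>" if "\<pi> g = \<one>\<^bsub>H Mod ?C\<^esub>" for g
      using that HC.rho_one by (simp add: h_def)
    have h_lcs: "h ` lower_central G r \<subseteq> {\<zero>\<^bsub>M\<^esub>}"
    proof (intro image_subsetI)
      fix g assume g: "g \<in> lower_central G r"
      have "?N #>\<^bsub>G\<^esub> g \<in> ?C"
        using lower_central_hom_image[OF G.group_axioms H.group_axioms, of "\<lambda>g. ?N #>\<^bsub>G\<^esub> g" r]
          N.r_coset_hom_Mod g unfolding H_def by blast
      then have "\<pi> g = ?C"
        unfolding \<pi>_def using C.subset by (intro H.coset_join2[OF _ C.subgroup_axioms]) auto
      then show "h g \<in> {\<zero>\<^bsub>M\<^esub>}" using h_one by simp
    qed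
    have h_N: "h ` ?N \<subseteq> {\<zero>\<^bsub>M\<^esub>}"
    proof (intro image_subsetI)
      fix g assume g: "g \<in> ?N"
      then have "?N #>\<^bsub>G\<^esub> g = \<one>\<^bsub>H\<^esub>"
        unfolding H_def using N.subset by (simp add: G.coset_join2[OF _ N.subgroup_axioms] subset_iff)
      then have "\<pi> g = ?C"
        unfolding \<pi>_def using C.one_closed by (simp add: H.coset_join2[OF _ C.subgroup_axioms])
      then show "h g \<in> {\<zero>\<^bsub>M\<^esub>}" using h_one by simp
    qed
    obtain \<Phi> where \<Phi>: "lie_algebra_hom L M \<Phi>"
      "\<And>x y. x \<in> carrier L \<Longrightarrow> y \<in> carrier L \<Longrightarrow> \<Phi> (bch L F x y) = bch M EM (\<Phi> x) (\<Phi> y)"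
      "\<Phi> ` F r \<subseteq> {\<zero>\<^bsub>M\<^esub>}" "\<And>g. g \<in> carrier G \<Longrightarrow> \<Phi> (\<rho> g) = h g"
      "\<Phi> ` carrier L \<subseteq> M.rho_span"
      using lie_extension[OF univ r _ _ h h_lcs] M by metis
    interpret \<Phi>: lie_algebra_hom L M \<Phi> by (rule \<Phi>(1))
    have \<Phi>_F: "\<Phi> x = \<zero>\<^bsub>M\<^esub>" if "x \<in> F r" for x using \<Phi>(3) that by blast
    \<comment> \<open>An element of the closure differs from one of the derived algebra by an
      element of \<open>F r\<close>, which \<open>\<Phi>\<close> kills; approximation at the single
      precision \<open>r\<close> is enough.\<close>
    have \<Phi>_I: "\<Phi> j = \<zero>\<^bsub>M\<^esub>" if j: "j \<in> I" for j
    proof -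
      obtain a where a: "a \<in> lie_derived L i" "eqm (F r) j a"
        using closure_inE[OF j[unfolded I_def] r] .
      have "rat_span M (h ` ?N) \<subseteq> {\<zero>\<^bsub>M\<^esub>}"
        using h_N by (intro HC.rat_span_least HC.subspace_trivial)
      then have "\<Phi> a = \<zero>\<^bsub>M\<^esub>" using M.hom_lie_derived_subset[OF \<Phi>(1,5), of i] a(1) by blast
      moreover have "\<Phi> j = \<Phi> (j \<ominus> a) \<oplus>\<^bsub>M\<^esub> \<Phi> a"
        using eqm_carrier[OF a(2)] by (simp flip: \<Phi>.hom_add)
      ultimately show ?thesis using \<Phi>_F[of "j \<ominus> a"] a(2) by (simp add: eq_mod_def)
    qed
    \<comment> \<open>Equality under \<open>p\<close> means that \<open>x \<ominus> y\<close> is a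
      sum of an element of \<open>I\<close> and one of \<open>F r\<close>; both are sent to
      zero.\<close>
    have \<Phi>_p: "\<Phi> x = \<Phi> y" if xy: "x \<in> carrier L" "y \<in> carrier L" "p x = p y" for x y
    proof -
      obtain z where z: "z \<in> F r" "eqm I (x \<ominus> y) z" using p_eq_iff[OF xy(1,2)] xy(3) by blast
      have zc: "z \<in> carrier L" using F_carrier[OF z(1) r] .
      have "x = ((x \<ominus> y) \<ominus> z \<oplus> z) \<oplus> y" using xy zc by simp
      then have "\<Phi> x = (\<Phi> ((x \<ominus> y) \<ominus> z) \<oplus>\<^bsub>M\<^esub> \<Phi> z) \<oplus>\<^bsub>M\<^esub> \<Phi> y"
        using xy zc by (metis \<Phi>.hom_add a_closed minus_closed)
      then show ?thesis using \<Phi>_I[of "(x \<ominus> y) \<ominus> z"] \<Phi>_F[OF z(1)] z(2) xy by (simp add: eq_mod_def)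
    qed
    obtain \<psi> where \<psi>: "\<psi> \<in> extensional (p ` carrier L)" "\<And>x. x \<in> carrier L \<Longrightarrow> \<psi> (p x) = \<Phi> x"
      using factor_through_image[of "carrier L" p \<Phi>] \<Phi>_p by blast
    let ?ext = "\<lambda>\<psi>. \<psi> \<in> hom ?P (exp_group M EM) \<and> \<psi> \<in> extensional (carrier ?P) \<and>
        (\<forall>X\<in>carrier (H Mod ?C). \<psi> (?\<sigma> X) = f X)"
    have \<psi>_prop: "?ext \<psi>"
    proof (intro conjI ballI homI)
      fix X Y assume "X \<in> carrier ?P" "Y \<in> carrier ?P"
      then obtain x y where xy: "x \<in> carrier L" "y \<in> carrier L" "X = p x" "Y = p y"
        unfolding carrier_P by blast
      show "\<psi> (X \<otimes>\<^bsub>?P\<^esub> Y) = \<psi> X \<otimes>\<^bsub>exp_group M EM\<^esub> \<psi> Y"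
        unfolding xy(3,4) mult_P[OF xy(1,2)] using xy(1,2) by (simp add: \<psi>(2) \<Phi>(2) exp_group_def)
    next
      fix X assume "X \<in> carrier (H Mod ?C)"
      then obtain g where g: "g \<in> carrier G" "X = \<pi> g" unfolding carrier_HC by blast
      then show "\<psi> (?\<sigma> X) = f X" using \<sigma>_\<pi>[OF g(1)] \<psi>(2) \<Phi>(4) by (simp add: h_def)
    next
      show "\<psi> \<in> extensional (carrier ?P)" using \<psi>(1) unfolding carrier_P .
    next
      fix X assume "X \<in> carrier ?P"
      then show "\<psi> X \<in> carrier (exp_group M EM)"
        unfolding carrier_P using \<psi>(2) by (auto simp: exp_group_def)
    qed
    let ?Q1 = "lie_quotient L (F r)" and ?F1 = "quotient_filtration L (F r) F" and ?p1 = "\<lambda>x. F r +> x"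
    let ?P1 = "exp_group ?Q1 ?F1" and ?\<Gamma> = "lower_central G r" and ?\<sigma>1 = "induced_map L (F r) \<rho>"
    have \<Gamma>: "?\<Gamma> \<lhd> G" by (rule G.lower_central_normal)
    have Fr: "closed_ideal (F r)" by (rule closed_ideal_F[OF r])
    obtain f1 where f1: "f1 \<in> hom (G Mod ?\<Gamma>) (exp_group M EM)" "\<And>g. g \<in> carrier G \<Longrightarrow> f1 (?\<Gamma> #>\<^bsub>G\<^esub> g) = h g"
      using FactGroup_universal[OF h \<Gamma>] M.rho_eq_of_coset_eq[OF \<Gamma> h_lcs] by metis
    let ?ext1 = "\<lambda>\<phi>. \<phi> \<in> hom ?P1 (exp_group M EM) \<and> \<phi> \<in> extensional (carrier ?P1) \<and>
        (\<forall>X\<in>carrier (G Mod ?\<Gamma>). \<phi> (?\<sigma>1 X) = f1 X)"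
    have carrier_P1: "carrier ?P1 = ?p1 ` carrier L" by (simp add: exp_group_def carrier_lie_quotient)
    have p1_p: "p x = p y" if xy: "x \<in> carrier L" "y \<in> carrier L" "?p1 x = ?p1 y" for x y
    proof -
      have "x \<ominus> y \<in> F r" using xy coset_eq_iff[OF F_subspace[OF r]] by (simp add: eq_mod_def)
      moreover have "eqm I (x \<ominus> y) (x \<ominus> y)"
        using xy eqm_refl[OF ideal_subspace[OF closed_ideal_ideal[OF I]]] by simp
      ultimately show ?thesis using p_eq_iff[OF xy(1,2)] by blast
    qed
    \<comment> \<open>Composition with the projection from \<open>L/F r\<close> turns any extension
      of \<open>f\<close> into an extension of \<open>f1\<close>, the map induced by
      \<open>h\<close> on the nilpotent quotient of \<open>G\<close>.\<close>
    have pullback: "\<exists>\<phi>. ?ext1 \<phi> \<and> (\<forall>x\<in>carrier L. \<phi> (?p1 x) = \<psi>' (p x))"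
      if \<psi>': "\<psi>' \<in> hom ?P (exp_group M EM)" "\<forall>X\<in>carrier (H Mod ?C). \<psi>' (?\<sigma> X) = f X" for \<psi>'
    proof -
      obtain \<phi> where \<phi>: "\<phi> \<in> extensional (?p1 ` carrier L)"
        "\<And>x. x \<in> carrier L \<Longrightarrow> \<phi> (?p1 x) = \<psi>' (p x)"
        using factor_through_image[of "carrier L" ?p1 "\<lambda>x. \<psi>' (p x)"] p1_p by metis
      have "\<phi> \<in> hom ?P1 (exp_group M EM)"
      proof (rule homI)
        fix X Y assume "X \<in> carrier ?P1" "Y \<in> carrier ?P1"
        then obtain x y where xy: "x \<in> carrier L" "y \<in> carrier L" "X = ?p1 x" "Y = ?p1 y"
          unfolding carrier_P1 by blast
        have "X \<otimes>\<^bsub>?P1\<^esub> Y = ?p1 (bch L F x y)"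
          using bch_coset[OF Fr xy(1,2)] xy(3,4) by (simp add: exp_group_def)
        moreover have "\<psi>' (p (bch L F x y)) = \<psi>' (p x) \<otimes>\<^bsub>exp_group M EM\<^esub> \<psi>' (p y)"
          using hom_mult[OF \<psi>'(1), of "p x" "p y"] mult_P[OF xy(1,2)] xy(1,2) by (simp add: carrier_P)
        ultimately show "\<phi> (X \<otimes>\<^bsub>?P1\<^esub> Y) = \<phi> X \<otimes>\<^bsub>exp_group M EM\<^esub> \<phi> Y"
          unfolding xy(3,4) using xy(1,2) by (simp only: \<phi>(2) bch_closed)
      next
        fix X assume "X \<in> carrier ?P1"
        then obtain x where x: "x \<in> carrier L" "X = ?p1 x" unfolding carrier_P1 by blast
        then show "\<phi> X \<in> carrier (exp_group M EM)"
          unfolding x(2) \<phi>(2)[OF x(1)] using \<psi>'(1) by (intro hom_in_carrier[of \<psi>']) (auto simp: carrier_P)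
      qed
      moreover have "\<phi> \<in> extensional (carrier ?P1)" unfolding carrier_P1 by (rule \<phi>(1))
      moreover have "\<phi> (?\<sigma>1 X) = f1 X" if X: "X \<in> carrier (G Mod ?\<Gamma>)" for X
      proof -
        obtain g where g: "g \<in> carrier G" "X = ?\<Gamma> #>\<^bsub>G\<^esub> g" using X by (auto simp: carrier_FactGroup)
        have "\<phi> (?\<sigma>1 X) = \<psi>' (p (\<rho> g))"
          using induced_map_coset[OF \<Gamma> Fr rho_lower_central[OF r] g(1)] g \<phi>(2)[of "\<rho> g"] by simp
        also have "\<dots> = h g"
          using \<psi>'(2) \<sigma>_\<pi>[OF g(1)] g(1) unfolding carrier_HC h_def by (metis imageI)
        finally show ?thesis using f1(2) g by simp
      qed
      ultimately show ?thesis using \<phi>(2) by blast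
    qed
    have unique: "\<exists>!\<phi>. ?ext1 \<phi>"
      using univ[unfolded nilpotent_universal_def, rule_format, of M EM f1] M f1(1) by blast
    show "\<exists>!\<psi>. ?ext \<psi>"
    proof (rule ex1I[where a = \<psi>])
      show "?ext \<psi>" by (rule \<psi>_prop)
    next
      fix \<psi>'
      assume \<psi>': "?ext \<psi>'"
      obtain \<phi>' where \<phi>': "?ext1 \<phi>'" "\<And>x. x \<in> carrier L \<Longrightarrow> \<phi>' (?p1 x) = \<psi>' (p x)"
        using pullback[of \<psi>'] \<psi>' by blast
      obtain \<phi> where \<phi>: "?ext1 \<phi>" "\<And>x. x \<in> carrier L \<Longrightarrow> \<phi> (?p1 x) = \<psi> (p x)"
        using pullback[of \<psi>] \<psi>_prop by blast
      have "\<phi>' = \<phi>" using unique \<phi>'(1) \<phi>(1) by blast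
      then have "\<psi>' (p x) = \<psi> (p x)" if "x \<in> carrier L" for x using \<phi>'(2) \<phi>(2) that by metis
      then show "\<psi>' = \<psi>" using \<psi>' \<psi>(1) unfolding carrier_P
        by (intro extensionalityI[of _ "p ` carrier L"]) auto
    qed
  qed
qed

theorem theorem3p5:
  fixes G :: "('g, 'm) monoid_scheme"
    and L :: "'a lie_record"
    and F :: "nat \<Rightarrow> 'a set"
    and \<rho> :: "'g \<Rightarrow> 'a"
    and i :: nat
  assumes "group G"
    and "malcev_completion TYPE('c) G L F \<rho>"
    and "i \<ge> 1"
  shows "malcev_completion TYPE('c)
           (G Mod derived_series G i)
           (lie_quotient L (derived_closure L F i))
           (quotient_filtration L (derived_closure L F i) F)
           (induced_map L (derived_closure L F i) \<rho>)"
proof -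
  have m: "malcev_lie_algebra L F" and \<rho>: "\<rho> \<in> hom G (exp_group L F)"
    and univ: "\<And>r. r \<ge> 1 \<Longrightarrow> nilpotent_universal TYPE('c) (G Mod lower_central G r)
        (exp_group (lie_quotient L (F r)) (quotient_filtration L (F r) F)) (induced_map L (F r) \<rho>)"
    using assms(2) by (auto simp: malcev_completion_def)
  interpret exp_hom L F G \<rho>
    using m \<rho> assms(1) by (simp add: malcev_lie_algebra_iff exp_hom_def exp_hom_axioms_def)
  have "lie_derived L i \<subseteq> carrier L"
    using ideal_subspace[OF ideal_lie_derived] subspace_subset by blast
  \<comment> \<open>The topological closure of the statement is replaced by the one defined through
    congruences.\<close>
  then have I_eq: "derived_closure L F i = closure_in (lie_derived L i)"
    by (simp add: derived_closure_def closure_of_filtration)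
  have I: "closed_ideal (closure_in (lie_derived L i))"
    by (intro closed_ideal_closure_in ideal_lie_derived)
  show ?thesis
    unfolding malcev_completion_def I_eq
  proof (intro conjI allI impI)
    show "malcev_lie_algebra (lie_quotient L (closure_in (lie_derived L i)))
        (quotient_filtration L (closure_in (lie_derived L i)) F)"
      using m I by (intro malcev_quotient) (simp_all add: malcev_lie_algebra_iff)
    show "induced_map L (closure_in (lie_derived L i)) \<rho> \<in> hom (G Mod derived_series G i)
        (exp_group (lie_quotient L (closure_in (lie_derived L i)))
          (quotient_filtration L (closure_in (lie_derived L i)) F))"
      by (rule induced_map_in_hom[OF G.derived_series_normal I rho_derived_series])
  qed (rule derived_quotient_universal[OF univ])
qed

end
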